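(* For each $(p,q,d)\in\{(6,6,1),\,(4,8,1),\,(4,4,2)\}$, Gaussians maximize the Strichartz inequality $$\big\|\,\|e^{it\Delta}f(\boldsymbol x)\|_{L^p(\mathrm{d}\boldsymbol x)}\big\|_{L^q(\mathrm{d}t)}\le C\,\|f\|_{L^2(\mathbb{R}^d,\mathrm{d}\boldsymbol x)},\qquad f\in L^2(\mathbb{R}^d,\mathrm{d}\boldsymbol x).$$
   Context: $e^{it\Delta}f(\boldsymbol x)$ is the solution of $\partial_t u=i\Delta u$ on $\mathbb{R}^d\times\mathbb{R}$ with $u(\boldsymbol x,0)=f(\boldsymbol x)$; $\boldsymbol x$ ranges over $\mathbb{R}^d$ and $t$ over $\mathbb{R}$; functions are complex valued. "Gaussians maximize the Strichartz inequality" means that the functions $f(\boldsymbol x)=Ae^{-B\|\boldsymbol x\|^2+\boldsymbol u\cdot\boldsymbol x}$ with $A,B\in\mathbb{C}$, $A\ne0$, $\mathrm{Re}\,B>0$, $\boldsymbol u\in\mathbb{C}^d$, attain the supremum of $\big\|\|e^{it\Delta}f\|_{L^p(\mathrm{d}\boldsymbol x)}\big\|_{L^q(\mathrm{d}t)}/\|f\|_{L^2}$ over nonzero $f\in L^2(\mathbb{R}^d)$; equivalently, the inequality holds with $C=C(p,d)=\big(p^{-1/(2p)}2^{1/p-1/4}\big)^d$. *)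

theory Defs
  imports "HOL-Analysis.Analysis"
begin

section \<open>Lebesgue norms\<close>

definition ennreal_powr :: "ennreal \<Rightarrow> real \<Rightarrow> ennreal" where
  "ennreal_powr x r = (if x = \<infinity> then \<infinity> else ennreal (enn2real x powr r))"

text \<open>
  The exponents \<open>p\<close>, \<open>q\<close> are meant to lie in \<open>{1..}\<close>; the norms are \<open>\<infinity>\<close> when the integral diverges.
\<close>

definition Lp_norm :: "real \<Rightarrow> ('a::euclidean_space \<Rightarrow> complex) \<Rightarrow> ennreal" where
  "Lp_norm p f = ennreal_powr (\<integral>\<^sup>+x. ennreal (norm (f x) powr p) \<partial>lborel) (1 / p)"

definition mixed_norm :: "real \<Rightarrow> real \<Rightarrow> (real \<Rightarrow> 'a::euclidean_space \<Rightarrow> complex) \<Rightarrow> ennreal" where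
  "mixed_norm p q u =
     ennreal_powr (\<integral>\<^sup>+t. ennreal_powr (Lp_norm p (u t)) q \<partial>lborel) (1 / q)"

text \<open>
  Elements of \<open>L\<^sup>2\<close> are represented by Borel functions, without passing to the quotient by
  equality almost everywhere; every class of Lebesgue measurable functions has such a representative.
\<close>

definition L2 :: "('a::euclidean_space \<Rightarrow> complex) set" where
  "L2 = {f \<in> borel_measurable lborel. Lp_norm 2 f < \<infinity>}"

definition L2_nonzero :: "('a::euclidean_space \<Rightarrow> complex) set" where
  "L2_nonzero = {f \<in> L2. \<not> (AE x in lborel. f x = 0)}"


section \<open>The free Schroedinger evolution\<close>

definition partial_deriv ::
    "'a::euclidean_space \<Rightarrow> ('a \<Rightarrow> complex) \<Rightarrow> 'a \<Rightarrow> complex" where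
  "partial_deriv b \<phi> x = frechet_derivative \<phi> (at x) b"

definition laplacian :: "('a::euclidean_space \<Rightarrow> complex) \<Rightarrow> 'a \<Rightarrow> complex" where
  "laplacian \<phi> x = (\<Sum>b\<in>Basis. partial_deriv b (partial_deriv b \<phi>) x)"

text \<open>Twice continuously differentiable functions with compact support.\<close>

definition test_function :: "('a::euclidean_space \<Rightarrow> complex) \<Rightarrow> bool" where
  "test_function \<phi> \<longleftrightarrow>
     (\<forall>x. \<phi> differentiable (at x)) \<and>
     (\<forall>b\<in>Basis. \<forall>x. partial_deriv b \<phi> differentiable (at x)) \<and>
     (\<forall>b\<in>Basis. \<forall>c\<in>Basis. continuous_on UNIV (partial_deriv c (partial_deriv b \<phi>))) \<and>
     compact (closure {x. \<phi> x \<noteq> 0})"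

text \<open>
  \<open>u\<close> solves \<open>\<partial>\<^sub>t u = \<i>\<Delta>u\<close>, \<open>u(\<cdot>, 0) = f\<close>: since a general \<open>f\<close> in \<open>L\<^sup>2\<close> has no classical solution,
  \<open>u\<close> is an \<open>L\<^sup>2\<close>-continuous curve and the equation holds weakly in \<open>x\<close>, the Laplacian being moved to
  the test function. By mollification, smooth test functions give the same solutions.
\<close>

definition schroedinger_solution ::
    "('a::euclidean_space \<Rightarrow> complex) \<Rightarrow> (real \<Rightarrow> 'a \<Rightarrow> complex) \<Rightarrow> bool" where
  "schroedinger_solution f u \<longleftrightarrow>
     (\<forall>t. u t \<in> L2) \<and>
     (\<forall>t. ((\<lambda>s. Lp_norm 2 (\<lambda>x. u s x - u t x)) \<longlongrightarrow> 0) (at t)) \<and>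
     (AE x in lborel. u 0 x = f x) \<and>
     (\<forall>\<phi> t. test_function \<phi> \<longrightarrow>
        ((\<lambda>s. LINT x|lborel. u s x * \<phi> x) has_vector_derivative
           \<i> * (LINT x|lborel. u t x * laplacian \<phi> x)) (at t))"

text \<open>
  The solution is unique only up to a null set for each \<open>t\<close>, so a representative is chosen; the
  norms above do not depend on the choice.
\<close>

definition schroedinger_flow ::
    "('a::euclidean_space \<Rightarrow> complex) \<Rightarrow> real \<Rightarrow> 'a \<Rightarrow> complex" where
  "schroedinger_flow f = (SOME u. schroedinger_solution f u)"


section \<open>The Strichartz quotient and Gaussians\<close>

definition strichartz_quotient ::
    "real \<Rightarrow> real \<Rightarrow> ('a::euclidean_space \<Rightarrow> complex) \<Rightarrow> ennreal" where
  "strichartz_quotient p q f = mixed_norm p q (schroedinger_flow f) / Lp_norm 2 f"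

definition strichartz_const :: "real \<Rightarrow> nat \<Rightarrow> real" where
  "strichartz_const p d = (p powr (- (1 / (2 * p))) * 2 powr (1 / p - 1 / 4)) ^ d"

text \<open>The product \<open>w \<cdot> x\<close> is bilinear, without complex conjugation.\<close>

definition gaussian :: "complex \<Rightarrow> complex \<Rightarrow> complex ^ 'd \<Rightarrow> real ^ 'd \<Rightarrow> complex" where
  "gaussian A B w x =
     A * exp (- B * complex_of_real ((norm x)\<^sup>2) + (\<Sum>i\<in>UNIV. w $ i * complex_of_real (x $ i)))"

end

theory Submission
  imports Defs "HOL-Probability.Characteristic_Functions" "HOL-Real_Asymp.Real_Asymp"
begin

text \<open>
  The idea is to compute both sides on a dense set and to see that their difference is a positive
  definite form.

  A packet is the standard Gaussian times a character, and its evolution is an explicit Gaussian. Let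
  \<open>f\<close> be a finite sum of packets with evolution \<open>u\<close>. In the three cases \<open>p\<close> is even and \<open>q\<close> is \<open>p\<close> or \<open>2p\<close>, so
  the \<open>q\<close>-th power of the mixed norm is a multiple sum over tuples of packets. Group the factors \<open>u\<close> and
  \<open>cnj u\<close> separately: a product of \<open>k\<close> packets with frequencies \<open>\<xi>\<^sub>1, \<dots>, \<xi>\<^sub>k\<close> is a Gaussian with frequency
  \<open>S = \<xi>\<^sub>1 + \<dots> + \<xi>\<^sub>k\<close> that oscillates in time according to \<open>\<bar>\<xi>\<^sub>1\<bar>\<^sup>2 + \<dots> + \<bar>\<xi>\<^sub>k\<bar>\<^sup>2\<close>. The excess of this number over
  \<open>\<bar>S\<bar>\<^sup>2/k\<close> (summed over the two groups of two when \<open>q = 2p\<close>) is the square of the length of the component of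
  \<open>(\<xi>\<^sub>1, \<dots>, \<xi>\<^sub>k)\<close> orthogonal to a subspace, and what singles out the three cases is that this subspace has
  codimension two. The component is therefore a complex number \<open>b\<close>, and the parallel component is a
  complex number \<open>a\<close>, too.

  The spatial integral of the product of two such Gaussians is, up to a constant,
  \<open>\<bar>om t\<bar>\<^sup>2 exp (-\<bar>a - a'\<bar>\<^sup>2/4) exp (-(1 - \<zeta>)\<bar>b\<bar>\<^sup>2/4) cnj (exp (-(1 - \<zeta>)\<bar>b'\<bar>\<^sup>2/4))\<close>
  (\<open>packet_power_integral\<close>), where \<open>\<zeta> = ze t\<close> moves once around the unit circle and \<open>\<bar>om t\<bar>\<^sup>2 dt\<close> is a multiple of
  the arc length. So the time integral keeps the diagonal terms \<open>\<Sum>\<^sub>n (\<bar>b\<bar>\<^sup>2\<bar>b'\<bar>\<^sup>2/16)\<^sup>n / n!\<^sup>2\<close>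
  (\<open>ze_exp_integral\<close>). On the other side, the power of \<open>\<parallel>f\<parallel>\<close> is the form with kernel
  \<open>exp (-\<bar>a - a'\<bar>\<^sup>2/4) exp (-\<bar>b - b'\<bar>\<^sup>2/4)\<close>. The second factor contains
  \<open>exp (b cnj b'/4) exp (cnj b b'/4)\<close>, all terms of whose double power series are positive rank one
  kernels, and the diagonal terms are exactly those from the other side. The difference is a positive
  kernel, which is the inequality with the sharp constant (\<open>trace_inequality\<close>, and \<open>strichartz_4_4_2\<close>,
  \<open>strichartz_4_8_1\<close>, \<open>strichartz_6_6_1\<close>).

  To pass to all of \<open>L\<^sup>2\<close> one needs that packet sums are dense (\<open>packet_sums_dense\<close>), that the evolution,
  which is isometric on packet sums, extends to weak solutions (\<open>solution_exists\<close>), and that these are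
  unique, since the flow is an arbitrarily chosen solution (\<open>solution_unique\<close>). Then Fatou's lemma
  applies (\<open>strichartz_inequality\<close>). Uniqueness also identifies the flow of an arbitrary Gaussian, whose
  mixed norm is computed directly (\<open>gaussian_flow_equality\<close>).
\<close>

section \<open>Square-integrable functions\<close>

definition l2norm :: "('a::euclidean_space \<Rightarrow> complex) \<Rightarrow> real" where
  "l2norm f = sqrt (LINT x|lborel. (norm (f x))\<^sup>2)"

lemma ennreal_powr_ennreal: "ennreal_powr (ennreal x) r = ennreal (x powr r)" if "0 \<le> x"
  using that by (simp add: ennreal_powr_def)

lemma L2_iff:
  "f \<in> L2 \<longleftrightarrow> f \<in> borel_measurable lborel \<and> integrable lborel (\<lambda>x. (norm (f x))\<^sup>2)"
proof -
  have "Lp_norm 2 f < \<infinity> \<longleftrightarrow> (\<integral>\<^sup>+x. ennreal ((norm (f x))\<^sup>2) \<partial>lborel) < \<infinity>"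
    by (auto simp: Lp_norm_def ennreal_powr_def powr_numeral less_top)
  then show ?thesis
    by (auto simp: L2_def integrable_iff_bounded)
qed

lemma L2D:
  assumes "f \<in> L2"
  shows L2_measurable: "f \<in> borel_measurable lborel"
    and L2_integrable: "integrable lborel (\<lambda>x. (norm (f x))\<^sup>2)"
  using assms by (auto simp: L2_iff)

lemma l2norm_nonneg [simp]: "0 \<le> l2norm f"
  by (simp add: l2norm_def)

lemma l2norm_square: "(l2norm f)\<^sup>2 = (LINT x|lborel. (norm (f x))\<^sup>2)"
  by (simp add: l2norm_def)

lemma nn_integral_L2: "(\<integral>\<^sup>+x. ennreal ((norm (f x))\<^sup>2) \<partial>lborel) = ennreal ((l2norm f)\<^sup>2)" if "f \<in> L2"
  using nn_integral_eq_integral[OF L2_integrable[OF that]] by (simp add: l2norm_square)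

lemma Lp_norm_2_eq: "Lp_norm 2 f = ennreal (l2norm f)" if "f \<in> L2"
proof -
  have "Lp_norm 2 f = ennreal_powr (ennreal ((l2norm f)\<^sup>2)) (1/2)"
    using nn_integral_L2[OF that] by (simp add: Lp_norm_def powr_numeral)
  also have "\<dots> = ennreal (l2norm f)"
    by (simp add: ennreal_powr_ennreal powr_half_sqrt)
  finally show ?thesis .
qed

lemma L2_dominated:
  assumes "g \<in> L2" "f \<in> borel_measurable lborel" "\<And>x. norm (f x) \<le> M * norm (g x)"
  shows "f \<in> L2"
proof -
  have int: "integrable lborel (\<lambda>x. M\<^sup>2 * (norm (g x))\<^sup>2)"
    using L2_integrable[OF assms(1)] by simp
  have "(norm (f x))\<^sup>2 \<le> M\<^sup>2 * (norm (g x))\<^sup>2" for x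
    using power_mono[OF assms(3)[of x], of 2] by (simp add: power_mult_distrib)
  then have "integrable lborel (\<lambda>x. (norm (f x))\<^sup>2)"
    by (intro Bochner_Integration.integrable_bound[OF int]) (use assms(2) in auto)
  then show ?thesis using assms(2) by (simp add: L2_iff)
qed

lemma L2_add: "(\<lambda>x. f x + g x) \<in> L2" if "f \<in> L2" "g \<in> L2"
proof -
  note [measurable] = that[THEN L2_measurable]
  have int: "integrable lborel (\<lambda>x. 2 * (norm (f x))\<^sup>2 + 2 * (norm (g x))\<^sup>2)"
    using that[THEN L2_integrable] by simp
  have "(norm (f x + g x))\<^sup>2 \<le> 2 * (norm (f x))\<^sup>2 + 2 * (norm (g x))\<^sup>2" for x
  proof -
    have "(norm (f x + g x))\<^sup>2 \<le> (norm (f x) + norm (g x))\<^sup>2"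
      by (intro power_mono norm_triangle_ineq) auto
    also have "\<dots> \<le> 2 * (norm (f x))\<^sup>2 + 2 * (norm (g x))\<^sup>2"
      using sum_squares_bound[of "norm (f x)" "norm (g x)"]
      by (simp add: power2_sum)
    finally show ?thesis .
  qed
  then have "integrable lborel (\<lambda>x. (norm (f x + g x))\<^sup>2)"
    by (intro Bochner_Integration.integrable_bound[OF int]) auto
  then show ?thesis by (simp add: L2_iff)
qed

lemma L2_cmult: "(\<lambda>x. c * f x) \<in> L2" if "f \<in> L2"
  by (rule L2_dominated[OF that, of _ "norm c"]) (use L2_measurable[OF that] in \<open>auto simp: norm_mult\<close>)

lemma L2_zero [simp]: "(\<lambda>x. 0) \<in> L2"
  by (simp add: L2_iff)

lemma L2_diff: "(\<lambda>x. f x - g x) \<in> L2" if "f \<in> L2" "g \<in> L2"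
  using L2_add[OF that(1) L2_cmult[OF that(2), of "-1"]] by simp

lemma L2_sum: "(\<lambda>x. \<Sum>i\<in>I. f i x) \<in> L2" if "\<And>i. i \<in> I \<Longrightarrow> f i \<in> L2"
  using that by (induction I rule: infinite_finite_induct) (auto intro: L2_add)

lemma L2_cnj: "(\<lambda>x. cnj (f x)) \<in> L2" if "f \<in> L2"
proof -
  have "cnj \<in> borel_measurable borel"
    by (intro borel_measurable_continuous_onI continuous_intros)
  then show ?thesis
    by (intro L2_dominated[OF that, of _ 1])
       (use L2_measurable[OF that] in \<open>auto intro: measurable_compose\<close>)
qed

lemma l2norm_cmult: "l2norm (\<lambda>x. c * f x) = norm c * l2norm f"
  by (simp add: l2norm_def norm_mult power_mult_distrib real_sqrt_mult)

lemma l2norm_minus_commute: "l2norm (\<lambda>x. f x - g x) = l2norm (\<lambda>x. g x - f x)"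
  by (simp add: l2norm_def norm_minus_commute)

lemma L2_mult_integrable: "integrable lborel (\<lambda>x. f x * g x)" if "f \<in> L2" "g \<in> L2"
proof (rule Bochner_Integration.integrable_bound)
  note [measurable] = that[THEN L2_measurable]
  show "integrable lborel (\<lambda>x. (norm (f x))\<^sup>2 + (norm (g x))\<^sup>2)"
    using that[THEN L2_integrable] by simp
  show "AE x in lborel. norm (f x * g x) \<le> norm ((norm (f x))\<^sup>2 + (norm (g x))\<^sup>2)"
  proof (rule AE_I2)
    fix x
    have "norm (f x) * norm (g x) \<le> 2 * norm (f x) * norm (g x)" by simp
    also have "\<dots> \<le> (norm (f x))\<^sup>2 + (norm (g x))\<^sup>2"
      by (rule sum_squares_bound)
    finally show "norm (f x * g x) \<le> norm ((norm (f x))\<^sup>2 + (norm (g x))\<^sup>2)"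
      by (simp add: norm_mult)
  qed
  show "(\<lambda>x. f x * g x) \<in> borel_measurable lborel" by measurable
qed

lemma L2_Cauchy_Schwarz_norm:
  assumes "f \<in> L2" "g \<in> L2"
  shows "(LINT x|lborel. norm (f x) * norm (g x)) \<le> l2norm f * l2norm g"
proof -
  note [measurable] = assms[THEN L2_measurable]
  have int: "integrable lborel (\<lambda>x. norm (f x) * norm (g x))"
    using integrable_norm[OF L2_mult_integrable[OF assms]] by (simp add: norm_mult)
  let ?I = "LINT x|lborel. norm (f x) * norm (g x)"
  have I0: "0 \<le> ?I" by (simp add: integral_nonneg_AE)
  have "(\<integral>\<^sup>+x. ennreal (norm (f x)) * ennreal (norm (g x)) \<partial>lborel)\<^sup>2
      \<le> (\<integral>\<^sup>+x. (ennreal (norm (f x)))\<^sup>2 \<partial>lborel) * (\<integral>\<^sup>+x. (ennreal (norm (g x)))\<^sup>2 \<partial>lborel)"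
    by (rule Cauchy_Schwarz_nn_integral) auto
  then have "(\<integral>\<^sup>+x. ennreal (norm (f x) * norm (g x)) \<partial>lborel)\<^sup>2
      \<le> (\<integral>\<^sup>+x. ennreal ((norm (f x))\<^sup>2) \<partial>lborel) * (\<integral>\<^sup>+x. ennreal ((norm (g x))\<^sup>2) \<partial>lborel)"
    by (simp add: ennreal_mult' ennreal_power)
  then have "ennreal (?I\<^sup>2) \<le> ennreal ((l2norm f)\<^sup>2 * (l2norm g)\<^sup>2)"
    using nn_integral_eq_integral[OF int] I0
    by (simp add: nn_integral_L2[OF assms(1)] nn_integral_L2[OF assms(2)] ennreal_power ennreal_mult)
  then have "?I\<^sup>2 \<le> (l2norm f * l2norm g)\<^sup>2"
    by (simp add: power_mult_distrib)
  then show ?thesis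
    by (rule power2_le_imp_le) simp
qed

lemma L2_Cauchy_Schwarz:
  assumes "f \<in> L2" "g \<in> L2"
  shows "norm (LINT x|lborel. f x * g x) \<le> l2norm f * l2norm g"
proof -
  have "norm (LINT x|lborel. f x * g x) \<le> (LINT x|lborel. norm (f x * g x))"
    by (rule integral_norm_bound)
  with L2_Cauchy_Schwarz_norm[OF assms] show ?thesis by (simp add: norm_mult)
qed

lemma l2norm_triangle: "l2norm (\<lambda>x. f x + g x) \<le> l2norm f + l2norm g" if "f \<in> L2" "g \<in> L2"
proof (rule power2_le_imp_le)
  note int = that[THEN L2_integrable] integrable_norm[OF L2_mult_integrable[OF that], unfolded norm_mult]
  have "(LINT x|lborel. (norm (f x + g x))\<^sup>2)
      \<le> (LINT x|lborel. (norm (f x))\<^sup>2 + 2 * (norm (f x) * norm (g x)) + (norm (g x))\<^sup>2)"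
  proof (rule integral_mono)
    show "integrable lborel (\<lambda>x. (norm (f x + g x))\<^sup>2)" using L2_integrable[OF L2_add[OF that]] .
    show "integrable lborel (\<lambda>x. (norm (f x))\<^sup>2 + 2 * (norm (f x) * norm (g x)) + (norm (g x))\<^sup>2)"
      using int by simp
    show "(norm (f x + g x))\<^sup>2 \<le> (norm (f x))\<^sup>2 + 2 * (norm (f x) * norm (g x)) + (norm (g x))\<^sup>2" for x
      using power_mono[OF norm_triangle_ineq[of "f x" "g x"], of 2]
      by (simp add: power2_sum algebra_simps)
  qed
  also have "\<dots> = (l2norm f)\<^sup>2 + 2 * (LINT x|lborel. norm (f x) * norm (g x)) + (l2norm g)\<^sup>2"
    using int by (simp add: l2norm_square)
  also have "\<dots> \<le> (l2norm f + l2norm g)\<^sup>2"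
    using L2_Cauchy_Schwarz_norm[OF that] by (simp add: power2_sum)
  finally show "(l2norm (\<lambda>x. f x + g x))\<^sup>2 \<le> (l2norm f + l2norm g)\<^sup>2"
    by (simp add: l2norm_square)
qed simp

lemma l2norm_triangle_diff:
  assumes "f \<in> L2" "g \<in> L2" "h \<in> L2"
  shows "l2norm (\<lambda>x. f x - h x) \<le> l2norm (\<lambda>x. f x - g x) + l2norm (\<lambda>x. g x - h x)"
  using l2norm_triangle[OF L2_diff[OF assms(1,2)] L2_diff[OF assms(2,3)]] by simp

lemma l2norm_le_add_diff:
  assumes "f \<in> L2" "g \<in> L2"
  shows "l2norm f \<le> l2norm g + l2norm (\<lambda>x. f x - g x)"
  using l2norm_triangle[OF assms(2) L2_diff[OF assms]] by simp

lemma l2norm_eq_0_iff: "l2norm f = 0 \<longleftrightarrow> (AE x in lborel. f x = 0)" if "f \<in> L2"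
  using integral_nonneg_eq_0_iff_AE[OF L2_integrable[OF that]] by (simp add: l2norm_def)

lemma l2norm_mono:
  assumes "g \<in> L2" "f \<in> L2" "\<And>x. norm (f x) \<le> norm (g x)"
  shows "l2norm f \<le> l2norm g"
  unfolding l2norm_def
  by (intro real_sqrt_le_mono integral_mono L2_integrable assms power_mono) auto


lemma l2norm_dominated_convergence:
  fixes f :: "nat \<Rightarrow> 'a::euclidean_space \<Rightarrow> complex"
  assumes g: "g \<in> L2" and f: "\<And>n. f n \<in> borel_measurable lborel" and h: "h \<in> L2"
    and bound: "\<And>n x. norm (f n x) \<le> norm (g x)" and lim: "AE x in lborel. (\<lambda>n. f n x) \<longlonglongrightarrow> h x"
  shows "(\<lambda>n. l2norm (\<lambda>x. f n x - h x)) \<longlonglongrightarrow> 0"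
proof -
  note [measurable] = f L2_measurable[OF h] L2_measurable[OF g]
  have "(\<lambda>n. LINT x|lborel. (norm (f n x - h x))\<^sup>2) \<longlonglongrightarrow> integral\<^sup>L (lborel :: 'a measure) (\<lambda>_. 0)"
  proof (rule integral_dominated_convergence)
    show "integrable lborel (\<lambda>x. 2 * (norm (g x))\<^sup>2 + 2 * (norm (h x))\<^sup>2)"
      using L2_integrable[OF g] L2_integrable[OF h] by simp
    show "AE x in lborel. (\<lambda>n. (norm (f n x - h x))\<^sup>2) \<longlonglongrightarrow> 0"
      using lim
    proof eventually_elim
      case (elim x)
      have "(\<lambda>n. (norm (f n x - h x))\<^sup>2) \<longlonglongrightarrow> (norm (h x - h x))\<^sup>2"
        by (intro tendsto_intros elim)
      then show ?case by simp
    qed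
    show "AE x in lborel. norm ((norm (f n x - h x))\<^sup>2) \<le> 2 * (norm (g x))\<^sup>2 + 2 * (norm (h x))\<^sup>2" for n
    proof (rule AE_I2)
      fix x
      have "norm (f n x - h x) \<le> norm (g x) + norm (h x)"
        using norm_triangle_ineq4[of "f n x" "h x"] bound[of n x] by linarith
      then have "(norm (f n x - h x))\<^sup>2 \<le> (norm (g x) + norm (h x))\<^sup>2"
        by (intro power_mono) auto
      also have "\<dots> \<le> 2 * (norm (g x))\<^sup>2 + 2 * (norm (h x))\<^sup>2"
        using sum_squares_bound[of "norm (g x)" "norm (h x)"] by (simp add: power2_sum)
      finally show "norm ((norm (f n x - h x))\<^sup>2) \<le> 2 * (norm (g x))\<^sup>2 + 2 * (norm (h x))\<^sup>2"
        by simp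
    qed
  qed auto
  then have "(\<lambda>n. sqrt (LINT x|lborel. (norm (f n x - h x))\<^sup>2)) \<longlonglongrightarrow> sqrt 0"
    by (intro tendsto_real_sqrt) simp
  then show ?thesis by (simp add: l2norm_def)
qed

section \<open>Gaussian integrals\<close>

text \<open>
  Completing the square in the real part of \<open>c\<close> is a translation and leaves the characteristic function
  of the normal distribution at a multiple of the imaginary part.
\<close>

lemma gaussian_integral_real:
  fixes c :: complex and \<alpha> :: real
  assumes "\<alpha> > 0"
  shows "has_bochner_integral lborel (\<lambda>x. exp (- of_real \<alpha> * of_real (x\<^sup>2) + c * of_real x))
           (of_real (sqrt (pi / \<alpha>)) * exp (c\<^sup>2 / (4 * of_real \<alpha>)))"
proof -
  define a b where "a = Re c" and "b = Im c"
  define r k where "r = a / (2 * \<alpha>)" and "k = sqrt (2 * \<alpha>)"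
  have k: "k > 0" "k\<^sup>2 = 2 * \<alpha>" using assms by (auto simp: k_def)
  have c: "c = of_real a + \<i> * of_real b" by (simp add: a_def b_def complex_eq)
  define t where "t = b / k"
  let ?h = "\<lambda>x. std_normal_density x *\<^sub>R iexp (t * x)"
  have "integrable std_normal_distribution (\<lambda>x. iexp (t * x))"
    using real_dist_normal_dist
    by (intro finite_measure.integrable_const_bound[where B=1])
       (auto simp: real_distribution_def prob_space_def)
  then have int: "integrable lborel ?h"
    by (subst (asm) integrable_density) auto
  have "(LINT x|std_normal_distribution. iexp (t * x)) = (LINT x|lborel. ?h x)"
    by (subst integral_density) auto
  then have "(LINT x|lborel. ?h x) = of_real (exp (- t\<^sup>2 / 2))"
    using fun_cong[OF char_std_normal_distribution, of t] by (simp add: char_def)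
  with int have "has_bochner_integral lborel ?h (of_real (exp (- t\<^sup>2 / 2)))"
    by (simp add: has_bochner_integral_iff)
  then have *: "has_bochner_integral lborel (\<lambda>x. ?h (- k * r + k * x)) (of_real (exp (- t\<^sup>2 / 2)) /\<^sub>R \<bar>k\<bar>)"
    using lborel_has_bochner_integral_real_affine_iff[of k ?h "of_real (exp (- t\<^sup>2 / 2))" "- k * r"] k by auto
  \<comment> \<open>\<open>D\<close> undoes the normalisation of the density and the two phases created by the translation by \<open>r\<close>.\<close>
  define D where "D = of_real (sqrt (2 * pi)) * exp (of_real (\<alpha> * r\<^sup>2) + \<i> * of_real (b * r))"
  have "has_bochner_integral lborel (\<lambda>x. D * ?h (- k * r + k * x)) (D * (of_real (exp (- t\<^sup>2 / 2)) /\<^sub>R \<bar>k\<bar>))"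
    by (rule has_bochner_integral_mult_right) (use * in auto)
  moreover have "D * ?h (- k * r + k * x) = exp (- of_real \<alpha> * of_real (x\<^sup>2) + c * of_real x)" for x
  proof -
    have "?h (- k * r + k * x) = of_real (1 / sqrt (2 * pi)) *
        exp (of_real (- (\<alpha> * (x - r)\<^sup>2)) + \<i> * of_real (b * (x - r)))"
    proof -
      have e1: "- (- k * r + k * x)\<^sup>2 / 2 = - (\<alpha> * (x - r)\<^sup>2)"
      proof -
        have "(- k * r + k * x)\<^sup>2 = k\<^sup>2 * (x - r)\<^sup>2" by (simp add: power2_eq_square algebra_simps)
        then show ?thesis using k by simp
      qed
      have e2: "t * (- k * r + k * x) = b * (x - r)"
        using k by (simp add: t_def field_simps)
      have e3: "exp (of_real u + \<i> * of_real v) = of_real (exp u) * exp (\<i> * of_real v)" for u v :: real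
        by (simp add: exp_add exp_of_real)
      show ?thesis unfolding std_normal_density_def e1 e2 e3
        by (simp add: scaleR_conv_of_real)
    qed
    then have "D * ?h (- k * r + k * x) = exp (of_real (\<alpha> * r\<^sup>2) + \<i> * of_real (b * r)) *
        exp (of_real (- (\<alpha> * (x - r)\<^sup>2)) + \<i> * of_real (b * (x - r)))"
      unfolding D_def by simp
    also have "\<dots> = exp (- of_real \<alpha> * of_real (x\<^sup>2) + c * of_real x)"
    proof -
      have "\<alpha> * r\<^sup>2 - \<alpha> * (x - r)\<^sup>2 = - \<alpha> * x\<^sup>2 + a * x"
        using assms by (simp add: r_def power2_eq_square field_simps)
      then have "complex_of_real (\<alpha> * r\<^sup>2 - \<alpha> * (x - r)\<^sup>2) = of_real (- \<alpha> * x\<^sup>2 + a * x)"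
        by simp
      then have "of_real (\<alpha> * r\<^sup>2) - of_real (\<alpha> * (x - r)\<^sup>2) = - of_real \<alpha> * of_real (x\<^sup>2) + of_real a * (of_real x :: complex)"
        by (simp only: of_real_add of_real_diff of_real_minus of_real_mult)
      then have "of_real (\<alpha> * r\<^sup>2) + \<i> * of_real (b * r) + (of_real (- (\<alpha> * (x - r)\<^sup>2)) + \<i> * of_real (b * (x - r)))
        = - of_real \<alpha> * of_real (x\<^sup>2) + c * (of_real x :: complex)"
        unfolding c by (simp add: algebra_simps)
      then show ?thesis by (simp add: exp_add [symmetric])
    qed
    finally show ?thesis .
  qed
  moreover have "D * (of_real (exp (- t\<^sup>2 / 2)) /\<^sub>R \<bar>k\<bar>) = of_real (sqrt (pi / \<alpha>)) * exp (c\<^sup>2 / (4 * of_real \<alpha>))"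
  proof -
    have s: "sqrt (2 * pi) / k = sqrt (pi / \<alpha>)" using assms by (simp add: k_def real_sqrt_mult real_sqrt_divide)
    have "of_real (\<alpha> * r\<^sup>2) + \<i> * of_real (b * r) + of_real (- t\<^sup>2 / 2) = c\<^sup>2 / (4 * of_real \<alpha>)"
    proof -
      have "t\<^sup>2 / 2 = b\<^sup>2 / (4 * \<alpha>)" using k by (simp add: t_def power_divide)
      then have "- t\<^sup>2 / 2 = - (b\<^sup>2 / (4 * \<alpha>))" by simp
      moreover have "\<alpha> * r\<^sup>2 = a\<^sup>2 / (4 * \<alpha>)" "b * r = 2 * a * b / (4 * \<alpha>)"
        using assms by (simp_all add: r_def power2_eq_square)
      moreover have "c\<^sup>2 = of_real (a\<^sup>2) + \<i> * of_real (2 * a * b) - of_real (b\<^sup>2)"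
        unfolding c by (simp add: power2_eq_square algebra_simps)
      ultimately show ?thesis
        by (simp only: of_real_divide of_real_minus of_real_mult of_real_power of_real_numeral)
           (simp add: diff_divide_distrib add_divide_distrib)
    qed
    then have "exp (of_real (\<alpha> * r\<^sup>2) + \<i> * of_real (b * r)) * of_real (exp (- t\<^sup>2 / 2)) = exp (c\<^sup>2 / (4 * of_real \<alpha>))"
      by (simp only: exp_of_real [symmetric] exp_add [symmetric])
    moreover have "of_real (sqrt (pi / \<alpha>)) = of_real (sqrt (2 * pi)) * (of_real (inverse \<bar>k\<bar>) :: complex)"
      using k unfolding s[symmetric] by (simp add: divide_inverse)
    ultimately show ?thesis unfolding D_def scaleR_conv_of_real by (simp only: mult_ac)
  qed
  ultimately show ?thesis by simp
qed

lemma lborel_integral_prod_Basis: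
  fixes h :: "'a::euclidean_space \<Rightarrow> real \<Rightarrow> complex"
  assumes "\<And>b. b \<in> Basis \<Longrightarrow> has_bochner_integral lborel (h b) (I b)"
  shows "has_bochner_integral lborel (\<lambda>x::'a. \<Prod>b\<in>Basis. h b (x \<bullet> b)) (\<Prod>b\<in>Basis. I b)"
proof -
  interpret product_sigma_finite "\<lambda>_::'a. lborel :: real measure" ..
  have int: "integrable lborel (h b)" if "b \<in> Basis" for b
    using assms[OF that] by (simp add: has_bochner_integral_iff)
  have [measurable]: "h b \<in> borel_measurable borel" if "b \<in> Basis" for b
    using borel_measurable_integrable[OF int[OF that]] by simp
  have eq: "(\<Prod>b\<in>Basis. h b ((\<Sum>c\<in>Basis. f c *\<^sub>R c) \<bullet> b)) = (\<Prod>b\<in>Basis. h b (f b))" for f :: "'a \<Rightarrow> real"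
    by (intro prod.cong refl) simp
  have m: "(\<lambda>f. \<Sum>b\<in>Basis. f b *\<^sub>R b) \<in> measurable (\<Pi>\<^sub>M b\<in>(Basis::'a set). lborel :: real measure) borel"
    by measurable
  have i: "integrable lborel (\<lambda>x::'a. \<Prod>b\<in>Basis. h b (x \<bullet> b))"
    by (subst lborel_eq, subst integrable_distr_eq[OF m]) (auto simp: eq intro!: product_integrable_prod int)
  have "(LINT x|lborel. (\<Prod>b\<in>Basis. h b ((x::'a) \<bullet> b))) = (\<Prod>b\<in>Basis. LINT x|lborel. h b x)"
    by (subst lborel_eq, subst integral_distr[OF m]) (auto simp: eq intro!: product_integral_prod int)
  also have "\<dots> = (\<Prod>b\<in>Basis. I b)"
    by (intro prod.cong refl has_bochner_integral_integral_eq assms)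
  finally show ?thesis using i by (simp add: has_bochner_integral_iff)
qed

text \<open>
  The bilinear product, \<open>w\<close> being given by its coefficients in the standard basis; in this form the
  Gaussians make sense in every Euclidean space, not only in \<open>\<real>\<^sup>n\<close> indexed by a finite type.
\<close>

definition cdot :: "('a::euclidean_space \<Rightarrow> complex) \<Rightarrow> 'a \<Rightarrow> complex" where
  "cdot w x = (\<Sum>b\<in>Basis. w b * of_real (x \<bullet> b))"

lemma norm_square_Basis: "(norm x)\<^sup>2 = (\<Sum>b\<in>Basis. (x \<bullet> b)\<^sup>2)" for x :: "'a::euclidean_space"
  unfolding power2_norm_eq_inner euclidean_inner[of x x] by (simp add: power2_eq_square)

lemma cdot_of_real: "cdot (\<lambda>b. c * of_real (y \<bullet> b)) x = c * of_real (y \<bullet> x)"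
  unfolding euclidean_inner[of y x] by (simp add: cdot_def sum_distrib_left mult.assoc)

theorem gaussian_integral:
  fixes w :: "'a::euclidean_space \<Rightarrow> complex"
  assumes "\<alpha> > 0"
  shows "has_bochner_integral lborel (\<lambda>x. exp (- of_real \<alpha> * of_real ((norm x)\<^sup>2) + cdot w x))
           (of_real (sqrt (pi / \<alpha>)) ^ DIM('a) * exp ((\<Sum>b\<in>Basis. (w b)\<^sup>2) / (4 * of_real \<alpha>)))"
proof -
  have "has_bochner_integral lborel
      (\<lambda>x::'a. \<Prod>b\<in>Basis. exp (- of_real \<alpha> * of_real ((x \<bullet> b)\<^sup>2) + w b * of_real (x \<bullet> b)))
      (\<Prod>b\<in>(Basis::'a set). of_real (sqrt (pi / \<alpha>)) * exp ((w b)\<^sup>2 / (4 * of_real \<alpha>)))"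
    by (rule lborel_integral_prod_Basis
        [where h = "\<lambda>b y. exp (- of_real \<alpha> * of_real (y\<^sup>2) + w b * of_real y)"])
       (rule gaussian_integral_real[OF assms])
  moreover have "(\<Prod>b\<in>Basis. exp (- of_real \<alpha> * of_real ((x \<bullet> b)\<^sup>2) + w b * of_real (x \<bullet> b)))
     = exp (- of_real \<alpha> * of_real ((norm x)\<^sup>2) + cdot w x)" for x :: 'a
  proof -
    have "(\<Sum>b\<in>Basis. - of_real \<alpha> * of_real ((x \<bullet> b)\<^sup>2) + w b * of_real (x \<bullet> b))
        = - of_real \<alpha> * of_real ((norm x)\<^sup>2) + cdot w x"
      by (simp only: norm_square_Basis cdot_def sum.distrib of_real_sum sum_distrib_left)
    then show ?thesis by (simp only: exp_sum[OF finite_Basis, symmetric])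
  qed
  moreover have "(\<Prod>b\<in>(Basis::'a set). of_real (sqrt (pi / \<alpha>)) * exp ((w b)\<^sup>2 / (4 * of_real \<alpha>)))
     = of_real (sqrt (pi / \<alpha>)) ^ DIM('a) * exp ((\<Sum>b\<in>Basis. (w b)\<^sup>2) / (4 * of_real \<alpha>))"
    by (simp only: prod.distrib exp_sum[OF finite_Basis, symmetric] sum_divide_distrib prod_constant)
  ultimately show ?thesis by simp
qed

section \<open>Density of finite sums of Gaussian wave packets\<close>

definition packet :: "'a::euclidean_space \<Rightarrow> 'a \<Rightarrow> complex" where
  "packet \<xi> x = exp (- of_real ((norm x)\<^sup>2) / 2 + \<i> * of_real (\<xi> \<bullet> x))"

text \<open>
  Finite sums of packets are indexed by lists: appending two lists adds the sums, and the same list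
  describes the initial datum and its evolution.
\<close>

definition packet_sum :: "(complex \<times> 'a::euclidean_space) list \<Rightarrow> 'a \<Rightarrow> complex" where
  "packet_sum l x = (\<Sum>(c, \<xi>)\<leftarrow>l. c * packet \<xi> x)"

definition packet_closure :: "('a::euclidean_space \<Rightarrow> complex) set" where
  "packet_closure = {f \<in> L2. \<forall>e>0. \<exists>l. l2norm (\<lambda>x. f x - packet_sum l x) < e}"

lemma packet_sum_simps [simp]:
  "packet_sum [] x = 0"
  "packet_sum (p # l) x = fst p * packet (snd p) x + packet_sum l x"
  "packet_sum (l @ l') x = packet_sum l x + packet_sum l' x"
  by (simp_all add: packet_sum_def split_def)

lemma packet_sum_cmult: "packet_sum (map (\<lambda>(c, \<xi>). (a * c, \<xi>)) l) x = a * packet_sum l x"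
  by (induction l) (auto simp: algebra_simps)

lemma packet_sum_modulate:
  "packet_sum (map (\<lambda>(c, \<xi>). (c, \<xi> + \<eta>)) l) x = exp (\<i> * of_real (\<eta> \<bullet> x)) * packet_sum l x"
proof (induction l)
  case (Cons p l)
  have "packet (snd p + \<eta>) x = exp (\<i> * of_real (\<eta> \<bullet> x)) * packet (snd p) x"
    by (simp add: packet_def inner_add_left algebra_simps flip: exp_add)
  then show ?case using Cons by (simp add: split_def algebra_simps)
qed simp

lemma norm_packet: "norm (packet \<xi> x) = exp (- (norm x)\<^sup>2 / 2)"
  by (simp add: packet_def)

lemma packet_measurable [measurable]: "packet \<xi> \<in> borel_measurable borel"
  unfolding packet_def by measurable

lemma gaussian_weight_L2:
  assumes "\<alpha> > 0"
  shows "(\<lambda>x::'a::euclidean_space. of_real (exp (- \<alpha> * (norm x)\<^sup>2))) \<in> L2"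
proof -
  have "integrable lborel (\<lambda>x::'a. exp (- of_real (2 * \<alpha>) * of_real ((norm x)\<^sup>2) + cdot (\<lambda>_. 0) x))"
    using gaussian_integral[of "2 * \<alpha>" "\<lambda>_::'a. 0"] assms by (simp add: has_bochner_integral_iff)
  from integrable_norm[OF this] have "integrable lborel (\<lambda>x::'a. exp (- (2 * \<alpha>) * (norm x)\<^sup>2))"
    by (simp add: cdot_def)
  moreover have "exp (- (2 * \<alpha>) * (norm x)\<^sup>2) = (norm (complex_of_real (exp (- \<alpha> * (norm x)\<^sup>2))))\<^sup>2" for x :: 'a
    by (simp add: power2_eq_square flip: exp_add)
  ultimately show ?thesis by (simp add: L2_iff)
qed

lemma packet_L2: "packet \<xi> \<in> L2"
  by (rule L2_dominated[OF gaussian_weight_L2[of "1/2"], of _ 1]) (auto simp: norm_packet)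

lemma packet_sum_L2: "packet_sum l \<in> L2"
proof (induction l)
  case Nil
  have "packet_sum [] = (\<lambda>x. 0)" by (rule ext) simp
  then show ?case by simp
next
  case (Cons p l)
  have "packet_sum (p # l) = (\<lambda>x. fst p * packet (snd p) x + packet_sum l x)" by (rule ext) simp
  then show ?case using L2_add[OF L2_cmult[OF packet_L2] Cons] by simp
qed

lemma packet_closure_L2: "f \<in> packet_closure \<Longrightarrow> f \<in> L2"
  by (simp add: packet_closure_def)

lemma packet_closureE:
  assumes "f \<in> packet_closure" "e > 0"
  obtains l where "l2norm (\<lambda>x. f x - packet_sum l x) < e"
  using assms by (auto simp: packet_closure_def)

lemma packet_closure_limit:
  assumes "f \<in> L2" "\<And>e. e > 0 \<Longrightarrow> \<exists>g\<in>packet_closure. l2norm (\<lambda>x. f x - g x) < e"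
  shows "f \<in> packet_closure"
  unfolding packet_closure_def
proof (intro CollectI conjI allI impI assms(1))
  fix e :: real assume "e > 0"
  then obtain g where g: "g \<in> packet_closure" "l2norm (\<lambda>x. f x - g x) < e / 2"
    using assms(2)[of "e/2"] by auto
  obtain l where l: "l2norm (\<lambda>x. g x - packet_sum l x) < e / 2"
    using packet_closureE[OF g(1), of "e/2"] \<open>e > 0\<close> by auto
  have "l2norm (\<lambda>x. f x - packet_sum l x) < e"
    using l2norm_triangle_diff[OF assms(1) packet_closure_L2[OF g(1)] packet_sum_L2[of l]] g(2) l by simp
  then show "\<exists>l. l2norm (\<lambda>x. f x - packet_sum l x) < e" ..
qed

lemma packet_closure_seq_limit:
  assumes "f \<in> L2" "\<And>n. g n \<in> packet_closure" "(\<lambda>n. l2norm (\<lambda>x. g n x - f x)) \<longlonglongrightarrow> 0"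
  shows "f \<in> packet_closure"
proof (rule packet_closure_limit[OF assms(1)])
  fix e :: real assume "e > 0"
  from order_tendstoD(2)[OF assms(3) this] obtain n where "l2norm (\<lambda>x. g n x - f x) < e"
    by (auto simp: eventually_sequentially)
  with assms(2)[of n] show "\<exists>g\<in>packet_closure. l2norm (\<lambda>x. f x - g x) < e"
    by (auto simp: l2norm_minus_commute[of f])
qed

lemma packet_sum_closure: "packet_sum l \<in> packet_closure"
  unfolding packet_closure_def
proof (intro CollectI conjI packet_sum_L2 allI impI)
  fix e :: real assume "e > 0"
  then show "\<exists>l'. l2norm (\<lambda>x. packet_sum l x - packet_sum l' x) < e"
    by (intro exI[of _ l]) (simp add: l2norm_def)
qed

lemma packet_closure_add:
  assumes "f \<in> packet_closure" "g \<in> packet_closure"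
  shows "(\<lambda>x. f x + g x) \<in> packet_closure"
  unfolding packet_closure_def
proof (intro CollectI conjI allI impI)
  note L2 = assms[THEN packet_closure_L2]
  show "(\<lambda>x. f x + g x) \<in> L2" by (rule L2_add[OF L2])
  fix e :: real assume "e > 0"
  obtain l where l: "l2norm (\<lambda>x. f x - packet_sum l x) < e / 2"
    using packet_closureE[OF assms(1), of "e/2"] \<open>e > 0\<close> by auto
  obtain l' where l': "l2norm (\<lambda>x. g x - packet_sum l' x) < e / 2"
    using packet_closureE[OF assms(2), of "e/2"] \<open>e > 0\<close> by auto
  have "l2norm (\<lambda>x. (f x - packet_sum l x) + (g x - packet_sum l' x)) < e"
    using l2norm_triangle[OF L2_diff[OF L2(1) packet_sum_L2[of l]] L2_diff[OF L2(2) packet_sum_L2[of l']]] l l' by simp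
  then show "\<exists>l. l2norm (\<lambda>x. f x + g x - packet_sum l x) < e"
    by (intro exI[of _ "l @ l'"]) (simp add: algebra_simps)
qed

text \<open>
  Multiplication by a bounded function is \<open>L\<^sup>2\<close>-continuous, so it preserves the closure as soon as it maps
  the packet sums there. Constants and characters map packet sums to packet sums.
\<close>

lemma packet_closure_mult:
  assumes u: "u \<in> borel_measurable borel" "\<And>x. norm (u x) \<le> M"
    and sums: "\<And>l. (\<lambda>x. u x * packet_sum l x) \<in> packet_closure"
    and f: "f \<in> packet_closure"
  shows "(\<lambda>x. u x * f x) \<in> packet_closure"
proof (rule packet_closure_limit)
  note fL = packet_closure_L2[OF f]
  note [measurable] = u(1) L2_measurable[OF fL] L2_measurable[OF packet_sum_L2]
  have M0: "0 \<le> M" using u(2)[of undefined] norm_ge_zero order_trans by blast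
  show "(\<lambda>x. u x * f x) \<in> L2"
    by (rule L2_dominated[OF fL, of _ M]) (auto simp: norm_mult u(2) intro!: mult_right_mono)
  fix e :: real assume "e > 0"
  with M0 have "e / (M + 1) > 0" by simp
  then obtain l where l: "l2norm (\<lambda>x. f x - packet_sum l x) < e / (M + 1)"
    using packet_closureE[OF f] by blast
  note D = L2_diff[OF fL packet_sum_L2[of l]]
  have DM: "(\<lambda>x. u x * (f x - packet_sum l x)) \<in> L2"
    by (rule L2_dominated[OF D, of _ M]) (auto simp: norm_mult u(2) intro!: mult_right_mono)
  have "l2norm (\<lambda>x. u x * (f x - packet_sum l x)) \<le> l2norm (\<lambda>x. of_real M * (f x - packet_sum l x))"
    using M0 by (intro l2norm_mono L2_cmult D DM) (auto simp: norm_mult u(2) intro!: mult_right_mono)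
  also have "\<dots> = M * l2norm (\<lambda>x. f x - packet_sum l x)" using M0 by (simp add: l2norm_cmult)
  also have "\<dots> \<le> (M + 1) * l2norm (\<lambda>x. f x - packet_sum l x)" by (intro mult_right_mono) auto
  also have "\<dots> < e" using l M0 by (simp add: field_simps)
  finally show "\<exists>g\<in>packet_closure. l2norm (\<lambda>x. u x * f x - g x) < e"
    by (intro bexI[OF _ sums[of l]]) (simp add: algebra_simps)
qed

lemma packet_closure_cmult: "(\<lambda>x. c * f x) \<in> packet_closure" if "f \<in> packet_closure"
proof (rule packet_closure_mult[OF _ _ _ that, of _ "norm c"])
  fix l
  have "(\<lambda>x. c * packet_sum l x) = packet_sum (map (\<lambda>(d, \<xi>). (c * d, \<xi>)) l)"
    by (rule ext) (simp add: packet_sum_cmult)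
  then show "(\<lambda>x. c * packet_sum l x) \<in> packet_closure" by (simp add: packet_sum_closure)
qed auto

lemma packet_closure_modulate:
  "(\<lambda>x. exp (\<i> * of_real (\<eta> \<bullet> x)) * f x) \<in> packet_closure" if "f \<in> packet_closure"
proof (rule packet_closure_mult[OF _ _ _ that, of _ 1])
  fix l
  have "(\<lambda>x. exp (\<i> * of_real (\<eta> \<bullet> x)) * packet_sum l x) = packet_sum (map (\<lambda>(c, \<xi>). (c, \<xi> + \<eta>)) l)"
    by (rule ext) (simp add: packet_sum_modulate)
  then show "(\<lambda>x. exp (\<i> * of_real (\<eta> \<bullet> x)) * packet_sum l x) \<in> packet_closure"
    by (simp add: packet_sum_closure)
qed auto

text \<open>
  The bounded Borel functions whose product with the standard Gaussian lies in the closure turn out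
  to be all of them: they form an algebra, closed under bounded pointwise limits, that contains the
  characters.
\<close>

definition multiplier :: "('a::euclidean_space \<Rightarrow> complex) \<Rightarrow> bool" where
  "multiplier u \<longleftrightarrow> u \<in> borel_measurable borel \<and> (\<exists>M. \<forall>x. norm (u x) \<le> M) \<and>
     (\<lambda>x. u x * packet 0 x) \<in> packet_closure"

lemma multiplierD:
  assumes "multiplier u"
  shows multiplier_measurable: "u \<in> borel_measurable borel"
    and multiplier_closure: "(\<lambda>x. u x * packet 0 x) \<in> packet_closure"
  using assms by (auto simp: multiplier_def)

lemma multiplier_const: "multiplier (\<lambda>_. c)"
proof -
  have "packet_sum [(1, 0)] = packet 0" by (rule ext) simp
  then have "packet 0 \<in> packet_closure" using packet_sum_closure[of "[(1, 0)]"] by metis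
  then show ?thesis by (auto simp: multiplier_def intro: packet_closure_cmult)
qed

lemma multiplier_character: "multiplier (\<lambda>x. exp (\<i> * of_real (\<eta> \<bullet> x)))"
proof -
  have "packet_sum [(1, 0)] = packet 0" by (rule ext) simp
  then have "packet 0 \<in> packet_closure" using packet_sum_closure[of "[(1, 0)]"] by metis
  then show ?thesis
    by (auto simp: multiplier_def intro!: packet_closure_modulate exI[of _ 1])
qed

lemma multiplier_add: "multiplier (\<lambda>x. u x + v x)" if uv: "multiplier u" "multiplier v"
proof -
  obtain M N where MN: "\<And>x. norm (u x) \<le> M" "\<And>x. norm (v x) \<le> N" using uv by (auto simp: multiplier_def)
  have "norm (u x + v x) \<le> M + N" for x by (intro norm_triangle_mono MN)
  moreover have "(\<lambda>x. (u x + v x) * packet 0 x) \<in> packet_closure"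
    using packet_closure_add[OF uv[THEN multiplier_closure]] by (simp add: algebra_simps)
  ultimately show ?thesis using uv[THEN multiplier_measurable] by (auto simp: multiplier_def)
qed

text \<open>
  A multiplier times a character is a multiplier, so \<open>u\<close> maps packet sums into the closure; now
  approximate \<open>v\<close> times the Gaussian by packet sums.
\<close>

lemma multiplier_mult: "multiplier (\<lambda>x. u x * v x)" if uv: "multiplier u" "multiplier v"
proof -
  note [measurable] = uv[THEN multiplier_measurable]
  obtain M N where MN: "\<And>x. norm (u x) \<le> M" "\<And>x. norm (v x) \<le> N" using uv by (auto simp: multiplier_def)
  have "norm (u x * v x) \<le> M * N" for x
    unfolding norm_mult by (intro mult_mono MN) (use order_trans[OF norm_ge_zero MN(1)] in auto)
  moreover have "(\<lambda>x. u x * packet_sum l x) \<in> packet_closure" for l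
  proof (induction l)
    case Nil
    show ?case using packet_sum_closure[of "[]"] by (simp add: packet_sum_def[abs_def])
  next
    case (Cons p l)
    have "(\<lambda>x. u x * packet \<xi> x) \<in> packet_closure" for \<xi>
    proof -
      have "packet \<xi> x = exp (\<i> * of_real (\<xi> \<bullet> x)) * packet 0 x" for x
        by (simp add: packet_def flip: exp_add)
      then show ?thesis using packet_closure_modulate[OF multiplier_closure[OF uv(1)], of \<xi>]
        by (simp add: mult_ac)
    qed
    from packet_closure_add[OF packet_closure_cmult[OF this[of "snd p"], of "fst p"] Cons]
    show ?case by (simp add: algebra_simps)
  qed
  then have "(\<lambda>x. u x * (v x * packet 0 x)) \<in> packet_closure"
    by (intro packet_closure_mult[OF _ MN(1) _ multiplier_closure[OF uv(2)]]) auto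
  ultimately show ?thesis by (auto simp: multiplier_def mult.assoc)
qed

lemma multiplier_sum: "multiplier (\<lambda>x. \<Sum>i\<in>I. u i x)" if "\<And>i. i \<in> I \<Longrightarrow> multiplier (u i)"
  using that
  by (induction I rule: infinite_finite_induct) (auto intro: multiplier_const multiplier_add)

lemma multiplier_limit:
  assumes u: "\<And>n. multiplier (u n)" "\<And>n x. norm (u n x) \<le> M" and lim: "\<And>x. (\<lambda>n. u n x) \<longlonglongrightarrow> v x"
  shows "multiplier v"
proof -
  note [measurable] = u(1)[THEN multiplier_measurable]
  have [measurable]: "v \<in> borel_measurable borel"
    by (rule borel_measurable_LIMSEQ_metric[OF _ lim]) simp
  have v: "norm (v x) \<le> M" for x
    by (rule LIMSEQ_le_const2[OF tendsto_norm[OF lim]]) (use u(2) in auto)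
  have M0: "0 \<le> M" using order_trans[OF norm_ge_zero v] .
  have vL: "(\<lambda>x. v x * packet 0 x) \<in> L2"
    by (rule L2_dominated[OF packet_L2[of 0], of _ M]) (auto simp: norm_mult intro!: mult_right_mono v)
  have "(\<lambda>n. l2norm (\<lambda>x. u n x * packet 0 x - v x * packet 0 x)) \<longlonglongrightarrow> 0"
    by (rule l2norm_dominated_convergence[OF L2_cmult[OF packet_L2[of 0], of "of_real M"] _ vL])
       (use M0 in \<open>auto simp: norm_mult intro!: mult_right_mono u tendsto_intros lim\<close>)
  from packet_closure_seq_limit[OF vL multiplier_closure[OF u(1)] this]
  show ?thesis using v by (auto simp: multiplier_def)
qed

lemma multiplier_sin: "multiplier (\<lambda>x. of_real (sin (\<xi> \<bullet> x)))"
proof -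
  have "multiplier (\<lambda>x. (1 / (2 * \<i>)) * exp (\<i> * of_real (\<xi> \<bullet> x)) + (- 1 / (2 * \<i>)) * exp (\<i> * of_real ((- \<xi>) \<bullet> x)))"
    by (intro multiplier_add multiplier_mult multiplier_const multiplier_character)
  moreover have "(1 / (2 * \<i>)) * exp (\<i> * of_real (\<xi> \<bullet> x)) + (- 1 / (2 * \<i>)) * exp (\<i> * of_real ((- \<xi>) \<bullet> x))
      = of_real (sin (\<xi> \<bullet> x))" for x
    by (simp add: sin_of_real [symmetric] sin_exp_eq exp_minus field_simps)
  ultimately show ?thesis by simp
qed

lemma multiplier_polynomial:
  assumes "real_polynomial_function p" "multiplier (\<lambda>x. of_real (s x))"
  shows "multiplier (\<lambda>x. of_real (p (s x :: real)))"
  using assms(1)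
proof induction
  case (linear f)
  have "f y = f 1 * y" for y
    using linear_scale[OF bounded_linear.linear[OF linear], of y 1] by simp
  then have "of_real (f (s x)) = of_real (f 1) * complex_of_real (s x)" for x by (metis of_real_mult)
  then show ?case using multiplier_mult[OF multiplier_const[of "of_real (f 1)"] assms(2)] by simp
qed (use multiplier_const multiplier_add multiplier_mult in auto)

text \<open>
  A bounded continuous function of one coordinate \<open>y = x \<bullet> b\<close> is a bounded limit of functions of
  \<open>n sin (y / n)\<close>, and on the compact range of the latter Weierstrass approximation applies.
\<close>

lemma multiplier_continuous:
  assumes F: "continuous_on UNIV F" "\<And>y. \<bar>F y\<bar> \<le> (1::real)"
  shows "multiplier (\<lambda>x. of_real (F (x \<bullet> b)))"
proof (rule multiplier_limit)
  let ?s = "\<lambda>n x. (real n + 1) * sin ((x \<bullet> b) / (real n + 1))"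
  \<comment> \<open>The shift \<open>n + 1\<close> keeps the divisor positive.\<close>
  show "(\<lambda>n. of_real (F (?s n x))) \<longlonglongrightarrow> (of_real (F (x \<bullet> b)) :: complex)" for x
  proof -
    have "(\<lambda>n. ?s n x) \<longlonglongrightarrow> x \<bullet> b"
      by (cases "x \<bullet> b = 0") (real_asymp, real_asymp)
    moreover have "isCont F (x \<bullet> b)" using F(1) by (simp add: continuous_on_eq_continuous_at)
    ultimately show ?thesis by (intro tendsto_of_real isCont_tendsto_compose[of _ F])
  qed
  show "norm (complex_of_real (F (?s n x))) \<le> 1" for n x using F(2) by simp
  show "multiplier (\<lambda>x. of_real (F (?s n x)))" for n
  proof -
    let ?K = "{- (real n + 1)..real n + 1}"
    have s: "?s n x \<in> ?K" for x
    proof -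
      have "\<bar>?s n x\<bar> \<le> (real n + 1) * 1"
        unfolding abs_mult by (intro mult_mono) auto
      then show ?thesis by (auto simp: abs_le_iff)
    qed
    have "\<exists>p. real_polynomial_function p \<and> (\<forall>y\<in>?K. \<bar>F y - p y\<bar> < 1 / real (Suc k))" for k
      by (rule Stone_Weierstrass_real_polynomial_function[of ?K F "1 / real (Suc k)"])
         (use F(1) continuous_on_subset in auto)
    then obtain p where p: "\<And>k. real_polynomial_function (p k)"
      "\<And>k y. y \<in> ?K \<Longrightarrow> \<bar>F y - p k y\<bar> < 1 / real (Suc k)" by metis
    show ?thesis
    proof (rule multiplier_limit)
      have "multiplier (\<lambda>x. of_real (sin ((b /\<^sub>R (real n + 1)) \<bullet> x)))" by (rule multiplier_sin)
      from multiplier_mult[OF multiplier_const this, of "of_real (real n + 1)"]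
      have "multiplier (\<lambda>x. of_real (?s n x))" by (simp add: inner_commute divide_inverse mult_ac)
      then show "multiplier (\<lambda>x. of_real (p k (?s n x)))" for k
        by (rule multiplier_polynomial[OF p(1)])
      show "norm (complex_of_real (p k (?s n x))) \<le> 2" for k x
      proof -
        have "1 / real (Suc k) \<le> 1" by simp
        then have "\<bar>F (?s n x) - p k (?s n x)\<bar> < 1"
          using p(2)[OF s[of x], of k] by linarith
        then have "\<bar>p k (?s n x)\<bar> \<le> 2" using F(2)[of "?s n x"] by linarith
        then show ?thesis by simp
      qed
      show "(\<lambda>k. of_real (p k (?s n x))) \<longlonglongrightarrow> (of_real (F (?s n x)) :: complex)" for x
      proof (intro tendsto_of_real)
        have "(\<lambda>k. p k (?s n x) - F (?s n x)) \<longlonglongrightarrow> 0"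
          by (rule tendsto_rabs_zero_cancel, rule real_tendsto_sandwich[OF _ _ tendsto_const LIMSEQ_inverse_real_of_nat])
             (use p(2)[OF s[of x]] in \<open>auto simp: abs_minus_commute less_imp_le inverse_eq_divide
                 intro!: always_eventually\<close>)
        then show "(\<lambda>k. p k (?s n x)) \<longlonglongrightarrow> F (?s n x)" by (simp add: LIM_zero_iff)
      qed
    qed
  qed
qed

lemma multiplier_halfspace: "multiplier (indicator {x. a < x \<bullet> b})"
proof (rule multiplier_limit)
  let ?F = "\<lambda>n y. min 1 (max 0 (real n * (y - a)))"
  show "multiplier (\<lambda>x. of_real (?F n (x \<bullet> b)))" for n
    by (rule multiplier_continuous) (auto intro!: continuous_intros)
  show "norm (complex_of_real (?F n (x \<bullet> b))) \<le> 1" for n x by auto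
  show "(\<lambda>n. of_real (?F n (x \<bullet> b))) \<longlonglongrightarrow> (indicator {x. a < x \<bullet> b} x :: complex)" for x
  proof (cases "a < x \<bullet> b")
    case True
    obtain N where N: "1 / (x \<bullet> b - a) < real N" using reals_Archimedean2 by blast
    have "\<forall>\<^sub>F n in sequentially. of_real (?F n (x \<bullet> b)) = (1::complex)"
    proof (rule eventually_sequentiallyI[of N])
      fix n assume "N \<le> n"
      then have "1 / (x \<bullet> b - a) < real n" using N by linarith
      with True have "1 \<le> real n * (x \<bullet> b - a)" by (simp add: field_simps)
      then show "of_real (?F n (x \<bullet> b)) = (1::complex)" by simp
    qed
    then show ?thesis using True by (simp add: tendsto_eventually)
  next
    case False
    then have "real n * (x \<bullet> b - a) \<le> 0" for n by (intro mult_nonneg_nonpos) auto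
    then have "?F n (x \<bullet> b) = 0" for n by (metis max.absorb1 min.absorb2 zero_le_one)
    then show ?thesis using False by simp
  qed
qed

text \<open>
  The half spaces generate the Borel sets, and the sets whose indicator is a multiplier are closed under
  complements and finite unions (the multipliers form an algebra) and under increasing unions (they
  are closed under bounded limits).
\<close>

lemma multiplier_indicator: "multiplier (indicator A)" if "A \<in> sets (borel :: 'a::euclidean_space measure)"
proof -
  have "A \<in> sigma_sets UNIV ((\<lambda>(a, i). {x::'a. a < x \<bullet> i}) ` (UNIV \<times> Basis))"
    using that by (simp add: borel_eq_halfspace_greater)
  then show ?thesis
  proof induction
    case (Basic A)
    then show ?case using multiplier_halfspace by auto
  next
    case Empty
    then show ?case using multiplier_const[of 0] by (simp add: indicator_def)
  next
    case (Compl A)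
    have "indicator (UNIV - A) x = 1 + (- 1) * (indicator A x :: complex)" for x by (simp add: indicator_def)
    then have *: "(indicator (UNIV - A) :: 'a \<Rightarrow> complex) = (\<lambda>x. 1 + (- 1) * indicator A x)" by (rule ext)
    show ?case unfolding * by (intro multiplier_add multiplier_mult multiplier_const Compl)
  next
    case (Union A)
    have fin: "multiplier (indicator (\<Union>i<n. A i))" for n :: nat
    proof (induction n)
      case 0 then show ?case using multiplier_const[of 0] by (simp add: indicator_def)
    next
      case (Suc n)
      let ?B = "\<Union>i<n. A i"
      have "indicator (\<Union>i<Suc n. A i) x = indicator ?B x + (indicator (A n) x + (- 1) * (indicator ?B x * (indicator (A n) x :: complex)))"
        for x by (auto simp: indicator_def less_Suc_eq)
      then have *: "(indicator (\<Union>i<Suc n. A i) :: 'a \<Rightarrow> complex) =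
        (\<lambda>x. indicator ?B x + (indicator (A n) x + (- 1) * (indicator ?B x * (indicator (A n) x))))" by (rule ext)
      show ?case unfolding * by (intro multiplier_add multiplier_mult multiplier_const Suc Union)
    qed
    show ?case
    proof (rule multiplier_limit[OF fin])
      show "norm (indicator (\<Union>i<n. A i) x :: complex) \<le> 1" for n :: nat and x by (simp add: indicator_def)
      show "(\<lambda>n. indicator (\<Union>i<n. A i) x :: complex) \<longlonglongrightarrow> indicator (\<Union>i. A i) x" for x
        using LIMSEQ_indicator_UN[of A x] .
    qed
  qed
qed

lemma multiplier_bounded:
  assumes [measurable]: "u \<in> borel_measurable borel" and bound: "\<And>x. norm (u x) \<le> M"
  shows "multiplier u"
proof -
  obtain F where F: "\<And>i. simple_function borel (F i)" "\<And>x. (\<lambda>i. F i x) \<longlonglongrightarrow> u x"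
      "\<And>i x. norm (F i x) \<le> 2 * norm (u x)"
    using borel_measurable_implies_sequence_metric[OF assms(1), of 0] by auto
  show ?thesis
  proof (rule multiplier_limit[of F "2 * M"])
    fix i
    have [simp]: "finite (range (F i))" using simple_functionD(1)[OF F(1)[of i]] by simp
    have "multiplier (\<lambda>x. \<Sum>y\<in>range (F i). y * indicator (F i -` {y}) x)"
      using simple_functionD(2)[OF F(1)[of i]]
      by (intro multiplier_sum multiplier_mult multiplier_const multiplier_indicator) auto
    moreover have "(\<Sum>y\<in>range (F i). y * indicator (F i -` {y}) x) = F i x" for x
    proof -
      have "(\<Sum>y\<in>range (F i). y * indicator (F i -` {y}) x) = (\<Sum>y\<in>range (F i). if y = F i x then y else 0)"
        by (intro sum.cong) (auto simp: indicator_def)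
      then show ?thesis by simp
    qed
    ultimately show "multiplier (F i)" by simp
    show "norm (F i x) \<le> 2 * M" for x using F(3)[of i x] bound[of x] by linarith
  qed (rule F(2))
qed

text \<open>
  Truncate \<open>f\<close> where it or \<open>x\<close> is large. The truncation divided by the Gaussian is bounded, hence a
  multiplier, and it converges to \<open>f\<close> by domination.
\<close>

theorem packet_sums_dense: "packet_closure = L2"
proof (intro equalityI subsetI)
  fix f :: "'a \<Rightarrow> complex" assume f: "f \<in> L2"
  have [measurable]: "f \<in> borel_measurable borel" using L2_measurable[OF f] by simp
  define A where "A n = {x. norm (f x) \<le> real n \<and> norm x \<le> real n}" for n
  have [measurable]: "A n \<in> sets borel" for n unfolding A_def by measurable
  show "f \<in> packet_closure"
  proof (rule packet_closure_seq_limit[OF f])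
    show "(\<lambda>x. indicator (A n) x * f x) \<in> packet_closure" for n
    proof -
      have "multiplier (\<lambda>x. indicator (A n) x * f x * exp (of_real ((norm x)\<^sup>2 / 2)))"
      proof (rule multiplier_bounded)
        show "norm (indicator (A n) x * f x * exp (of_real ((norm x)\<^sup>2 / 2))) \<le> real n * exp ((real n)\<^sup>2 / 2)" for x
        proof (cases "x \<in> A n")
          case True
          then have "norm (f x) \<le> real n" "(norm x)\<^sup>2 \<le> (real n)\<^sup>2" by (auto simp: A_def intro: power_mono)
          then show ?thesis using True by (simp add: norm_mult mult_mono)
        qed simp
      qed measurable
      from multiplier_closure[OF this] show ?thesis
        by (simp add: packet_def mult.assoc flip: exp_add)
    qed
    show "(\<lambda>n. l2norm (\<lambda>x. indicator (A n) x * f x - f x)) \<longlonglongrightarrow> 0"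
    proof (rule l2norm_dominated_convergence[OF f _ f])
      show "AE x in lborel. (\<lambda>n. indicator (A n) x * f x) \<longlonglongrightarrow> f x"
      proof (rule AE_I2)
        fix x
        obtain N where N: "max (norm (f x)) (norm x) < real N" using reals_Archimedean2 by blast
        have "\<forall>\<^sub>F n in sequentially. indicator (A n) x * f x = f x"
        proof (rule eventually_sequentiallyI[of N])
          fix n assume "N \<le> n"
          then have "real N \<le> real n" by simp
          with N have "x \<in> A n" unfolding A_def by auto
          then show "indicator (A n) x * f x = f x" by simp
        qed
        then show "(\<lambda>n. indicator (A n) x * f x) \<longlonglongrightarrow> f x" by (rule tendsto_eventually)
      qed
    qed (auto simp: indicator_def norm_mult)
  qed
qed (rule packet_closure_L2)

section \<open>Twice differentiable functions and integration by parts\<close>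

lemma vector_mean_value_bound:
  fixes f :: "real \<Rightarrow> 'b::real_normed_vector"
  assumes "\<And>s. s \<in> closed_segment a b \<Longrightarrow> (f has_vector_derivative f' s) (at s)"
    and "\<And>s. s \<in> closed_segment a b \<Longrightarrow> norm (f' s) \<le> M"
  shows "norm (f b - f a) \<le> M * \<bar>b - a\<bar>"
proof -
  have "norm (f b - f a) \<le> M * norm (b - a)"
  proof (rule differentiable_bound[of "closed_segment a b" f "\<lambda>s h. h *\<^sub>R f' s"])
    show "(f has_derivative (\<lambda>h. h *\<^sub>R f' s)) (at s within closed_segment a b)" if "s \<in> closed_segment a b" for s
      using assms(1)[OF that] by (auto simp: has_vector_derivative_def intro: has_derivative_at_withinI)
    show "onorm (\<lambda>h. h *\<^sub>R f' s) \<le> M" if "s \<in> closed_segment a b" for s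
    proof (rule onorm_le)
      show "norm (h *\<^sub>R f' s) \<le> M * norm h" for h
        using mult_right_mono[OF assms(2)[OF that], of "norm h"] by (simp add: mult.commute)
    qed
  qed auto
  then show ?thesis by simp
qed

lemma has_vector_derivative_iff_quotient:
  fixes f :: "real \<Rightarrow> 'b::real_normed_vector"
  shows "(f has_vector_derivative D) (at t) \<longleftrightarrow> ((\<lambda>h. (f (t + h) - f t) /\<^sub>R h) \<longlongrightarrow> D) (at 0)"
proof -
  have "norm ((f (t + h) - f t) /\<^sub>R h - D) = norm (f (t + h) - f t - h *\<^sub>R D) / norm h" if "h \<noteq> 0" for h
  proof -
    have "(f (t + h) - f t) /\<^sub>R h - D = (f (t + h) - f t - h *\<^sub>R D) /\<^sub>R h"
      using that by (simp add: scaleR_diff_right)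
    then show ?thesis by (simp add: divide_inverse mult.commute)
  qed
  then have "((\<lambda>h. norm (f (t + h) - f t - h *\<^sub>R D) / norm h) \<longlongrightarrow> 0) (at 0)
     \<longleftrightarrow> ((\<lambda>h. norm ((f (t + h) - f t) /\<^sub>R h - D)) \<longlongrightarrow> 0) (at 0)"
    by (intro filterlim_cong refl) (auto simp: eventually_at_filter)
  also have "\<dots> \<longleftrightarrow> ((\<lambda>h. (f (t + h) - f t) /\<^sub>R h) \<longlongrightarrow> D) (at 0)"
    unfolding tendsto_norm_zero_iff by (rule LIM_zero_iff)
  finally show ?thesis
    by (simp add: has_vector_derivative_def has_derivative_at bounded_linear_scaleR_left)
qed

text \<open>
  \<open>F1 b\<close> and \<open>F2 b c\<close> are the first and second partial derivatives of \<open>F\<close> in the coordinate directions.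
\<close>

definition C2_with :: "('a::euclidean_space \<Rightarrow> complex) \<Rightarrow> ('a \<Rightarrow> 'a \<Rightarrow> complex) \<Rightarrow> ('a \<Rightarrow> 'a \<Rightarrow> 'a \<Rightarrow> complex) \<Rightarrow> bool" where
  "C2_with F F1 F2 \<longleftrightarrow>
     (\<forall>x. (F has_derivative (\<lambda>h. \<Sum>b\<in>Basis. of_real (h \<bullet> b) * F1 b x)) (at x)) \<and>
     (\<forall>b\<in>Basis. \<forall>x. (F1 b has_derivative (\<lambda>h. \<Sum>c\<in>Basis. of_real (h \<bullet> c) * F2 b c x)) (at x)) \<and>
     (\<forall>b\<in>Basis. \<forall>c\<in>Basis. continuous_on UNIV (F2 b c))"

lemma sum_Basis_direction: "(\<Sum>b\<in>Basis. of_real ((c::'a::euclidean_space) \<bullet> b) * (f b :: complex)) = f c" if "c \<in> Basis"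
proof -
  have "(\<Sum>b\<in>Basis. of_real (c \<bullet> b) * f b) = (\<Sum>b\<in>Basis. if b = c then f b else 0)"
    using that by (intro sum.cong refl) (auto simp: inner_Basis)
  then show ?thesis using that by simp
qed

lemma partial_deriv_eq:
  assumes "\<And>x. (F has_derivative (\<lambda>h. \<Sum>b\<in>Basis. of_real (h \<bullet> b) * F1 b x)) (at x)" "c \<in> Basis"
  shows "partial_deriv c F = F1 c"
proof
  fix x
  show "partial_deriv c F x = F1 c x"
    using frechet_derivative_at[OF assms(1)[of x], symmetric] sum_Basis_direction[OF assms(2), of "\<lambda>b. F1 b x"]
    by (simp add: partial_deriv_def)
qed

lemma C2_withD:
  assumes "C2_with F F1 F2"
  shows C2_deriv: "(F has_derivative (\<lambda>h. \<Sum>b\<in>Basis. of_real (h \<bullet> b) * F1 b x)) (at x)"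
    and C2_deriv2: "b \<in> Basis \<Longrightarrow> (F1 b has_derivative (\<lambda>h. \<Sum>c\<in>Basis. of_real (h \<bullet> c) * F2 b c x)) (at x)"
    and C2_cont2: "b \<in> Basis \<Longrightarrow> c \<in> Basis \<Longrightarrow> continuous_on UNIV (F2 b c)"
  using assms by (auto simp: C2_with_def)

lemma C2_continuous:
  assumes "C2_with F F1 F2"
  shows C2_cont: "continuous_on UNIV F" and C2_cont1: "b \<in> Basis \<Longrightarrow> continuous_on UNIV (F1 b)"
  using C2_withD(1,2)[OF assms]
  by (auto simp: continuous_on_eq_continuous_at intro: has_derivative_continuous)

lemma C2_laplacian:
  assumes "C2_with F F1 F2"
  shows "laplacian F x = (\<Sum>b\<in>Basis. F2 b b x)"
proof -
  have 1: "partial_deriv b F = F1 b" if "b \<in> Basis" for b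
    by (rule partial_deriv_eq[OF C2_deriv[OF assms] that])
  have "partial_deriv b (F1 b) = F2 b b" if "b \<in> Basis" for b
    by (rule partial_deriv_eq[OF C2_deriv2[OF assms that] that])
  with 1 show ?thesis by (simp add: laplacian_def)
qed

lemma C2_test_function:
  assumes C2: "C2_with F F1 F2" and supp: "\<And>x. norm x > R \<Longrightarrow> F x = 0"
  shows "test_function F"
proof -
  have 1: "partial_deriv b F = F1 b" if "b \<in> Basis" for b
    by (rule partial_deriv_eq[OF C2_deriv[OF C2] that])
  have 2: "partial_deriv c (F1 b) = F2 b c" if "b \<in> Basis" "c \<in> Basis" for b c
    by (rule partial_deriv_eq[OF C2_deriv2[OF C2 that(1)] that(2)])
  have "bounded {x. F x \<noteq> 0}"
    by (rule boundedI[of _ R]) (use supp in \<open>auto simp: not_less[symmetric]\<close>)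
  then show ?thesis
    using C2_withD[OF C2]
    by (auto simp: test_function_def 1 2 differentiable_def intro: bounded_closure)
qed

text \<open>
  The Frechet derivative is linear, hence determined by the partial derivatives.
\<close>

lemma test_function_C2:
  assumes "test_function \<phi>"
  shows "C2_with \<phi> (\<lambda>b. partial_deriv b \<phi>) (\<lambda>b c. partial_deriv c (partial_deriv b \<phi>))"
proof -
  have D: "(F has_derivative (\<lambda>h. \<Sum>b\<in>Basis. of_real (h \<bullet> b) * partial_deriv b F x)) (at x)"
    if "F differentiable (at x)" for F :: "'a \<Rightarrow> complex" and x
  proof -
    have F: "(F has_derivative frechet_derivative F (at x)) (at x)"
      using that by (simp add: frechet_derivative_works)
    then have lin: "linear (frechet_derivative F (at x))" by (rule has_derivative_linear)
    have "frechet_derivative F (at x) h = (\<Sum>b\<in>Basis. of_real (h \<bullet> b) * partial_deriv b F x)" for h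
    proof -
      have "frechet_derivative F (at x) h = frechet_derivative F (at x) (\<Sum>b\<in>Basis. (h \<bullet> b) *\<^sub>R b)"
        by (simp add: euclidean_representation)
      also have "\<dots> = (\<Sum>b\<in>Basis. of_real (h \<bullet> b) * partial_deriv b F x)"
        by (simp add: linear_sum[OF lin] linear_scale[OF lin] partial_deriv_def scaleR_conv_of_real)
      finally show ?thesis .
    qed
    then have "frechet_derivative F (at x) = (\<lambda>h. \<Sum>b\<in>Basis. of_real (h \<bullet> b) * partial_deriv b F x)" by (rule ext)
    with F show ?thesis by simp
  qed
  show ?thesis using assms unfolding C2_with_def test_function_def by (auto intro: D)
qed

lemma test_function_support:
  assumes "test_function \<phi>"
  obtains R where "R > 0" "\<And>x. norm x > R \<Longrightarrow> \<phi> x = 0"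
proof -
  have "bounded (closure {x. \<phi> x \<noteq> 0})" using assms by (auto simp: test_function_def compact_imp_bounded)
  then obtain R where R: "\<And>x. x \<in> closure {x. \<phi> x \<noteq> 0} \<Longrightarrow> norm x \<le> R" by (auto simp: bounded_iff)
  have "\<phi> x = 0" if "norm x > max R 1" for x
  proof (rule ccontr)
    assume "\<phi> x \<noteq> 0"
    then have "x \<in> closure {x. \<phi> x \<noteq> 0}" by (intro subsetD[OF closure_subset]) simp
    then have "norm x \<le> R" by (rule R)
    with that show False by simp
  qed
  then show thesis by (intro that[of "max R 1"]) auto
qed

lemma C2_mult:
  assumes F: "C2_with F F1 F2" and G: "C2_with G G1 G2"
  shows "C2_with (\<lambda>x. F x * G x) (\<lambda>b x. F1 b x * G x + F x * G1 b x)
     (\<lambda>b c x. F2 b c x * G x + F1 b x * G1 c x + F1 c x * G1 b x + F x * G2 b c x)"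
  unfolding C2_with_def
proof (intro conjI ballI allI)
  fix x
  show "((\<lambda>x. F x * G x) has_derivative
      (\<lambda>h. \<Sum>b\<in>Basis. of_real (h \<bullet> b) * (F1 b x * G x + F x * G1 b x))) (at x)"
    by (rule has_derivative_eq_rhs[OF has_derivative_mult[OF C2_deriv[OF F] C2_deriv[OF G]]])
       (simp add: fun_eq_iff sum_distrib_left sum_distrib_right sum.distrib algebra_simps)
  fix b :: 'a assume b: "b \<in> Basis"
  show "((\<lambda>x. F1 b x * G x + F x * G1 b x) has_derivative
      (\<lambda>h. \<Sum>c\<in>Basis. of_real (h \<bullet> c) *
        (F2 b c x * G x + F1 b x * G1 c x + F1 c x * G1 b x + F x * G2 b c x))) (at x)"
    by (rule has_derivative_eq_rhs[OF has_derivative_add[OF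
          has_derivative_mult[OF C2_deriv2[OF F b] C2_deriv[OF G]]
          has_derivative_mult[OF C2_deriv[OF F] C2_deriv2[OF G b]]]])
       (simp add: fun_eq_iff sum_distrib_left sum_distrib_right sum.distrib algebra_simps)
next
  fix b c :: 'a assume b: "b \<in> Basis" and c: "c \<in> Basis"
  show "continuous_on UNIV (\<lambda>x. F2 b c x * G x + F1 b x * G1 c x + F1 c x * G1 b x + F x * G2 b c x)"
    using C2_cont2[OF F b c] C2_cont2[OF G b c] C2_cont1[OF F b] C2_cont1[OF G b] C2_cont1[OF F c] C2_cont1[OF G c]
      C2_cont[OF F] C2_cont[OF G]
    by (intro continuous_intros)
qed

lemma compact_support_bounded:
  fixes f :: "'a::euclidean_space \<Rightarrow> complex"
  assumes "continuous_on UNIV f" "\<And>x. norm x > R \<Longrightarrow> f x = 0"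
  obtains M where "M \<ge> 0" "\<And>x. norm (f x) \<le> M * indicator (cball 0 R) x"
proof -
  have "compact (f ` cball 0 R)"
    by (intro compact_continuous_image continuous_on_subset[OF assms(1)]) auto
  then obtain M where M: "\<And>x. x \<in> cball 0 R \<Longrightarrow> norm (f x) \<le> M"
    using compact_imp_bounded by (fastforce simp: bounded_iff)
  show thesis
  proof (rule that[of "max M 0"])
    show "norm (f x) \<le> max M 0 * indicator (cball 0 R) x" for x
    proof (cases "x \<in> cball 0 R")
      case True then show ?thesis using M[of x] by simp
    next
      case False then show ?thesis using assms(2)[of x] by simp
    qed
  qed simp
qed

lemma indicator_cball_integrable: "integrable lborel (\<lambda>x::'a::euclidean_space. M * indicator (cball 0 R) x :: real)"
proof -
  have "emeasure lborel (cball (0::'a) R) < \<infinity>"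
    by (rule emeasure_bounded_finite) (rule bounded_cball)
  then show ?thesis by (intro integrable_mult_right integrable_real_indicator) auto
qed

lemma compact_support_integrable:
  fixes f :: "'a::euclidean_space \<Rightarrow> complex"
  assumes "continuous_on UNIV f" "\<And>x. norm x > R \<Longrightarrow> f x = 0"
  shows "integrable lborel f"
proof -
  obtain M where M: "M \<ge> 0" "\<And>x. norm (f x) \<le> M * indicator (cball 0 R) x"
    using compact_support_bounded[OF assms] by blast
  show ?thesis
    by (rule Bochner_Integration.integrable_bound[OF indicator_cball_integrable[of M R]])
       (use M borel_measurable_continuous_onI[OF assms(1)] in auto)
qed

lemma compact_support_L2:
  fixes f :: "'a::euclidean_space \<Rightarrow> complex"
  assumes "continuous_on UNIV f" "\<And>x. norm x > R \<Longrightarrow> f x = 0"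
  shows "f \<in> L2"
proof -
  have "integrable lborel (\<lambda>x. of_real ((norm (f x))\<^sup>2) :: complex)"
    by (rule compact_support_integrable[of _ R]) (use assms in \<open>auto intro!: continuous_intros\<close>)
  then have "integrable lborel (\<lambda>x. (norm (f x))\<^sup>2)" by (simp only: complex_of_real_integrable_eq)
  then show ?thesis using borel_measurable_continuous_onI[OF assms(1)] by (simp add: L2_iff)
qed

text \<open>
  Outside the closed ball the function vanishes on a neighbourhood.
\<close>

lemma support_derivative:
  assumes D: "(F has_derivative (\<lambda>h. \<Sum>b\<in>Basis. of_real (h \<bullet> b) * F1 b x)) (at x)"
    and supp: "\<And>y. norm y > R \<Longrightarrow> F y = 0" and x: "norm (x::'a::euclidean_space) > R" and c: "c \<in> Basis"
  shows "F1 c x = (0::complex)"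
proof -
  have "open {y::'a. norm y > R}" by (intro open_Collect_less continuous_intros)
  then have "(F has_derivative (\<lambda>h. 0)) (at x)"
    by (rule has_derivative_transform_within_open[OF has_derivative_const[of 0]]) (use x supp in auto)
  from has_derivative_unique[OF this D] have "0 = (\<Sum>b\<in>Basis. of_real (c \<bullet> b) * F1 b x)" by (metis (no_types))
  then show ?thesis using sum_Basis_direction[OF c, of "\<lambda>b. F1 b x"] by simp
qed

text \<open>
  By translation invariance the difference quotients of a compactly supported function integrate to
  zero; so does their limit.
\<close>

lemma integral_partial_deriv_eq_0:
  fixes F :: "'a::euclidean_space \<Rightarrow> complex"
  assumes D: "\<And>x. (F has_derivative (\<lambda>h. \<Sum>b\<in>Basis. of_real (h \<bullet> b) * F1 b x)) (at x)"
    and c: "c \<in> Basis" and cont: "continuous_on UNIV (F1 c)" and supp: "\<And>x. norm x > R \<Longrightarrow> F x = 0"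
  shows "(LINT x|lborel. F1 c x) = 0"
proof -
  have Fc: "continuous_on UNIV F"
    using D by (auto simp: continuous_on_eq_continuous_at intro: has_derivative_continuous)
  have supp1: "F1 c x = 0" if "norm x > R" for x by (rule support_derivative[of F F1 x R c, OF D[of x] supp that c])
  obtain M where M: "M \<ge> 0" "\<And>x. norm (F1 c x) \<le> M * indicator (cball 0 R) x"
    using compact_support_bounded[OF cont supp1] by blast
  have M': "norm (F1 c x) \<le> M" for x using M(2)[of x] M(1) by (cases "x \<in> cball 0 R") auto
  define h where "h n = inverse (real (Suc n))" for n
  have h: "h n > 0" "h n \<le> 1" for n by (auto simp: h_def field_simps)
  have h0: "h \<longlonglongrightarrow> 0" unfolding h_def by (rule LIMSEQ_inverse_real_of_nat)
  define q where "q n x = (F (x + h n *\<^sub>R c) - F x) /\<^sub>R h n" for n x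
  have line: "((\<lambda>s. F (x + s *\<^sub>R c)) has_vector_derivative F1 c (x + s *\<^sub>R c)) (at s)" for x s
  proof -
    have "((\<lambda>s. x + s *\<^sub>R c) has_derivative (\<lambda>k. k *\<^sub>R c)) (at s)"
      by (auto intro!: derivative_eq_intros)
    from has_derivative_compose[OF this D]
    have "((\<lambda>s. F (x + s *\<^sub>R c)) has_derivative
        (\<lambda>k. \<Sum>b\<in>Basis. of_real ((k *\<^sub>R c) \<bullet> b) * F1 b (x + s *\<^sub>R c))) (at s)" .
    moreover have "(\<Sum>b\<in>Basis. of_real ((k *\<^sub>R c) \<bullet> b) * F1 b (x + s *\<^sub>R c)) = k *\<^sub>R F1 c (x + s *\<^sub>R c)" for k
    proof -
      have "(\<Sum>b\<in>Basis. of_real ((k *\<^sub>R c) \<bullet> b) * F1 b (x + s *\<^sub>R c))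
          = of_real k * (\<Sum>b\<in>Basis. of_real (c \<bullet> b) * F1 b (x + s *\<^sub>R c))"
        by (simp add: sum_distrib_left mult.assoc)
      also have "\<dots> = k *\<^sub>R F1 c (x + s *\<^sub>R c)"
        unfolding sum_Basis_direction[OF c, of "\<lambda>b. F1 b (x + s *\<^sub>R c)"] by (simp add: scaleR_conv_of_real)
      finally show ?thesis .
    qed
    ultimately show ?thesis by (simp add: has_vector_derivative_def)
  qed
  have Fm: "integrable lborel F" by (rule compact_support_integrable[OF Fc supp])
  have shift: "(LINT x|lborel. F (x + a)) = (LINT x|lborel. F x)" "integrable lborel (\<lambda>x. F (x + a))" for a
  proof -
    have [measurable]: "F \<in> borel_measurable borel" by (rule borel_measurable_continuous_onI[OF Fc])
    show "(LINT x|lborel. F (x + a)) = (LINT x|lborel. F x)"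
      by (subst (2) lborel_distr_plus[of a, symmetric], subst integral_distr) (auto simp: add.commute)
    have "integrable (distr lborel borel ((+) a)) F" using Fm by (simp add: lborel_distr_plus)
    then show "integrable lborel (\<lambda>x. F (x + a))"
      by (subst (asm) integrable_distr_eq) (auto simp: add.commute)
  qed
  have "(\<lambda>n. LINT x|lborel. q n x) \<longlonglongrightarrow> (LINT x|lborel. F1 c x)"
  proof (rule integral_dominated_convergence)
    show "integrable lborel (\<lambda>x::'a. M * indicator (cball 0 (R + 1)) x :: real)" by (rule indicator_cball_integrable)
    show "F1 c \<in> borel_measurable lborel" using borel_measurable_continuous_onI[OF cont] by simp
    show "q n \<in> borel_measurable lborel" for n
    proof -
      have "continuous_on UNIV (q n)"
        unfolding q_def by (intro continuous_intros continuous_on_compose2[OF Fc]) auto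
      then show ?thesis by (simp add: borel_measurable_continuous_onI)
    qed
    show "AE x in lborel. (\<lambda>n. q n x) \<longlonglongrightarrow> F1 c x"
    proof (rule AE_I2)
      fix x
      from line[of x 0] have "((\<lambda>s. (F (x + s *\<^sub>R c) - F x) /\<^sub>R s) \<longlongrightarrow> F1 c x) (at 0)"
        by (simp add: has_vector_derivative_iff_quotient)
      then show "(\<lambda>n. q n x) \<longlonglongrightarrow> F1 c x"
        unfolding q_def
        by (rule filterlim_compose) (use h0 h in \<open>auto simp: filterlim_at less_imp_neq[THEN not_sym]\<close>)
    qed
    show "AE x in lborel. norm (q n x) \<le> M * indicator (cball 0 (R + 1)) x" for n
    proof (rule AE_I2)
      fix x
      show "norm (q n x) \<le> M * indicator (cball 0 (R + 1)) x"
      proof (cases "x \<in> cball 0 (R + 1)")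
        case True
        have "norm (F (x + h n *\<^sub>R c) - F (x + 0 *\<^sub>R c)) \<le> M * \<bar>h n - 0\<bar>"
          by (rule vector_mean_value_bound[where f = "\<lambda>s. F (x + s *\<^sub>R c)"]) (rule line M')+
        then have "norm (F (x + h n *\<^sub>R c) - F x) / h n \<le> M" using h[of n] by (simp add: field_simps)
        then show ?thesis using True h[of n] by (simp add: q_def divide_inverse mult.commute)
      next
        case False
        have "norm (h n *\<^sub>R c) \<le> 1" using h[of n] c by simp
        with False have "norm x > R" "norm (x + h n *\<^sub>R c) > R"
          using norm_triangle_ineq4[of "x + h n *\<^sub>R c" "h n *\<^sub>R c"] by (auto simp: dist_norm)
        then show ?thesis using supp False by (simp add: q_def)
      qed
    qed
  qed
  moreover have "(LINT x|lborel. q n x) = 0" for n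
    unfolding q_def using shift Fm by simp
  ultimately show ?thesis by (simp add: LIMSEQ_const_iff)
qed

lemma integration_by_parts:
  fixes F \<phi> :: "'a::euclidean_space \<Rightarrow> complex"
  assumes F: "\<And>x. (F has_derivative (\<lambda>h. \<Sum>b\<in>Basis. of_real (h \<bullet> b) * F1 b x)) (at x)" "continuous_on UNIV (F1 c)"
    and \<phi>: "\<And>x. (\<phi> has_derivative (\<lambda>h. \<Sum>b\<in>Basis. of_real (h \<bullet> b) * \<phi>1 b x)) (at x)" "continuous_on UNIV (\<phi>1 c)"
    and c: "c \<in> Basis" and supp: "\<And>x. norm x > R \<Longrightarrow> \<phi> x = 0"
  shows "(LINT x|lborel. F1 c x * \<phi> x) = - (LINT x|lborel. F x * \<phi>1 c x)"
proof -
  have cont: "continuous_on UNIV F" "continuous_on UNIV \<phi>"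
    using F(1) \<phi>(1) by (auto simp: continuous_on_eq_continuous_at intro: has_derivative_continuous)
  have supp1: "\<phi>1 c x = 0" if "norm x > R" for x by (rule support_derivative[of \<phi> \<phi>1 x R c, OF \<phi>(1)[of x] supp that c])
  have int: "integrable lborel (\<lambda>x. F1 c x * \<phi> x)" "integrable lborel (\<lambda>x. F x * \<phi>1 c x)"
    by (rule compact_support_integrable[of _ R]; use supp supp1 cont F(2) \<phi>(2) in \<open>auto intro!: continuous_intros\<close>)+
  have "(LINT x|lborel. (F1 c x * \<phi> x + F x * \<phi>1 c x)) = 0"
  proof (rule integral_partial_deriv_eq_0[where ?F1.0 = "\<lambda>c x. F1 c x * \<phi> x + F x * \<phi>1 c x" and F = "\<lambda>x. F x * \<phi> x"])
    show "((\<lambda>x. F x * \<phi> x) has_derivative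
        (\<lambda>h. \<Sum>b\<in>Basis. of_real (h \<bullet> b) * (F1 b x * \<phi> x + F x * \<phi>1 b x))) (at x)" for x
      by (rule has_derivative_eq_rhs[OF has_derivative_mult[OF F(1) \<phi>(1)]])
         (simp add: fun_eq_iff sum_distrib_left sum_distrib_right sum.distrib algebra_simps)
    show "continuous_on UNIV (\<lambda>x. F1 c x * \<phi> x + F x * \<phi>1 c x)"
      by (intro continuous_intros cont F(2) \<phi>(2))
  qed (use supp c in auto)
  then show ?thesis using int by (simp add: add_eq_0_iff2)
qed

lemma laplacian_self_adjoint:
  assumes F: "C2_with F F1 F2" and \<phi>: "C2_with \<phi> \<phi>1 \<phi>2" and supp: "\<And>x. norm (x::'a::euclidean_space) > R \<Longrightarrow> \<phi> x = 0"
  shows "(LINT x|lborel. laplacian F x * \<phi> x) = (LINT x|lborel. F x * laplacian \<phi> x)"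
proof -
  have supp1: "\<phi>1 b x = 0" if "norm x > R" "b \<in> Basis" for x b
    by (rule support_derivative[of \<phi> \<phi>1 x R b, OF C2_deriv[OF \<phi>] supp that])
  have supp2: "\<phi>2 b b x = 0" if "norm x > R" "b \<in> Basis" for x b
    by (rule support_derivative[of "\<phi>1 b" "\<phi>2 b" x R b, OF C2_deriv2[OF \<phi> that(2)] supp1[OF _ that(2)] that])
  have eq: "(LINT x|lborel. F2 b b x * \<phi> x) = (LINT x|lborel. F x * \<phi>2 b b x)" if b: "b \<in> Basis" for b
  proof -
    have "(LINT x|lborel. F2 b b x * \<phi> x) = - (LINT x|lborel. F1 b x * \<phi>1 b x)"
      by (rule integration_by_parts[where ?F1.0 = "F2 b" and ?\<phi>1.0 = \<phi>1])
         (use C2_deriv2[OF F b] C2_cont2[OF F b b] C2_deriv[OF \<phi>] C2_cont1[OF \<phi> b] b supp in auto)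
    moreover have "(LINT x|lborel. F1 b x * \<phi>1 b x) = - (LINT x|lborel. F x * \<phi>2 b b x)"
      by (rule integration_by_parts[where ?F1.0 = F1 and ?\<phi>1.0 = "\<phi>2 b"])
         (use C2_deriv[OF F] C2_cont1[OF F b] C2_deriv2[OF \<phi> b] C2_cont2[OF \<phi> b b] b supp1 in auto)
    ultimately show ?thesis by simp
  qed
  have int: "integrable lborel (\<lambda>x. F2 b b x * \<phi> x)" "integrable lborel (\<lambda>x. F x * \<phi>2 b b x)" if b: "b \<in> Basis" for b
    using C2_cont2[OF F b b] C2_cont[OF F] C2_cont[OF \<phi>] C2_cont2[OF \<phi> b b] supp supp2 b
    by (auto intro!: compact_support_integrable[of _ R] continuous_intros)
  show ?thesis
    using int eq by (simp add: C2_laplacian[OF F] C2_laplacian[OF \<phi>] sum_distrib_left sum_distrib_right)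
qed

lemma test_function_L2:
  assumes "test_function \<phi>"
  shows "\<phi> \<in> L2" "laplacian \<phi> \<in> L2"
proof -
  obtain R where R: "\<And>x. norm x > R \<Longrightarrow> \<phi> x = 0" using test_function_support[OF assms] by blast
  note C2 = test_function_C2[OF assms]
  show "\<phi> \<in> L2" by (rule compact_support_L2[OF C2_cont[OF C2] R])
  have supp1: "partial_deriv b \<phi> x = 0" if "norm x > R" "b \<in> Basis" for x b
    by (rule support_derivative[of \<phi> "\<lambda>b. partial_deriv b \<phi>" x R b, OF C2_deriv[OF C2] R that])
  have supp2: "partial_deriv b (partial_deriv b \<phi>) x = 0" if "norm x > R" "b \<in> Basis" for x b
    by (rule support_derivative[of "partial_deriv b \<phi>" "\<lambda>c. partial_deriv c (partial_deriv b \<phi>)" x R b,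
          OF C2_deriv2[OF C2 that(2)] supp1[OF _ that(2)] that])
  show "laplacian \<phi> \<in> L2"
    unfolding laplacian_def[abs_def]
    by (intro L2_sum compact_support_L2[of _ R] C2_cont2[OF C2] supp2)
qed

section \<open>Cutoff functions\<close>

lemma has_derivative_positive_part_power:
  "((\<lambda>u. (max 0 u) ^ Suc (Suc n)) has_real_derivative real (Suc (Suc n)) * (max 0 u) ^ Suc n) (at u)"
proof (cases u "0::real" rule: linorder_cases)
  case less
  have "((\<lambda>u. 0) has_real_derivative real (Suc (Suc n)) * (max 0 u) ^ Suc n) (at u)"
    using less by simp
  then show ?thesis
    by (rule has_field_derivative_transform_within_open[where S = "{..<0}"]) (use less in auto)
next
  case greater
  have "((\<lambda>u. u ^ Suc (Suc n)) has_real_derivative real (Suc (Suc n)) * (max 0 u) ^ Suc n) (at u)"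
    using DERIV_pow[of "Suc (Suc n)" u UNIV] greater by simp
  then show ?thesis
    by (rule has_field_derivative_transform_within_open[where S = "{0<..}"]) (use greater in auto)
next
  case equal
  have "((\<lambda>h. (max 0 h) ^ Suc (Suc n) / h) \<longlongrightarrow> 0) (at (0::real))"
  proof (rule tendsto_eq_rhs[OF Lim_transform_eventually])
    have "((\<lambda>h. (max 0 h) ^ Suc n) \<longlongrightarrow> (max 0 0) ^ Suc n) (at (0::real))"
      by (intro tendsto_intros)
    then show "((\<lambda>h. (max 0 h) ^ Suc n) \<longlongrightarrow> 0) (at (0::real))" by simp
    show "\<forall>\<^sub>F h in at (0::real). (max 0 h) ^ Suc n = (max 0 h) ^ Suc (Suc n) / h"
      by (auto simp: eventually_at_filter max_def)
  qed simp
  then show ?thesis using equal by (simp add: DERIV_def)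
qed

text \<open>
  The cutoff \<open>\<chi>\<^sub>R(x) = max(0, 1 - \<bar>x\<bar>\<^sup>2/R\<^sup>2)\<^sup>3\<close>; the third power makes it twice continuously
  differentiable.
\<close>

definition cutoff :: "real \<Rightarrow> 'a::euclidean_space \<Rightarrow> complex" where
  "cutoff R x = of_real ((max 0 (1 - (norm x)\<^sup>2 / R\<^sup>2)) ^ 3)"

definition cutoff1 :: "real \<Rightarrow> 'a::euclidean_space \<Rightarrow> 'a \<Rightarrow> complex" where
  "cutoff1 R b x = of_real (- 6 * (max 0 (1 - (norm x)\<^sup>2 / R\<^sup>2))\<^sup>2 * (x \<bullet> b) / R\<^sup>2)"

definition cutoff2 :: "real \<Rightarrow> 'a::euclidean_space \<Rightarrow> 'a \<Rightarrow> 'a \<Rightarrow> complex" where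
  "cutoff2 R b c x = of_real (24 * (max 0 (1 - (norm x)\<^sup>2 / R\<^sup>2)) * (x \<bullet> b) * (x \<bullet> c) / R ^ 4
     - 6 * (max 0 (1 - (norm x)\<^sup>2 / R\<^sup>2))\<^sup>2 * (b \<bullet> c) / R\<^sup>2)"

lemma C2_cutoff: "C2_with (cutoff R) (cutoff1 R) (cutoff2 R)" if "R > 0" for R :: real
  unfolding C2_with_def
proof (intro conjI ballI allI)
  fix x :: 'a
  let ?u = "\<lambda>x::'a. 1 - (norm x)\<^sup>2 / R\<^sup>2"
  have u: "(?u has_derivative (\<lambda>h. - 2 * (x \<bullet> h) / R\<^sup>2)) (at x)"
  proof -
    have "((\<lambda>x::'a. x \<bullet> x) has_derivative (\<lambda>h. x \<bullet> h + h \<bullet> x)) (at x)"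
      by (intro has_derivative_inner has_derivative_ident)
    then have "((\<lambda>x::'a. 1 - inverse (R\<^sup>2) * (x \<bullet> x)) has_derivative (\<lambda>h. 0 - inverse (R\<^sup>2) * (x \<bullet> h + h \<bullet> x))) (at x)"
      by (intro has_derivative_diff has_derivative_const has_derivative_mult_right)
    then show ?thesis
      by (simp add: power2_norm_eq_inner divide_inverse inner_commute mult_ac)
  qed
  have sum: "x \<bullet> h = (\<Sum>b\<in>Basis. (h \<bullet> b) * (x \<bullet> b))" for h
    by (subst euclidean_inner) (simp add: mult.commute)
  have p3: "((\<lambda>u. (max 0 u) ^ 3) has_derivative (*) (3 * (max 0 (?u x))\<^sup>2)) (at (?u x))"
    using has_derivative_positive_part_power[of 1 "?u x"]
    by (simp add: has_field_derivative_def numeral_3_eq_3 numeral_2_eq_2)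
  have p2: "((\<lambda>u. (max 0 u)\<^sup>2) has_derivative (*) (2 * (max 0 (?u x)))) (at (?u x))"
    using has_derivative_positive_part_power[of 0 "?u x"]
    by (simp add: has_field_derivative_def numeral_2_eq_2)
  have "((\<lambda>x. (max 0 (?u x)) ^ 3) has_derivative (\<lambda>h. 3 * (max 0 (?u x))\<^sup>2 * (- 2 * (x \<bullet> h) / R\<^sup>2))) (at x)"
    using has_derivative_compose[OF u p3] .
  from has_derivative_of_real[OF this]
  show "(cutoff R has_derivative (\<lambda>h. \<Sum>b\<in>Basis. of_real (h \<bullet> b) * cutoff1 R b x)) (at x)"
    unfolding cutoff_def
  proof (rule has_derivative_eq_rhs, intro ext)
    fix h :: 'a
    have "(\<Sum>b\<in>Basis. (h \<bullet> b) * (- 6 * (max 0 (?u x))\<^sup>2 * (x \<bullet> b) / R\<^sup>2))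
        = (- 6 * (max 0 (?u x))\<^sup>2 / R\<^sup>2) * (\<Sum>b\<in>Basis. (h \<bullet> b) * (x \<bullet> b))"
      unfolding sum_distrib_left by (intro sum.cong refl) simp
    also have "\<dots> = 3 * (max 0 (?u x))\<^sup>2 * (- 2 * (x \<bullet> h) / R\<^sup>2)"
      unfolding sum[of h, symmetric] by simp
    finally show "complex_of_real (3 * (max 0 (?u x))\<^sup>2 * (- 2 * (x \<bullet> h) / R\<^sup>2))
        = (\<Sum>b\<in>Basis. of_real (h \<bullet> b) * cutoff1 R b x)"
      unfolding cutoff1_def by (simp only: of_real_mult[symmetric] of_real_sum[symmetric])
  qed
  fix b :: 'a assume b: "b \<in> Basis"
  have q: "((\<lambda>x. (max 0 (?u x))\<^sup>2) has_derivative (\<lambda>h. 2 * (max 0 (?u x)) * (- 2 * (x \<bullet> h) / R\<^sup>2))) (at x)"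
    using has_derivative_compose[OF u p2] .
  have "((\<lambda>x. - 6 * (max 0 (?u x))\<^sup>2 * (x \<bullet> b) / R\<^sup>2) has_derivative
      (\<lambda>h. - 6 / R\<^sup>2 * ((max 0 (?u x))\<^sup>2 * (h \<bullet> b) + 2 * (max 0 (?u x)) * (- 2 * (x \<bullet> h) / R\<^sup>2) * (x \<bullet> b)))) (at x)"
  proof -
    have "((\<lambda>x. (- 6 / R\<^sup>2) * ((max 0 (?u x))\<^sup>2 * (x \<bullet> b))) has_derivative
      (\<lambda>h. - 6 / R\<^sup>2 * ((max 0 (?u x))\<^sup>2 * (h \<bullet> b) + 2 * (max 0 (?u x)) * (- 2 * (x \<bullet> h) / R\<^sup>2) * (x \<bullet> b)))) (at x)"
      by (intro has_derivative_mult_right has_derivative_mult q has_derivative_inner_left has_derivative_ident)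
    moreover have "(- 6 / R\<^sup>2) * ((max 0 (?u x))\<^sup>2 * (x \<bullet> b)) = - 6 * (max 0 (?u x))\<^sup>2 * (x \<bullet> b) / R\<^sup>2" for x
      by simp
    ultimately show ?thesis by (simp only:)
  qed
  from has_derivative_of_real[OF this]
  have D: "(cutoff1 R b has_derivative (\<lambda>h. of_real (- 6 / R\<^sup>2 * ((max 0 (?u x))\<^sup>2 * (h \<bullet> b)
        + 2 * (max 0 (?u x)) * (- 2 * (x \<bullet> h) / R\<^sup>2) * (x \<bullet> b))))) (at x)"
    unfolding cutoff1_def .
  have "- 6 / R\<^sup>2 * ((max 0 (?u x))\<^sup>2 * (h \<bullet> b) + 2 * (max 0 (?u x)) * (- 2 * (x \<bullet> h) / R\<^sup>2) * (x \<bullet> b))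
      = (\<Sum>c\<in>Basis. (h \<bullet> c) * (24 * (max 0 (?u x)) * (x \<bullet> b) * (x \<bullet> c) / R ^ 4
         - 6 * (max 0 (?u x))\<^sup>2 * (b \<bullet> c) / R\<^sup>2))" for h
  proof -
    have hb: "h \<bullet> b = (\<Sum>c\<in>Basis. (h \<bullet> c) * (b \<bullet> c))" by (rule euclidean_inner)
    have "(\<Sum>c\<in>Basis. (h \<bullet> c) * (24 * (max 0 (?u x)) * (x \<bullet> b) * (x \<bullet> c) / R ^ 4
         - 6 * (max 0 (?u x))\<^sup>2 * (b \<bullet> c) / R\<^sup>2))
      = (\<Sum>c\<in>Basis. (24 * (max 0 (?u x)) * (x \<bullet> b) / R ^ 4) * ((h \<bullet> c) * (x \<bullet> c)))
       - (\<Sum>c\<in>Basis. (6 * (max 0 (?u x))\<^sup>2 / R\<^sup>2) * ((h \<bullet> c) * (b \<bullet> c)))"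
      by (simp add: sum_subtractf[symmetric] algebra_simps)
    also have "\<dots> = (24 * (max 0 (?u x)) * (x \<bullet> b) / R ^ 4) * (x \<bullet> h) - (6 * (max 0 (?u x))\<^sup>2 / R\<^sup>2) * (h \<bullet> b)"
      by (simp only: sum_distrib_left[symmetric] sum[of h, symmetric] hb[symmetric])
    finally show ?thesis using that by (simp add: field_simps power2_eq_square power4_eq_xxxx)
  qed
  then show "(cutoff1 R b has_derivative (\<lambda>h. \<Sum>c\<in>Basis. of_real (h \<bullet> c) * cutoff2 R b c x)) (at x)"
    by (intro has_derivative_eq_rhs[OF D]) (simp only: cutoff2_def of_real_sum of_real_mult)
next
  fix b c :: 'a
  show "continuous_on UNIV (cutoff2 R b c)"
    unfolding cutoff2_def using that by (intro continuous_intros) auto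
qed

lemma cutoff_support: "cutoff R x = 0" if "R > 0" "norm x > R"
proof -
  have "R\<^sup>2 \<le> (norm x)\<^sup>2" using that by (intro power_mono) auto
  then have "1 - (norm x)\<^sup>2 / R\<^sup>2 \<le> 0" using that by (simp add: field_simps)
  then show ?thesis by (simp add: cutoff_def max_def)
qed

lemma cutoff_bounds:
  assumes R: "R \<ge> 1" and b: "b \<in> Basis"
  shows "norm (cutoff R x) \<le> 1" "norm (cutoff1 R b x) \<le> 6 * norm x / R"
    "norm (cutoff2 R b b x) \<le> (24 * (norm x)\<^sup>2 + 6) / R"
proof -
  define m where "m = max 0 (1 - (norm x)\<^sup>2 / R\<^sup>2)"
  have m: "0 \<le> m" "m \<le> 1" "m\<^sup>2 \<le> 1" "m ^ 3 \<le> 1" by (auto simp: m_def power_le_one)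
  have xb: "\<bar>x \<bullet> b\<bar> \<le> norm x" by (rule Basis_le_norm[OF b])
  have R2: "R \<le> R\<^sup>2" "R \<le> R ^ 4" using R by (auto intro: self_le_power)
  show "norm (cutoff R x) \<le> 1" unfolding cutoff_def m_def[symmetric] norm_of_real using m by simp
  have "norm (cutoff1 R b x) = 6 * (m\<^sup>2 * \<bar>x \<bullet> b\<bar>) / R\<^sup>2"
    unfolding cutoff1_def m_def[symmetric] norm_of_real using m R by (simp add: abs_mult)
  also have "\<dots> \<le> 6 * (1 * norm x) / R"
    using m xb R R2 by (intro frac_le mult_mono) auto
  finally show "norm (cutoff1 R b x) \<le> 6 * norm x / R" by simp
  have "\<bar>24 * m * (x \<bullet> b) * (x \<bullet> b) / R ^ 4 - 6 * m\<^sup>2 * (b \<bullet> b) / R\<^sup>2\<bar>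
      \<le> \<bar>24 * m * (x \<bullet> b) * (x \<bullet> b) / R ^ 4\<bar> + \<bar>6 * m\<^sup>2 * (b \<bullet> b) / R\<^sup>2\<bar>" by (rule abs_triangle_ineq4)
  also have "\<bar>24 * m * (x \<bullet> b) * (x \<bullet> b) / R ^ 4\<bar> = 24 * (m * (\<bar>x \<bullet> b\<bar> * \<bar>x \<bullet> b\<bar>)) / R ^ 4"
    using m R by (simp add: abs_mult)
  also have "\<dots> \<le> 24 * (1 * (norm x * norm x)) / R"
    using m xb R R2 by (intro frac_le mult_mono) auto
  also have "\<bar>6 * m\<^sup>2 * (b \<bullet> b) / R\<^sup>2\<bar> = 6 * m\<^sup>2 / R\<^sup>2" using b R by (simp add: abs_mult)
  also have "\<dots> \<le> 6 * 1 / R" using m R R2 by (intro frac_le mult_mono) auto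
  finally show "norm (cutoff2 R b b x) \<le> (24 * (norm x)\<^sup>2 + 6) / R"
    unfolding cutoff2_def m_def[symmetric] norm_of_real by (simp add: power2_eq_square add_divide_distrib)
qed

lemma cutoff_tendsto: "(\<lambda>n. cutoff (real (Suc n)) x) \<longlonglongrightarrow> 1"
proof -
  have "(\<lambda>n. 1 - (norm x)\<^sup>2 / (real (Suc n))\<^sup>2) \<longlonglongrightarrow> 1" by real_asymp
  then have "(\<lambda>n. of_real ((max 0 (1 - (norm x)\<^sup>2 / (real (Suc n))\<^sup>2)) ^ 3)) \<longlonglongrightarrow> (of_real ((max 0 1) ^ 3) :: complex)"
    by (intro tendsto_intros)
  then show ?thesis by (simp add: cutoff_def)
qed

section \<open>The evolution of a Gaussian\<close>

definition gflow_denom :: "complex \<Rightarrow> real \<Rightarrow> complex" where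
  "gflow_denom B t = 1 + 4 * \<i> * B * of_real t"

text \<open>
  The heat flow of \<open>exp (-B \<bar>x\<bar>\<^sup>2 + w \<bullet> x)\<close> at the imaginary time \<open>\<i>t\<close>. The factor \<open>z\<^sup>-\<^sup>d\<^sup>/\<^sup>2\<close>, where \<open>z\<close> is
  \<open>gflow_denom\<close>, is a power of the principal root of \<open>1/z\<close>; this is smooth in time because \<open>z\<close> avoids the
  nonpositive real axis. \<open>gflow1\<close> and \<open>gflow2\<close> are its partial derivatives in space.
\<close>

definition gflow :: "complex \<Rightarrow> ('a::euclidean_space \<Rightarrow> complex) \<Rightarrow> real \<Rightarrow> 'a \<Rightarrow> complex" where
  "gflow B w t x = csqrt (1 / gflow_denom B t) ^ DIM('a) *
     exp ((- B * of_real ((norm x)\<^sup>2) + cdot w x + \<i> * of_real t * (\<Sum>b\<in>Basis. (w b)\<^sup>2)) / gflow_denom B t)"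

definition gflow1 :: "complex \<Rightarrow> ('a::euclidean_space \<Rightarrow> complex) \<Rightarrow> real \<Rightarrow> 'a \<Rightarrow> 'a \<Rightarrow> complex" where
  "gflow1 B w t b x = gflow B w t x * ((w b - 2 * B * of_real (x \<bullet> b)) / gflow_denom B t)"

definition gflow2 :: "complex \<Rightarrow> ('a::euclidean_space \<Rightarrow> complex) \<Rightarrow> real \<Rightarrow> 'a \<Rightarrow> 'a \<Rightarrow> 'a \<Rightarrow> complex" where
  "gflow2 B w t b c x = gflow B w t x * ((w b - 2 * B * of_real (x \<bullet> b)) / gflow_denom B t
      * ((w c - 2 * B * of_real (x \<bullet> c)) / gflow_denom B t) - 2 * B * of_real (b \<bullet> c) / gflow_denom B t)"

lemma gflow_denom_not_nonpos: "gflow_denom B t \<notin> \<real>\<^sub>\<le>\<^sub>0" if "Re B > 0"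
proof
  assume "gflow_denom B t \<in> \<real>\<^sub>\<le>\<^sub>0"
  then have "Im (gflow_denom B t) = 0" "Re (gflow_denom B t) \<le> 0"
    by (auto simp: complex_nonpos_Reals_iff)
  moreover from this(1) have "t = 0" using that by (simp add: gflow_denom_def)
  ultimately show False by (simp add: gflow_denom_def)
qed

lemma gflow_denom_nonzero: "gflow_denom B t \<noteq> 0" if "Re B > 0"
  using gflow_denom_not_nonpos[OF that, of t] by auto

lemma gflow_denom_inverse_not_nonpos: "1 / gflow_denom B t \<notin> \<real>\<^sub>\<le>\<^sub>0" if "Re B > 0"
  using gflow_denom_not_nonpos[OF that, of t] by (simp add: divide_inverse)

lemma continuous_gflow_denom [continuous_intros]: "continuous_on A (gflow_denom B)"
  unfolding gflow_denom_def by (intro continuous_intros)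

text \<open>
  The modulus of the evolved Gaussian is a Gaussian again, with this coefficient in place of \<open>B\<close>.
\<close>

lemma Re_divide_gflow_denom: "Re (B / gflow_denom B t) = Re B / (norm (gflow_denom B t))\<^sup>2"
proof -
  have "Re B * Re (gflow_denom B t) + Im B * Im (gflow_denom B t) = Re B"
    by (simp add: gflow_denom_def algebra_simps)
  then show ?thesis by (simp add: Re_divide cmod_power2)
qed

lemma norm_csqrt: "norm (csqrt z) = sqrt (norm z)"
  by (metis norm_ge_zero norm_power power2_csqrt real_sqrt_unique)

lemma cdot_has_derivative: "(cdot w has_derivative cdot w) (at x)"
  unfolding cdot_def[abs_def]
  by (intro has_derivative_sum has_derivative_mult_right has_derivative_of_real has_derivative_inner_left has_derivative_ident)

lemma cdot_bound: "norm (cdot w x) \<le> (\<Sum>b\<in>Basis. norm (w b)) * norm x"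
proof -
  have "norm (cdot w x) \<le> (\<Sum>b\<in>Basis. norm (w b) * \<bar>x \<bullet> b\<bar>)"
    unfolding cdot_def by (rule sum_norm_le) (simp add: norm_mult)
  also have "\<dots> \<le> (\<Sum>b\<in>Basis. norm (w b) * norm x)"
    by (intro sum_mono mult_left_mono Basis_le_norm) auto
  finally show ?thesis by (simp add: sum_distrib_right)
qed

lemma continuous_cdot [continuous_intros]: "continuous_on A (cdot w)"
  unfolding cdot_def by (intro continuous_intros)

lemma continuous_gflow [continuous_intros]: "continuous_on A (gflow B w t)"
  unfolding gflow_def divide_inverse by (intro continuous_intros)

lemma C2_gflow:
  fixes w :: "'a::euclidean_space \<Rightarrow> complex"
  shows "C2_with (gflow B w t) (gflow1 B w t) (gflow2 B w t)"
  unfolding C2_with_def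
proof (intro conjI ballI allI)
  fix x :: 'a
  let ?z = "gflow_denom B t"
  let ?q = "\<lambda>x::'a. (- B * of_real ((norm x)\<^sup>2) + cdot w x + \<i> * of_real t * (\<Sum>b\<in>Basis. (w b)\<^sup>2))"
  have q: "(?q has_derivative (\<lambda>h. - B * of_real (2 * (x \<bullet> h)) + cdot w h)) (at x)"
  proof -
    have "((\<lambda>x::'a. of_real (x \<bullet> x) :: complex) has_derivative (\<lambda>h. of_real (x \<bullet> h + h \<bullet> x))) (at x)"
      by (intro has_derivative_of_real has_derivative_inner has_derivative_ident)
    then have "(?q has_derivative (\<lambda>h. - B * of_real (x \<bullet> h + h \<bullet> x) + cdot w h + 0)) (at x)"
      unfolding power2_norm_eq_inner
      by (intro has_derivative_add has_derivative_mult_right cdot_has_derivative has_derivative_const)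
    then show ?thesis by (simp add: inner_commute)
  qed
  have e: "(exp has_derivative (*) (exp (y / ?z))) (at (y / ?z))" for y :: complex
    using DERIV_exp[of "y / ?z"] by (simp add: has_field_derivative_def)
  have "((\<lambda>x. ?q x / ?z) has_derivative (\<lambda>h. (- B * of_real (2 * (x \<bullet> h)) + cdot w h) / ?z)) (at x)"
    using has_derivative_mult_left[OF q, of "inverse ?z"] by (simp add: divide_inverse)
  from has_derivative_mult_right[OF has_derivative_compose[OF this e], of "csqrt (1 / ?z) ^ DIM('a)"]
  have D: "(gflow B w t has_derivative (\<lambda>h. gflow B w t x * ((- B * of_real (2 * (x \<bullet> h)) + cdot w h) / ?z))) (at x)"
    unfolding gflow_def[abs_def] by (simp add: mult.assoc)
  have sum: "gflow B w t x * ((- B * of_real (2 * (x \<bullet> h)) + cdot w h) / ?z)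
      = (\<Sum>b\<in>Basis. of_real (h \<bullet> b) * gflow1 B w t b x)" for h
  proof -
    have xh: "x \<bullet> h = (\<Sum>b\<in>Basis. (x \<bullet> b) * (h \<bullet> b))" by (rule euclidean_inner)
    have "- B * of_real (2 * (x \<bullet> h)) + cdot w h = (\<Sum>b\<in>Basis. of_real (h \<bullet> b) * (w b - 2 * B * of_real (x \<bullet> b)))"
      unfolding xh cdot_def
      by (simp add: sum_distrib_left algebra_simps sum_subtractf sum_negf sum.distrib)
    then show ?thesis
      by (simp add: gflow1_def sum_divide_distrib sum_distrib_left mult_ac)
  qed
  show "(gflow B w t has_derivative (\<lambda>h. \<Sum>b\<in>Basis. of_real (h \<bullet> b) * gflow1 B w t b x)) (at x)"
    using D unfolding sum .
  fix b :: 'a assume b: "b \<in> Basis"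
  have l: "((\<lambda>x. (w b - 2 * B * of_real (x \<bullet> b)) / ?z) has_derivative (\<lambda>h. - 2 * B * of_real (h \<bullet> b) / ?z)) (at x)"
  proof -
    have "((\<lambda>x. (w b - 2 * B * of_real (x \<bullet> b)) * inverse ?z) has_derivative (\<lambda>h. (0 - 2 * B * of_real (h \<bullet> b)) * inverse ?z)) (at x)"
      by (intro has_derivative_mult_left has_derivative_diff has_derivative_const has_derivative_mult_right
          has_derivative_of_real has_derivative_inner_left has_derivative_ident)
    then show ?thesis by (simp add: divide_inverse)
  qed
  have "(gflow1 B w t b has_derivative
      (\<lambda>h. gflow B w t x * (- 2 * B * of_real (h \<bullet> b) / ?z)
         + (\<Sum>c\<in>Basis. of_real (h \<bullet> c) * gflow1 B w t c x) * ((w b - 2 * B * of_real (x \<bullet> b)) / ?z))) (at x)"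
    unfolding gflow1_def[of B w t b, abs_def] using has_derivative_mult[OF D[unfolded sum] l] .
  moreover have "gflow B w t x * (- 2 * B * of_real (h \<bullet> b) / ?z)
         + (\<Sum>c\<in>Basis. of_real (h \<bullet> c) * gflow1 B w t c x) * ((w b - 2 * B * of_real (x \<bullet> b)) / ?z)
       = (\<Sum>c\<in>Basis. of_real (h \<bullet> c) * gflow2 B w t b c x)" for h
  proof -
    have hb: "h \<bullet> b = (\<Sum>c\<in>Basis. (h \<bullet> c) * (b \<bullet> c))" by (rule euclidean_inner)
    have "gflow B w t x * (- 2 * B * of_real (h \<bullet> b) / ?z)
        = (\<Sum>c\<in>Basis. of_real (h \<bullet> c) * (gflow B w t x * (- (2 * B * of_real (b \<bullet> c) / ?z))))"
      unfolding hb by (simp add: sum_distrib_left sum_divide_distrib sum_negf mult_ac)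
    moreover have "(\<Sum>c\<in>Basis. of_real (h \<bullet> c) * gflow1 B w t c x) * ((w b - 2 * B * of_real (x \<bullet> b)) / ?z)
        = (\<Sum>c\<in>Basis. of_real (h \<bullet> c) * (gflow B w t x * ((w b - 2 * B * of_real (x \<bullet> b)) / ?z * ((w c - 2 * B * of_real (x \<bullet> c)) / ?z))))"
      unfolding gflow1_def sum_distrib_right by (intro sum.cong refl) (simp only: mult_ac)
    ultimately show ?thesis
      unfolding gflow2_def by (simp only: sum.distrib[symmetric] distrib_left[symmetric] diff_conv_add_uminus add.commute)
  qed
  ultimately show "(gflow1 B w t b has_derivative (\<lambda>h. \<Sum>c\<in>Basis. of_real (h \<bullet> c) * gflow2 B w t b c x)) (at x)"
    by simp
next
  fix b c :: 'a
  show "continuous_on UNIV (gflow2 B w t b c)"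
    unfolding gflow2_def divide_inverse by (intro continuous_intros)
qed

lemma laplacian_gflow:
  fixes w :: "'a::euclidean_space \<Rightarrow> complex"
  assumes "Re B > 0"
  shows "laplacian (gflow B w t) x = gflow B w t x *
     ((4 * B\<^sup>2 * of_real ((norm x)\<^sup>2) - 4 * B * cdot w x + (\<Sum>b\<in>Basis. (w b)\<^sup>2)) / (gflow_denom B t)\<^sup>2
       - 2 * B * of_nat DIM('a) / gflow_denom B t)"
proof -
  let ?z = "gflow_denom B t"
  have "laplacian (gflow B w t) x
      = (\<Sum>b\<in>Basis. gflow B w t x * ((w b - 2 * B * of_real (x \<bullet> b))\<^sup>2 / ?z\<^sup>2 - 2 * B / ?z))"
    unfolding C2_laplacian[OF C2_gflow] gflow2_def
    by (intro sum.cong refl) (simp add: power2_eq_square)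
  also have "\<dots> = gflow B w t x * ((\<Sum>b\<in>Basis. (w b - 2 * B * of_real (x \<bullet> b))\<^sup>2) / ?z\<^sup>2 - 2 * B * of_nat DIM('a) / ?z)"
    by (simp add: sum_distrib_left[symmetric] sum_subtractf sum_divide_distrib mult_ac)
  also have "(\<Sum>b\<in>Basis. (w b - 2 * B * of_real (x \<bullet> b))\<^sup>2)
      = 4 * B\<^sup>2 * of_real ((norm x)\<^sup>2) - 4 * B * cdot w x + (\<Sum>b\<in>Basis. (w b)\<^sup>2)"
  proof -
    have "(w b - 2 * B * of_real (x \<bullet> b))\<^sup>2 = 4 * B\<^sup>2 * of_real ((x \<bullet> b)\<^sup>2) - 4 * B * (w b * of_real (x \<bullet> b)) + (w b)\<^sup>2" for b
      by (simp add: power2_eq_square algebra_simps)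
    then show ?thesis
      by (simp add: norm_square_Basis cdot_def sum.distrib sum_subtractf sum_distrib_left)
  qed
  finally show ?thesis .
qed

text \<open>
  The equation holds pointwise. The time variable is complexified to \<open>s\<close>, so that the chain rule for
  holomorphic functions differentiates the square root.
\<close>

lemma gflow_time_derivative:
  fixes w :: "'a::euclidean_space \<Rightarrow> complex"
  assumes "Re B > 0"
  shows "((\<lambda>t. gflow B w t x) has_vector_derivative \<i> * laplacian (gflow B w t) x) (at t)"
proof -
  let ?z = "gflow_denom B"
  let ?W = "\<Sum>b\<in>Basis. (w b)\<^sup>2"
  let ?q = "\<lambda>s. - B * of_real ((norm x)\<^sup>2) + cdot w x + \<i> * s * ?W"
  define Z where "Z s = 1 + 4 * \<i> * B * s" for s
  have Zt: "Z (of_real t) = ?z t" for t by (simp add: Z_def gflow_denom_def)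
  let ?d = "DIM('a)"
  have z0: "?z t \<noteq> 0" by (rule gflow_denom_nonzero[OF assms])
  have dZ: "(Z has_field_derivative 4 * \<i> * B) (at (of_real t))"
    unfolding Z_def by (auto intro!: derivative_eq_intros)
  have di: "((\<lambda>s. 1 / Z s) has_field_derivative - (4 * \<i> * B) / (?z t)\<^sup>2) (at (of_real t))"
    by (rule DERIV_cong[OF DERIV_divide[OF DERIV_const dZ]]) (use z0 in \<open>auto simp: Zt power2_eq_square\<close>)
  define s0 where "s0 = csqrt (1 / ?z t)"
  have s0: "s0 \<noteq> 0" "s0\<^sup>2 = 1 / ?z t" using z0 by (auto simp: s0_def)
  have ds: "((\<lambda>s. csqrt (1 / Z s)) has_field_derivative 1 / (2 * s0) * (- (4 * \<i> * B) / (?z t)\<^sup>2)) (at (of_real t))"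
    by (rule DERIV_chain2[where f = csqrt, OF _ di])
       (use gflow_denom_inverse_not_nonpos[OF assms, of t] in
         \<open>auto simp: Zt s0_def intro!: DERIV_cong[OF has_field_derivative_csqrt] simp: inverse_eq_divide\<close>)
  have dp: "((\<lambda>s. csqrt (1 / Z s) ^ ?d) has_field_derivative
      of_nat ?d * (1 / (2 * s0) * (- (4 * \<i> * B) / (?z t)\<^sup>2) * s0 ^ (?d - Suc 0))) (at (of_real t))"
    using DERIV_power[OF ds, of ?d] by (simp add: Zt s0_def mult_ac)
  have dp_eq: "of_nat ?d * (1 / (2 * s0) * (- (4 * \<i> * B) / (?z t)\<^sup>2) * s0 ^ (?d - Suc 0))
      = s0 ^ ?d * (- 2 * \<i> * B * of_nat ?d / ?z t)"
  proof -
    have "s0 ^ ?d = s0 * s0 ^ (?d - Suc 0)" by (simp flip: power_Suc)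
    moreover have "1 / s0 = s0 * ?z t" using s0 z0 by (simp add: field_simps power2_eq_square)
    ultimately show ?thesis using z0 s0(1) by (simp add: field_simps power2_eq_square)
  qed
  have dq: "((\<lambda>s. ?q s / Z s) has_field_derivative (\<i> * ?W * ?z t - ?q (of_real t) * (4 * \<i> * B)) / (?z t * ?z t)) (at (of_real t))"
    by (rule DERIV_cong[OF DERIV_divide[OF _ dZ, where D = "\<i> * ?W"]])
       (use z0 in \<open>auto simp: Zt intro!: derivative_eq_intros\<close>)
  have "((\<lambda>s. csqrt (1 / Z s) ^ ?d * exp (?q s / Z s)) has_field_derivative
     (s0 ^ ?d * (- 2 * \<i> * B * of_nat ?d / ?z t)) * exp (?q (of_real t) / ?z t)
     + (exp (?q (of_real t) / ?z t) * ((\<i> * ?W * ?z t - ?q (of_real t) * (4 * \<i> * B)) / (?z t * ?z t))) * s0 ^ ?d) (at (of_real t))"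
    using DERIV_mult[OF dp[unfolded dp_eq] DERIV_chain2[OF DERIV_exp dq]] by (simp add: Zt s0_def)
  moreover have "(s0 ^ ?d * (- 2 * \<i> * B * of_nat ?d / ?z t)) * exp (?q (of_real t) / ?z t)
     + (exp (?q (of_real t) / ?z t) * ((\<i> * ?W * ?z t - ?q (of_real t) * (4 * \<i> * B)) / (?z t * ?z t))) * s0 ^ ?d
     = \<i> * laplacian (gflow B w t) x"
  proof -
    have num: "\<i> * ?W * ?z t - ?q (of_real t) * (4 * \<i> * B)
        = \<i> * (4 * B\<^sup>2 * of_real ((norm x)\<^sup>2) - 4 * B * cdot w x + ?W)"
      by (simp add: gflow_denom_def power2_eq_square algebra_simps)
    have G: "gflow B w t x = s0 ^ ?d * exp (?q (of_real t) / ?z t)"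
      by (simp add: gflow_def s0_def)
    show ?thesis unfolding laplacian_gflow[OF assms] num G
      using z0 by (simp add: field_simps power2_eq_square)
  qed
  ultimately have "((\<lambda>s. csqrt (1 / Z s) ^ ?d * exp (?q s / Z s)) has_field_derivative \<i> * laplacian (gflow B w t) x) (at (of_real t))"
    by simp
  from has_vector_derivative_real_field[OF this] show ?thesis
    by (simp add: gflow_def Zt)
qed

text \<open>
  Locally uniformly in time the evolution is dominated, even after multiplication by a quadratic
  polynomial, by a fixed Gaussian; this is what justifies all limits under the integral below.
\<close>

lemma gflow_bound:
  fixes w :: "'a::euclidean_space \<Rightarrow> complex"
  assumes B: "Re B > 0"
  obtains M c where "c > 0" "M \<ge> 0"
    "\<And>t x. \<bar>t\<bar> \<le> T \<Longrightarrow> (1 + norm x)\<^sup>2 * norm (gflow B w t x) \<le> M * exp (- c * (norm x)\<^sup>2)"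
proof -
  let ?z = "gflow_denom B"
  let ?W = "\<Sum>b\<in>Basis. (w b)\<^sup>2"
  let ?Cw = "\<Sum>b\<in>Basis. norm (w b)"
  note z0 = gflow_denom_nonzero[OF B]
  have cont: "continuous_on {-\<bar>T\<bar>..\<bar>T\<bar>} (\<lambda>t. 1 / norm (?z t))"
    by (intro continuous_intros) (use z0 in auto)
  have contR: "continuous_on {-\<bar>T\<bar>..\<bar>T\<bar>} (\<lambda>t. Re B / (norm (?z t))\<^sup>2)"
    by (intro continuous_intros) (use z0 in auto)
  have "\<exists>u\<in>{-\<bar>T\<bar>..\<bar>T\<bar>}. \<forall>y\<in>{-\<bar>T\<bar>..\<bar>T\<bar>}. 1 / norm (?z y) \<le> 1 / norm (?z u)"
    by (rule continuous_attains_sup[OF _ _ cont]) auto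
  then obtain t1 where t1: "\<And>t. \<bar>t\<bar> \<le> \<bar>T\<bar> \<Longrightarrow> 1 / norm (?z t) \<le> 1 / norm (?z t1)"
    by (metis abs_le_D1 abs_le_D2 atLeastAtMost_iff minus_le_iff)
  have "\<exists>u\<in>{-\<bar>T\<bar>..\<bar>T\<bar>}. \<forall>y\<in>{-\<bar>T\<bar>..\<bar>T\<bar>}. Re B / (norm (?z u))\<^sup>2 \<le> Re B / (norm (?z y))\<^sup>2"
    by (rule continuous_attains_inf[OF _ _ contR]) auto
  then obtain t2 where t2: "\<And>t. \<bar>t\<bar> \<le> \<bar>T\<bar> \<Longrightarrow> Re B / (norm (?z t2))\<^sup>2 \<le> Re B / (norm (?z t))\<^sup>2"
    by (metis abs_le_D1 abs_le_D2 atLeastAtMost_iff minus_le_iff)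
  define K where "K = 1 / norm (?z t1)"
  define r where "r = Re B / (norm (?z t2))\<^sup>2"
  have K: "K > 0" and r: "r > 0" using z0 B by (auto simp: K_def r_def)
  \<comment> \<open>\<open>2\<close> absorbs the polynomial, by \<open>1 + r \<le> exp r\<close>; half of the decay rate \<open>r\<close> pays for the linear term.\<close>
  define a where "a = 2 + K * ?Cw"
  define M where "M = sqrt K ^ DIM('a) * exp (a\<^sup>2 / (2 * r) + K * (\<bar>T\<bar> * norm ?W))"
  show thesis
  proof (rule that[of "r / 2" M])
    show "r / 2 > 0" using r by simp
    show "M \<ge> 0" using K by (simp add: M_def)
    fix t :: real and x :: 'a assume tT: "\<bar>t\<bar> \<le> T"
    then have t: "\<bar>t\<bar> \<le> \<bar>T\<bar>" by simp
    have "(1 + norm x)\<^sup>2 \<le> (exp (norm x))\<^sup>2" by (intro power_mono exp_ge_add_one_self) auto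
    then have poly: "(1 + norm x)\<^sup>2 \<le> exp (2 * norm x)" by (simp add: exp_double)
    have zK: "1 / norm (?z t) \<le> K" using t1[OF t] by (simp add: K_def)
    have amp: "norm (csqrt (1 / ?z t) ^ DIM('a)) \<le> sqrt K ^ DIM('a)"
      unfolding norm_power norm_csqrt by (intro power_mono real_sqrt_le_mono) (use zK in \<open>auto simp: norm_divide\<close>)
    have "Re ((- B * of_real ((norm x)\<^sup>2) + cdot w x + \<i> * of_real t * ?W) / ?z t)
        = - ((norm x)\<^sup>2 * Re (B / ?z t)) + Re ((cdot w x + \<i> * of_real t * ?W) / ?z t)"
    proof -
      have "(- B * of_real ((norm x)\<^sup>2) + cdot w x + \<i> * of_real t * ?W) / ?z t
         = - (of_real ((norm x)\<^sup>2) * (B / ?z t)) + (cdot w x + \<i> * of_real t * ?W) / ?z t"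
        by (simp add: add_divide_distrib diff_divide_distrib mult_ac)
      then show ?thesis by (simp only: plus_complex.sel uminus_complex.sel Re_complex_of_real Im_complex_of_real times_complex.sel)
    qed
    also have "\<dots> \<le> - ((norm x)\<^sup>2 * r) + norm ((cdot w x + \<i> * of_real t * ?W) / ?z t)"
    proof -
      have "(norm x)\<^sup>2 * r \<le> (norm x)\<^sup>2 * Re (B / ?z t)"
        using t2[OF t] by (intro mult_left_mono) (auto simp: Re_divide_gflow_denom r_def)
      then show ?thesis by (intro add_mono complex_Re_le_cmod) auto
    qed
    also have "norm ((cdot w x + \<i> * of_real t * ?W) / ?z t) \<le> K * (?Cw * norm x + \<bar>T\<bar> * norm ?W)"
    proof -
      have "norm (cdot w x + \<i> * of_real t * ?W) \<le> ?Cw * norm x + \<bar>T\<bar> * norm ?W"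
        by (rule norm_triangle_mono[OF cdot_bound]) (use t in \<open>auto simp: norm_mult intro!: mult_right_mono\<close>)
      then have "(1 / norm (?z t)) * norm (cdot w x + \<i> * of_real t * ?W) \<le> K * (?Cw * norm x + \<bar>T\<bar> * norm ?W)"
        using K by (intro mult_mono zK) auto
      then show ?thesis by (simp add: norm_divide)
    qed
    finally have ex: "Re ((- B * of_real ((norm x)\<^sup>2) + cdot w x + \<i> * of_real t * ?W) / ?z t)
        \<le> - ((norm x)\<^sup>2 * r) + K * (?Cw * norm x + \<bar>T\<bar> * norm ?W)" by simp
    have sq: "a * norm x \<le> r / 2 * (norm x)\<^sup>2 + a\<^sup>2 / (2 * r)"
    proof -
      have "0 \<le> (r * norm x - a)\<^sup>2 / (2 * r)" using r by simp
      also have "\<dots> = r / 2 * (norm x)\<^sup>2 + a\<^sup>2 / (2 * r) - a * norm x"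
        using r by (simp add: power2_eq_square field_simps)
      finally show ?thesis by simp
    qed
    have "(1 + norm x)\<^sup>2 * norm (gflow B w t x)
        \<le> exp (2 * norm x) * (sqrt K ^ DIM('a) * exp (- ((norm x)\<^sup>2 * r) + K * (?Cw * norm x + \<bar>T\<bar> * norm ?W)))"
      unfolding gflow_def norm_mult norm_exp_eq_Re
      using ex K by (intro mult_mono poly amp) auto
    also have "\<dots> = sqrt K ^ DIM('a) * exp (a * norm x - r * (norm x)\<^sup>2 + K * (\<bar>T\<bar> * norm ?W))"
    proof -
      have "exp (2 * norm x) * exp (- ((norm x)\<^sup>2 * r) + K * (?Cw * norm x + \<bar>T\<bar> * norm ?W))
         = exp (a * norm x - r * (norm x)\<^sup>2 + K * (\<bar>T\<bar> * norm ?W))"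
        unfolding exp_add[symmetric] a_def by (simp add: algebra_simps)
      then show ?thesis by (simp only: mult.left_commute)
    qed
    also have "\<dots> \<le> sqrt K ^ DIM('a) * exp (a\<^sup>2 / (2 * r) + K * (\<bar>T\<bar> * norm ?W) + - (r / 2) * (norm x)\<^sup>2)"
      using sq K by (intro mult_left_mono) (auto simp: algebra_simps)
    also have "\<dots> = M * exp (- (r / 2) * (norm x)\<^sup>2)"
      unfolding M_def exp_add[of "a\<^sup>2 / (2 * r) + K * (\<bar>T\<bar> * norm ?W)"] by (simp only: mult.assoc)
    finally show "(1 + norm x)\<^sup>2 * norm (gflow B w t x) \<le> M * exp (- (r / 2) * (norm x)\<^sup>2)" .
  qed
qed

lemma laplacian_gflow_bound:
  fixes w :: "'a::euclidean_space \<Rightarrow> complex"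
  assumes B: "Re B > 0"
  obtains M where "M \<ge> 0"
    "\<And>t x. \<bar>t\<bar> \<le> T \<Longrightarrow> norm (laplacian (gflow B w t) x) \<le> M * ((1 + norm x)\<^sup>2 * norm (gflow B w t x))"
proof -
  let ?z = "gflow_denom B"
  let ?W = "\<Sum>b\<in>Basis. (w b)\<^sup>2"
  let ?Cw = "\<Sum>b\<in>Basis. norm (w b)"
  have Cw: "0 \<le> ?Cw" by (intro sum_nonneg) auto
  note z0 = gflow_denom_nonzero[OF B]
  have cont: "continuous_on {-\<bar>T\<bar>..\<bar>T\<bar>} (\<lambda>t. 1 / norm (?z t))"
    by (intro continuous_intros) (use z0 in auto)
  have "\<exists>u\<in>{-\<bar>T\<bar>..\<bar>T\<bar>}. \<forall>y\<in>{-\<bar>T\<bar>..\<bar>T\<bar>}. 1 / norm (?z y) \<le> 1 / norm (?z u)"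
    by (rule continuous_attains_sup[OF _ _ cont]) auto
  then obtain t1 where t1: "\<And>t. \<bar>t\<bar> \<le> \<bar>T\<bar> \<Longrightarrow> 1 / norm (?z t) \<le> 1 / norm (?z t1)"
    by (metis abs_le_D1 abs_le_D2 atLeastAtMost_iff minus_le_iff)
  define K where "K = 1 / norm (?z t1)"
  have K: "K > 0" using z0 by (auto simp: K_def)
  define N where "N = 4 * (norm B)\<^sup>2 + 4 * norm B * ?Cw + norm ?W"
  have N: "N \<ge> 0" using Cw by (simp add: N_def)
  show thesis
  proof (rule that[of "K\<^sup>2 * N + 2 * norm B * DIM('a) * K"])
    show "K\<^sup>2 * N + 2 * norm B * DIM('a) * K \<ge> 0" using K N by simp
    fix t :: real and x :: 'a assume tT: "\<bar>t\<bar> \<le> T"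
    then have "\<bar>t\<bar> \<le> \<bar>T\<bar>" by simp
    from t1[OF this] have zK: "1 / norm (?z t) \<le> K" by (simp add: K_def)
    let ?P = "(1 + norm x)\<^sup>2"
    have P: "1 \<le> ?P" "norm x \<le> ?P" "(norm x)\<^sup>2 \<le> ?P" by (auto simp: power2_sum)
    let ?p = "4 * B\<^sup>2 * of_real ((norm x)\<^sup>2) - 4 * B * cdot w x + ?W"
    have "norm ?p \<le> norm (4 * B\<^sup>2 * complex_of_real ((norm x)\<^sup>2)) + norm (4 * B * cdot w x) + norm ?W"
      by (intro norm_triangle_le add_mono norm_triangle_ineq4) auto
    also have "\<dots> = 4 * (norm B)\<^sup>2 * (norm x)\<^sup>2 + 4 * norm B * norm (cdot w x) + norm ?W"
      by (simp add: norm_mult norm_power)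
    also have "\<dots> \<le> 4 * (norm B)\<^sup>2 * ?P + 4 * norm B * (?Cw * ?P) + norm ?W * ?P"
    proof (intro add_mono mult_left_mono)
      show "norm (cdot w x) \<le> ?Cw * ?P"
        using cdot_bound[of w x] mult_left_mono[OF P(2) Cw] by linarith
      show "norm ?W \<le> norm ?W * ?P" using mult_left_mono[OF P(1), of "norm ?W"] by simp
    qed (use P in auto)
    also have "\<dots> = N * ?P" by (simp add: N_def algebra_simps)
    finally have p: "norm ?p \<le> N * ?P" .
    have "norm (?p / (?z t)\<^sup>2 - 2 * B * of_nat DIM('a) / ?z t)
       \<le> norm (?p / (?z t)\<^sup>2) + norm (2 * B * of_nat DIM('a) / ?z t)" by (rule norm_triangle_ineq4)
    also have "norm (?p / (?z t)\<^sup>2) = (1 / norm (?z t))\<^sup>2 * norm ?p"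
      by (simp add: norm_divide norm_power power_divide)
    also have "\<dots> \<le> K\<^sup>2 * (N * ?P)"
      by (intro mult_mono power_mono zK p) (use K in auto)
    also have "norm (2 * B * of_nat DIM('a) / ?z t) = 2 * norm B * DIM('a) * (1 / norm (?z t))"
      by (simp add: norm_divide norm_mult)
    also have "\<dots> \<le> 2 * norm B * DIM('a) * (K * ?P)"
    proof (intro mult_left_mono)
      show "1 / norm (?z t) \<le> K * ?P" 
      proof -
        have "K * 1 \<le> K * ?P" using P(1) K by (intro mult_left_mono) auto
        then show ?thesis using zK by linarith
      qed
    qed auto
    finally have "norm (?p / (?z t)\<^sup>2 - 2 * B * of_nat DIM('a) / ?z t) \<le> (K\<^sup>2 * N + 2 * norm B * DIM('a) * K) * ?P"
      by (simp add: algebra_simps)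
    then have "norm (gflow B w t x) * norm (?p / (?z t)\<^sup>2 - 2 * B * of_nat DIM('a) / ?z t)
        \<le> norm (gflow B w t x) * ((K\<^sup>2 * N + 2 * norm B * DIM('a) * K) * ?P)"
      by (rule mult_left_mono) simp
    then show "norm (laplacian (gflow B w t) x) \<le> (K\<^sup>2 * N + 2 * norm B * DIM('a) * K) * (?P * norm (gflow B w t x))"
      unfolding laplacian_gflow[OF B] norm_mult by (simp only: mult_ac)
  qed
qed

section \<open>Powers of packet sums and their Gram kernels\<close>

text \<open>
  For packets, \<open>B = 1/2\<close> and \<open>om t\<close> is the reciprocal of \<open>gflow_denom\<close>. As \<open>t\<close> runs through the real line,
  \<open>om t\<close> runs through the circle with diameter \<open>[0, 1]\<close> and \<open>ze t\<close> through the unit circle; moreover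
  \<open>ze = om / cnj om\<close>.
\<close>

definition om :: "real \<Rightarrow> complex" where "om t = 1 / (1 + 2 * \<i> * of_real t)"

definition ze :: "real \<Rightarrow> complex" where "ze t = 2 * om t - 1"

definition packet_flow :: "(complex \<times> 'a::euclidean_space) list \<Rightarrow> real \<Rightarrow> 'a \<Rightarrow> complex" where
  "packet_flow l t x = (\<Sum>(c, \<xi>)\<leftarrow>l. c * gflow (1/2) (\<lambda>b. \<i> * of_real (\<xi> \<bullet> b)) t x)"

lemma om_denom: "1 + 2 * \<i> * of_real t \<noteq> (0 :: complex)"
  by (simp add: complex_eq_iff)

lemma norm_om_square: "(norm (om t))\<^sup>2 = 1 / (1 + 4 * t\<^sup>2)"
proof -
  have "(norm (1 + 2 * \<i> * complex_of_real t))\<^sup>2 = 1 + 4 * t\<^sup>2"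
    by (simp add: cmod_power2 power_mult_distrib)
  then show ?thesis by (simp add: om_def norm_divide power_divide)
qed

lemma om_nonzero: "om t \<noteq> 0"
  using om_denom by (simp add: om_def)

lemma om_plus_cnj: "om t + cnj (om t) = 2 * of_real ((norm (om t))\<^sup>2)"
proof -
  have d: "1 - 2 * \<i> * of_real t \<noteq> (0 :: complex)" by (simp add: complex_eq_iff)
  have "om t + cnj (om t) = 2 * (om t * cnj (om t))"
    using om_denom[of t] d by (simp add: om_def field_simps)
  then show ?thesis by (simp only: complex_norm_square mult.assoc)
qed

lemma ze_eq: "ze t * cnj (om t) = om t" "cnj (ze t) * om t = cnj (om t)"
proof -
  have d: "1 - 2 * \<i> * of_real t \<noteq> (0 :: complex)" by (simp add: complex_eq_iff)
  show "ze t * cnj (om t) = om t"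
    using om_denom[of t] d by (simp add: ze_def om_def field_simps)
  then show "cnj (ze t) * om t = cnj (om t)" by (metis complex_cnj_cnj complex_cnj_mult)
qed

lemma norm_ze: "norm (ze t) = 1"
  using ze_eq(1)[of t] om_nonzero[of t] by (metis complex_mod_cnj mult_cancel_right1 norm_eq_zero norm_mult)

lemma t_om: "\<i> * of_real t * om t = (1 - ze t) / 4"
proof -
  have "om t * (1 + 2 * \<i> * of_real t) = 1" using om_denom[of t] by (simp add: om_def)
  then have "om t = 1 - 2 * (\<i> * of_real t * om t)" by (simp add: algebra_simps eq_diff_eq)
  moreover have "a = (1 - (2 * b - 1)) / 4" if "b = 1 - 2 * a" for a b :: complex
    unfolding that by (simp add: field_simps)
  ultimately show ?thesis unfolding ze_def by blast
qed

lemma gflow_packet: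
  fixes \<xi> :: "'a::euclidean_space"
  shows "gflow (1/2) (\<lambda>b. \<i> * of_real (\<xi> \<bullet> b)) t x = csqrt (om t) ^ DIM('a) *
     exp (om t * (- of_real ((norm x)\<^sup>2) / 2 + \<i> * of_real (\<xi> \<bullet> x) - \<i> * of_real t * of_real ((norm \<xi>)\<^sup>2)))"
proof -
  have z: "gflow_denom (1/2) t = 1 + 2 * \<i> * of_real t" by (simp add: gflow_denom_def)
  have "(\<Sum>b\<in>Basis. (\<i> * complex_of_real (\<xi> \<bullet> b))\<^sup>2) = - of_real ((norm \<xi>)\<^sup>2)"
    by (simp add: power_mult_distrib norm_square_Basis sum_negf)
  then show ?thesis
    unfolding gflow_def z cdot_of_real om_def by (simp add: diff_divide_distrib add_divide_distrib)
qed

lemma gflow_0: "gflow B w 0 x = exp (- B * of_real ((norm x)\<^sup>2) + cdot w x)"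
  by (simp add: gflow_def gflow_denom_def)

lemma packet_flow_0: "packet_flow l 0 x = packet_sum l x"
proof -
  have "gflow (1/2) (\<lambda>b. \<i> * of_real (\<xi> \<bullet> b)) 0 x = packet \<xi> x" for \<xi> :: 'a
    by (simp add: gflow_0 cdot_of_real packet_def)
  then show ?thesis by (simp add: packet_flow_def packet_sum_def)
qed

lemma packet_flow_simps [simp]:
  "packet_flow [] t x = 0"
  "packet_flow (p # l) t x = fst p * gflow (1/2) (\<lambda>b. \<i> * of_real (snd p \<bullet> b)) t x + packet_flow l t x"
  "packet_flow (l @ l') t x = packet_flow l t x + packet_flow l' t x"
  by (simp_all add: packet_flow_def split_def)

lemma packet_flow_cmult: "packet_flow (map (\<lambda>(c, \<xi>). (a * c, \<xi>)) l) t x = a * packet_flow l t x"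
  by (induction l) (auto simp: algebra_simps)

lemma packet_flow_nth:
  fixes l :: "(complex \<times> 'a::euclidean_space) list"
  shows "packet_flow l t x = csqrt (om t) ^ DIM('a) * (\<Sum>j<length l. fst (l ! j) *
     exp (om t * (- of_real ((norm x)\<^sup>2) / 2 + \<i> * of_real (snd (l ! j) \<bullet> x) - \<i> * of_real t * of_real ((norm (snd (l ! j)))\<^sup>2))))"
  unfolding packet_flow_def gflow_packet
  by (simp add: sum_list_sum_nth split_def atLeast0LessThan sum_distrib_left mult_ac)

text \<open>
  A \<open>k\<close>-fold product of packets has exponent \<open>-k\<bar>x\<bar>\<^sup>2/2 + \<i> S \<bullet> x - \<i> t \<sigma>\<close>, where \<open>S\<close> is the sum of the
  frequencies and \<open>\<sigma>\<close> the sum of their squares. Integrating over \<open>x\<close> leaves the part of \<open>\<sigma>\<close> that is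
  not accounted for by \<open>S\<close>, which is where the time dependence sits.
\<close>

lemma packet_product_integral:
  fixes S S' :: "'a::euclidean_space" and k \<sigma> \<sigma>' t :: real
  assumes k: "k > 0"
  defines "E \<equiv> \<lambda>\<sigma> S x. exp (om t * (- of_real (k * (norm x)\<^sup>2 / 2) + \<i> * of_real (S \<bullet> x) - \<i> * of_real t * of_real \<sigma>))"
  defines "e \<equiv> \<lambda>\<sigma> S. exp (- ((1 - ze t) * of_real ((\<sigma> - (norm S)\<^sup>2 / k) / 4)))"
  shows "has_bochner_integral lborel (\<lambda>x. E \<sigma> S x * cnj (E \<sigma>' S' x))
    (of_real (sqrt (pi / (k * (norm (om t))\<^sup>2))) ^ DIM('a) *
      (of_real (exp (- ((norm (S - S'))\<^sup>2 / (4 * k)))) * e \<sigma> S * cnj (e \<sigma>' S')))"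
proof -
  define o1 where "o1 = om t"
  define n where "n = (norm o1)\<^sup>2"
  have n: "n > 0" "of_real n = o1 * cnj o1" "o1 + cnj o1 = 2 * of_real n"
    unfolding n_def o1_def by (simp add: om_nonzero) (rule complex_norm_square, rule om_plus_cnj)
  define w where "w b = \<i> * (o1 * of_real (S \<bullet> b) - cnj o1 * of_real (S' \<bullet> b))" for b
  define D where "D = - \<i> * of_real t * o1 * of_real \<sigma> + \<i> * of_real t * cnj o1 * of_real \<sigma>'"
  have kn: "k * n > 0" using k n by simp
  have EE: "E \<sigma> S x * cnj (E \<sigma>' S' x) = exp D * exp (- of_real (k * n) * of_real ((norm x)\<^sup>2) + cdot w x)" for x
  proof -
    have c: "cdot w x = \<i> * (o1 * of_real (S \<bullet> x) - cnj o1 * of_real (S' \<bullet> x))"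
    proof -
      have "cdot w x = cdot (\<lambda>b. (\<i> * o1) * of_real (S \<bullet> b)) x - cdot (\<lambda>b. (\<i> * cnj o1) * of_real (S' \<bullet> b)) x"
        by (simp add: cdot_def w_def algebra_simps sum_subtractf)
      then show ?thesis unfolding cdot_of_real by (simp add: algebra_simps)
    qed
    have "E \<sigma> S x * cnj (E \<sigma>' S' x) = exp (o1 * (- of_real (k * (norm x)\<^sup>2 / 2) + \<i> * of_real (S \<bullet> x) - \<i> * of_real t * of_real \<sigma>)
       + cnj o1 * (- of_real (k * (norm x)\<^sup>2 / 2) - \<i> * of_real (S' \<bullet> x) + \<i> * of_real t * of_real \<sigma>'))"
      unfolding E_def exp_add o1_def by (simp add: exp_cnj algebra_simps)
    also have "o1 * (- of_real (k * (norm x)\<^sup>2 / 2) + \<i> * of_real (S \<bullet> x) - \<i> * of_real t * of_real \<sigma>)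
       + cnj o1 * (- of_real (k * (norm x)\<^sup>2 / 2) - \<i> * of_real (S' \<bullet> x) + \<i> * of_real t * of_real \<sigma>')
       = - (o1 + cnj o1) * of_real (k * (norm x)\<^sup>2 / 2) + cdot w x + D"
    proof -
      have "o1 * (- X + \<i> * of_real (S \<bullet> x) - \<i> * of_real t * of_real \<sigma>)
          + cnj o1 * (- X - \<i> * of_real (S' \<bullet> x) + \<i> * of_real t * of_real \<sigma>')
         = - (o1 + cnj o1) * X + cdot w x + D" for X
        unfolding c D_def by (simp add: algebra_simps)
      then show ?thesis .
    qed
    also have "\<dots> = D + (- of_real (k * n) * of_real ((norm x)\<^sup>2) + cdot w x)"
      unfolding n(3) by (simp add: algebra_simps)
    finally show ?thesis by (simp only: exp_add)
  qed
  have HB: "has_bochner_integral lborel (\<lambda>x. exp D * exp (- of_real (k * n) * of_real ((norm x)\<^sup>2) + cdot w x))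
     (exp D * (of_real (sqrt (pi / (k * n))) ^ DIM('a) * exp ((\<Sum>b\<in>Basis. (w b)\<^sup>2) / (4 * of_real (k * n)))))"
    by (intro has_bochner_integral_mult_right gaussian_integral kn)
  have EV: "exp D * exp ((\<Sum>b\<in>Basis. (w b)\<^sup>2) / (4 * of_real (k * n)))
      = of_real (exp (- ((norm (S - S'))\<^sup>2 / (4 * k)))) * e \<sigma> S * cnj (e \<sigma>' S')"
  proof -
    let ?s = "of_real ((norm S)\<^sup>2) :: complex" and ?s' = "of_real ((norm S')\<^sup>2) :: complex" and ?i = "of_real (S \<bullet> S') :: complex"
    define zz where "zz = ze t"
    have W: "(\<Sum>b\<in>Basis. (w b)\<^sup>2) = - (o1\<^sup>2 * ?s - 2 * of_real n * ?i + (cnj o1)\<^sup>2 * ?s')"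
    proof -
      have "(w b)\<^sup>2 = - (o1\<^sup>2 * of_real ((S \<bullet> b)\<^sup>2) - 2 * of_real n * of_real ((S \<bullet> b) * (S' \<bullet> b)) + (cnj o1)\<^sup>2 * of_real ((S' \<bullet> b)\<^sup>2))" for b
        unfolding w_def n(2) by (simp add: power2_eq_square algebra_simps)
      then show ?thesis
        by (simp add: norm_square_Basis euclidean_inner[of S S'] sum_negf sum.distrib sum_subtractf sum_distrib_left)
    qed
    have z: "zz * cnj o1 = o1" "cnj zz * o1 = cnj o1" using ze_eq by (auto simp: zz_def o1_def)
    have o: "o1\<^sup>2 = zz * of_real n" "(cnj o1)\<^sup>2 = cnj zz * of_real n"
      using z unfolding n(2) power2_eq_square by (metis mult.assoc mult.commute)+
    have Wk: "(\<Sum>b\<in>Basis. (w b)\<^sup>2) / (4 * of_real (k * n)) = - (zz * ?s - 2 * ?i + cnj zz * ?s') / (4 * of_real k)"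
      unfolding W o using n(1) k by (simp add: field_simps)
    have Deq: "D = - ((1 - zz) * of_real \<sigma> / 4) - (1 - cnj zz) * of_real \<sigma>' / 4"
    proof -
      have A: "\<i> * of_real t * o1 = (1 - zz) / 4" using t_om by (simp add: o1_def zz_def)
      from arg_cong[OF this, of cnj] have A': "\<i> * of_real t * cnj o1 = - (1 - cnj zz) / 4"
        by (simp add: field_simps)
      have "D = - ((\<i> * of_real t * o1) * of_real \<sigma>) + (\<i> * of_real t * cnj o1) * of_real \<sigma>'"
        by (simp add: D_def)
      then show ?thesis unfolding A A' by (simp add: field_simps)
    qed
    have SS: "of_real ((norm (S - S'))\<^sup>2) = ?s - 2 * ?i + ?s'"
    proof -
      have "(norm (S - S'))\<^sup>2 = (norm S)\<^sup>2 - 2 * (S \<bullet> S') + (norm S')\<^sup>2"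
        by (simp add: power2_norm_eq_inner inner_diff_left inner_diff_right inner_commute)
      then show ?thesis by simp
    qed
    have id: "(- ((1 - z) * a / 4) - (1 - z') * a' / 4) + - (z * s - 2 * i + z' * s') / (4 * r)
         = - ((s - 2 * i + s') / (4 * r)) + - ((1 - z) * ((a - s / r) / 4)) + - ((1 - z') * ((a' - s' / r) / 4))"
      if "r \<noteq> 0" for z z' a a' s s' i r :: complex
      using that by (simp add: field_simps)
    have "D + (\<Sum>b\<in>Basis. (w b)\<^sup>2) / (4 * of_real (k * n))
       = of_real (- ((norm (S - S'))\<^sup>2 / (4 * k))) + - ((1 - zz) * of_real ((\<sigma> - (norm S)\<^sup>2 / k) / 4))
         + - ((1 - cnj zz) * of_real ((\<sigma>' - (norm S')\<^sup>2 / k) / 4))"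
      unfolding Wk Deq using id[of "of_real k"] k SS by simp
    then have "exp (D + (\<Sum>b\<in>Basis. (w b)\<^sup>2) / (4 * of_real (k * n)))
      = exp (of_real (- ((norm (S - S'))\<^sup>2 / (4 * k)))) * exp (- ((1 - zz) * of_real ((\<sigma> - (norm S)\<^sup>2 / k) / 4)))
         * exp (- ((1 - cnj zz) * of_real ((\<sigma>' - (norm S')\<^sup>2 / k) / 4)))"
      by (simp only: exp_add)
    then show ?thesis unfolding e_def exp_of_real zz_def by (simp add: exp_add exp_cnj)
  qed
  show ?thesis
    using HB[folded EE, unfolded mult.left_commute[of "exp D"] EV] unfolding n_def o1_def .
qed

lemma has_bochner_integral_of_real_imp:
  assumes "has_bochner_integral M (\<lambda>x. complex_of_real (f x)) c"
  shows "has_bochner_integral M f (Re c)" "c = of_real (Re c)"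
proof -
  have "integrable M f" using assms by (simp add: has_bochner_integral_iff complex_of_real_integrable_eq)
  moreover have "c = of_real (integral\<^sup>L M f)" using assms by (simp add: has_bochner_integral_iff integral_complex_of_real)
  ultimately show "has_bochner_integral M f (Re c)" "c = of_real (Re c)"
    by (simp_all add: has_bochner_integral_iff)
qed

lemma norm_sum_square: "complex_of_real ((norm (\<Sum>j\<in>J. a j))\<^sup>2) = (\<Sum>j\<in>J. \<Sum>k\<in>J. a j * cnj (a k))"
  unfolding complex_norm_square cnj_sum sum_product ..

definition gram_form :: "'j set \<Rightarrow> ('j \<Rightarrow> complex) \<Rightarrow> ('j \<Rightarrow> 'j \<Rightarrow> complex) \<Rightarrow> complex" where
  "gram_form J C K = (\<Sum>j\<in>J. \<Sum>k\<in>J. C j * cnj (C k) * K j k)"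

text \<open>
  Here \<open>\<beta>\<close> is the part of \<open>\<sigma>\<close> that \<open>S\<close> does not account for; with \<open>k = 1\<close> it vanishes, which gives the
  conservation of the \<open>L\<^sup>2\<close> norm.
\<close>

lemma packet_power_integral:
  fixes S :: "'j \<Rightarrow> 'a::euclidean_space" and J :: "'j set" and C :: "'j \<Rightarrow> complex" and k t :: real and \<sigma> \<beta> :: "'j \<Rightarrow> real"
  assumes k: "k > 0" and J: "finite J"
    and \<beta>: "\<And>j. j \<in> J \<Longrightarrow> \<sigma> j = (norm (S j))\<^sup>2 / k + \<beta> j"
  defines "U \<equiv> \<lambda>x. \<Sum>j\<in>J. C j * exp (om t * (- of_real (k * (norm x)\<^sup>2 / 2) + \<i> * of_real (S j \<bullet> x) - \<i> * of_real t * of_real (\<sigma> j)))"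
  defines "H \<equiv> gram_form J C (\<lambda>i j. of_real (exp (- ((norm (S i - S j))\<^sup>2 / (4 * k))))
     * exp (- ((1 - ze t) * of_real (\<beta> i / 4))) * cnj (exp (- ((1 - ze t) * of_real (\<beta> j / 4)))))"
  shows "has_bochner_integral lborel (\<lambda>x. (norm (U x))\<^sup>2) (sqrt (pi / (k * (norm (om t))\<^sup>2)) ^ DIM('a) * Re H)"
    and "H = of_real (Re H)"
proof -
  let ?c = "sqrt (pi / (k * (norm (om t))\<^sup>2)) ^ DIM('a)"
  \<comment> \<open>The integral is real, so the Hermitian form is real too.\<close>
  have c: "?c > 0" using k om_nonzero[of t] by simp
  have "has_bochner_integral lborel
    (\<lambda>x. \<Sum>i\<in>J. \<Sum>j\<in>J. C i * cnj (C j) *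
      (exp (om t * (- of_real (k * (norm x)\<^sup>2 / 2) + \<i> * of_real (S i \<bullet> x) - \<i> * of_real t * of_real (\<sigma> i))) *
       cnj (exp (om t * (- of_real (k * (norm x)\<^sup>2 / 2) + \<i> * of_real (S j \<bullet> x) - \<i> * of_real t * of_real (\<sigma> j))))))
    (\<Sum>i\<in>J. \<Sum>j\<in>J. C i * cnj (C j) * (of_real (sqrt (pi / (k * (norm (om t))\<^sup>2))) ^ DIM('a) *
      (of_real (exp (- ((norm (S i - S j))\<^sup>2 / (4 * k)))) * exp (- ((1 - ze t) * of_real ((\<sigma> i - (norm (S i))\<^sup>2 / k) / 4)))
        * cnj (exp (- ((1 - ze t) * of_real ((\<sigma> j - (norm (S j))\<^sup>2 / k) / 4)))))))"
    by (intro has_bochner_integral_sum has_bochner_integral_mult_right packet_product_integral k)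
  also have "(\<lambda>x. \<Sum>i\<in>J. \<Sum>j\<in>J. C i * cnj (C j) *
      (exp (om t * (- of_real (k * (norm x)\<^sup>2 / 2) + \<i> * of_real (S i \<bullet> x) - \<i> * of_real t * of_real (\<sigma> i))) *
       cnj (exp (om t * (- of_real (k * (norm x)\<^sup>2 / 2) + \<i> * of_real (S j \<bullet> x) - \<i> * of_real t * of_real (\<sigma> j))))))
     = (\<lambda>x. of_real ((norm (U x))\<^sup>2))"
    unfolding norm_sum_square U_def by (intro ext sum.cong refl) (simp only: complex_cnj_mult mult_ac)
  also have "(\<Sum>i\<in>J. \<Sum>j\<in>J. C i * cnj (C j) * (of_real (sqrt (pi / (k * (norm (om t))\<^sup>2))) ^ DIM('a) *
      (of_real (exp (- ((norm (S i - S j))\<^sup>2 / (4 * k)))) * exp (- ((1 - ze t) * of_real ((\<sigma> i - (norm (S i))\<^sup>2 / k) / 4)))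
        * cnj (exp (- ((1 - ze t) * of_real ((\<sigma> j - (norm (S j))\<^sup>2 / k) / 4))))))) = of_real ?c * H"
    unfolding H_def gram_form_def sum_distrib_left
    by (intro sum.cong refl) (simp add: \<beta> mult_ac)
  finally have *: "has_bochner_integral lborel (\<lambda>x. complex_of_real ((norm (U x))\<^sup>2)) (of_real ?c * H)" .
  note ** = has_bochner_integral_of_real_imp[OF *]
  show "has_bochner_integral lborel (\<lambda>x. (norm (U x))\<^sup>2) (?c * Re H)"
    using **(1) by (simp del: of_real_power)
  have "Im (of_real ?c * H) = 0" using **(2) by (metis Im_complex_of_real)
  then have "?c * Im H = 0" by (simp only: times_complex.sel Im_complex_of_real Re_complex_of_real mult_zero_left add_0_right)
  then have "Im H = 0" using c by (metis less_irrefl mult_eq_0_iff)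
  then show "H = of_real (Re H)" by (simp add: complex_eq_iff)
qed

lemma packet_flow_norm:
  fixes l :: "(complex \<times> 'a::euclidean_space) list"
  shows "packet_flow l t \<in> L2"
    and "(l2norm (packet_flow l t))\<^sup>2 = sqrt pi ^ DIM('a) *
      Re (gram_form {..<length l} (\<lambda>j. fst (l ! j)) (\<lambda>i j. of_real (exp (- ((norm (snd (l ! i) - snd (l ! j)))\<^sup>2 / 4)))))"
    (is "_ = _ * Re ?G")
proof -
  let ?n = "(norm (om t))\<^sup>2"
  have n: "?n > 0" using om_nonzero[of t] by simp
  let ?U = "\<lambda>x::'a. \<Sum>j<length l. fst (l ! j) * exp (om t * (- of_real (1 * (norm x)\<^sup>2 / 2) + \<i> * of_real (snd (l ! j) \<bullet> x)
     - \<i> * of_real t * of_real ((norm (snd (l ! j)))\<^sup>2)))"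
  have U: "packet_flow l t x = csqrt (om t) ^ DIM('a) * ?U x" for x
    by (simp add: packet_flow_nth)
  have "has_bochner_integral lborel (\<lambda>x. (norm (?U x))\<^sup>2) (sqrt (pi / (1 * ?n)) ^ DIM('a) * Re ?G)"
    using packet_power_integral(1)[where k = 1 and J = "{..<length l}" and \<beta> = "\<lambda>_. 0"
        and \<sigma> = "\<lambda>j. (norm (snd (l ! j)))\<^sup>2" and S = "\<lambda>j. snd (l ! j)" and C = "\<lambda>j. fst (l ! j)" and t = t]
    by simp
  then have "has_bochner_integral lborel (\<lambda>x. (norm (om t)) ^ DIM('a) * (norm (?U x))\<^sup>2)
      ((norm (om t)) ^ DIM('a) * (sqrt (pi / ?n) ^ DIM('a) * Re ?G))"
    by (intro has_bochner_integral_mult_right) simp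
  moreover have "(norm (om t)) ^ DIM('a) * (norm (?U x))\<^sup>2 = (norm (packet_flow l t x))\<^sup>2" for x
  proof -
    have "(norm (csqrt (om t) ^ DIM('a)))\<^sup>2 = (norm (om t)) ^ DIM('a)"
      unfolding norm_power norm_csqrt power_mult[symmetric] mult.commute[of "DIM('a)" 2] by (simp add: power_mult)
    then show ?thesis unfolding U norm_mult power_mult_distrib by simp
  qed
  moreover have "(norm (om t)) ^ DIM('a) * (sqrt (pi / ?n) ^ DIM('a) * Re ?G) = sqrt pi ^ DIM('a) * Re ?G"
    using om_nonzero[of t] by (simp add: real_sqrt_divide power_divide)
  ultimately have *: "has_bochner_integral lborel (\<lambda>x. (norm (packet_flow l t x))\<^sup>2) (sqrt pi ^ DIM('a) * Re ?G)"
    by simp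
  have "continuous_on UNIV (packet_flow l t)"
  proof (induction l)
    case Nil
    have "packet_flow [] t = (\<lambda>x::'a. 0)" by (rule ext) simp
    then show ?case by simp
  next
    case (Cons p l)
    have "packet_flow (p # l) t = (\<lambda>x. fst p * gflow (1/2) (\<lambda>b. \<i> * of_real (snd p \<bullet> b)) t x + packet_flow l t x)"
      by (rule ext) simp
    then show ?case using Cons by (simp add: continuous_intros)
  qed
  then have "packet_flow l t \<in> borel_measurable lborel" by (simp add: borel_measurable_continuous_onI)
  then show "packet_flow l t \<in> L2" using * by (auto simp: L2_iff has_bochner_integral_iff)
  show "(l2norm (packet_flow l t))\<^sup>2 = sqrt pi ^ DIM('a) * Re ?G"
    using * by (simp add: l2norm_square has_bochner_integral_iff)
qed

corollary packet_flow_isometry: "l2norm (packet_flow l t) = l2norm (packet_sum l)"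
proof -
  have "(l2norm (packet_flow l t))\<^sup>2 = (l2norm (packet_flow l 0))\<^sup>2"
    unfolding packet_flow_norm(2) ..
  then show ?thesis by (simp add: packet_flow_0[abs_def])
qed

section \<open>Limits in \<open>L\<^sup>2\<close> and of derivatives\<close>

text \<open>
  The Hilbert space pairing is jointly continuous.
\<close>

lemma L2_pairing_tendsto:
  fixes f g :: "'i \<Rightarrow> 'a::euclidean_space \<Rightarrow> complex"
  assumes f: "\<And>i. f i \<in> L2" "f0 \<in> L2" "((\<lambda>i. l2norm (\<lambda>x. f i x - f0 x)) \<longlongrightarrow> 0) F"
    and g: "\<And>i. g i \<in> L2" "g0 \<in> L2" "((\<lambda>i. l2norm (\<lambda>x. g i x - g0 x)) \<longlongrightarrow> 0) F"
  shows "((\<lambda>i. LINT x|lborel. f i x * g i x) \<longlongrightarrow> (LINT x|lborel. f0 x * g0 x)) F"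
proof -
  have "((\<lambda>i. l2norm (\<lambda>x. f i x - f0 x) * (l2norm g0 + l2norm (\<lambda>x. g i x - g0 x))
      + l2norm f0 * l2norm (\<lambda>x. g i x - g0 x)) \<longlongrightarrow> 0 * (l2norm g0 + 0) + l2norm f0 * 0) F"
    by (intro tendsto_intros f g)
  then have lim: "((\<lambda>i. l2norm (\<lambda>x. f i x - f0 x) * (l2norm g0 + l2norm (\<lambda>x. g i x - g0 x))
      + l2norm f0 * l2norm (\<lambda>x. g i x - g0 x)) \<longlongrightarrow> 0) F" by simp
  have "norm ((LINT x|lborel. f i x * g i x) - (LINT x|lborel. f0 x * g0 x))
     \<le> l2norm (\<lambda>x. f i x - f0 x) * (l2norm g0 + l2norm (\<lambda>x. g i x - g0 x)) + l2norm f0 * l2norm (\<lambda>x. g i x - g0 x)" for i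
  proof -
    have "(LINT x|lborel. f i x * g i x) - (LINT x|lborel. f0 x * g0 x)
       = (LINT x|lborel. (f i x - f0 x) * g i x) + (LINT x|lborel. f0 x * (g i x - g0 x))"
      using f(1)[of i] f(2) g(1)[of i] g(2) by (simp add: L2_mult_integrable algebra_simps)
    also have "norm \<dots> \<le> l2norm (\<lambda>x. f i x - f0 x) * l2norm (g i) + l2norm f0 * l2norm (\<lambda>x. g i x - g0 x)"
      by (intro norm_triangle_mono L2_Cauchy_Schwarz L2_diff f g)
    also have "\<dots> \<le> l2norm (\<lambda>x. f i x - f0 x) * (l2norm g0 + l2norm (\<lambda>x. g i x - g0 x)) + l2norm f0 * l2norm (\<lambda>x. g i x - g0 x)"
      by (intro add_mono mult_left_mono l2norm_le_add_diff f g) auto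
    finally show ?thesis .
  qed
  then have "((\<lambda>i. (LINT x|lborel. f i x * g i x) - (LINT x|lborel. f0 x * g0 x)) \<longlongrightarrow> 0) F"
    by (intro Lim_null_comparison[OF _ lim] always_eventually) auto
  then show ?thesis by (simp add: LIM_zero_iff)
qed

lemma L2_Fatou:
  fixes f :: "nat \<Rightarrow> 'a::euclidean_space \<Rightarrow> complex"
  assumes f: "\<And>n. f n \<in> L2" "\<And>n. l2norm (f n) \<le> C" and g: "g \<in> borel_measurable lborel"
    and lim: "AE x in lborel. (\<lambda>n. f n x) \<longlonglongrightarrow> g x"
  shows "g \<in> L2" "l2norm g \<le> C"
proof -
  note [measurable] = L2_measurable[OF f(1)] g
  have C: "0 \<le> C" using order_trans[OF l2norm_nonneg f(2)] .
  have "(\<integral>\<^sup>+x. ennreal ((norm (g x))\<^sup>2) \<partial>lborel) = (\<integral>\<^sup>+x. liminf (\<lambda>n. ennreal ((norm (f n x))\<^sup>2)) \<partial>lborel)"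
    by (rule nn_integral_cong_AE, use lim in eventually_elim)
       (intro lim_imp_Liminf[symmetric] tendsto_intros tendsto_ennrealI, auto)
  also have "\<dots> \<le> liminf (\<lambda>n. \<integral>\<^sup>+x. ennreal ((norm (f n x))\<^sup>2) \<partial>lborel)"
    by (rule nn_integral_liminf) measurable
  also have "\<dots> \<le> ennreal (C\<^sup>2)"
    unfolding nn_integral_L2[OF f(1)]
    by (intro Liminf_le always_eventually) (auto intro!: ennreal_leI power_mono f)
  finally have *: "(\<integral>\<^sup>+x. ennreal ((norm (g x))\<^sup>2) \<partial>lborel) \<le> ennreal (C\<^sup>2)" .
  then have "(\<integral>\<^sup>+x. ennreal ((norm (g x))\<^sup>2) \<partial>lborel) < \<infinity>" by (rule order_le_less_trans) simp
  then show L2: "g \<in> L2" by (simp add: L2_iff integrable_iff_bounded)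
  from * have "(l2norm g)\<^sup>2 \<le> C\<^sup>2" by (simp add: nn_integral_L2[OF L2])
  then show "l2norm g \<le> C" using C by (rule power2_le_imp_le)
qed

text \<open>
  If the \<open>L\<^sup>2\<close> norms decay like \<open>4\<^sup>-\<^sup>n\<close>, the weighted sum \<open>\<Sum> 4\<^sup>n \<bar>g\<^sub>n\<bar>\<^sup>2\<close> is still integrable, so almost
  everywhere \<open>g\<^sub>n = O(2\<^sup>-\<^sup>n)\<close>.
\<close>

lemma fast_decay_AE_summable:
  fixes g :: "nat \<Rightarrow> 'a::euclidean_space \<Rightarrow> complex"
  assumes g: "\<And>n. g n \<in> L2" "\<And>n. l2norm (g n) \<le> A * (1/4) ^ n"
  shows "AE x in lborel. summable (\<lambda>n. norm (g n x))"
proof -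
  note [measurable] = L2_measurable[OF g(1)]
  have int: "(\<integral>\<^sup>+x. ennreal (4 ^ n * (norm (g n x))\<^sup>2) \<partial>lborel) \<le> ennreal (A\<^sup>2 * (1/4) ^ n)" for n
  proof -
    have "(\<integral>\<^sup>+x. ennreal (4 ^ n * (norm (g n x))\<^sup>2) \<partial>lborel) = ennreal (4 ^ n) * (\<integral>\<^sup>+x. ennreal ((norm (g n x))\<^sup>2) \<partial>lborel)"
      by (subst nn_integral_cmult[symmetric]) (auto simp: ennreal_mult)
    also have "\<dots> = ennreal (4 ^ n * (l2norm (g n))\<^sup>2)"
      by (simp add: nn_integral_L2[OF g(1)] ennreal_mult)
    also have "\<dots> \<le> ennreal (4 ^ n * (A * (1/4) ^ n)\<^sup>2)"
      by (intro ennreal_leI mult_left_mono power_mono g) auto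
    also have "4 ^ n * (A * (1/4) ^ n)\<^sup>2 = A\<^sup>2 * (1/4) ^ n"
    proof -
      have "4 ^ n * ((1/4) ^ n * (1/4::real) ^ n) = (1/4) ^ n" by (simp add: power_one_over)
      then show ?thesis by (simp add: power_mult_distrib power2_eq_square mult_ac)
    qed
    finally show ?thesis .
  qed
  have "(\<integral>\<^sup>+x. (\<Sum>n. ennreal (4 ^ n * (norm (g n x))\<^sup>2)) \<partial>lborel) = (\<Sum>n. \<integral>\<^sup>+x. ennreal (4 ^ n * (norm (g n x))\<^sup>2) \<partial>lborel)"
    by (rule nn_integral_suminf) measurable
  also have "\<dots> \<le> (\<Sum>n. ennreal (A\<^sup>2 * (1/4) ^ n))"
    by (intro suminf_le int) auto
  also have "\<dots> = ennreal (\<Sum>n. A\<^sup>2 * (1/4) ^ n)"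
    by (intro suminf_ennreal2 summable_mult summable_geometric) auto
  also have "\<dots> < \<infinity>" by (simp only: infinity_ennreal_def ennreal_less_top)
  finally have fin: "(\<integral>\<^sup>+x. (\<Sum>n. ennreal (4 ^ n * (norm (g n x))\<^sup>2)) \<partial>lborel) < \<infinity>" .
  have "(\<lambda>x. \<Sum>n. ennreal (4 ^ n * (norm (g n x))\<^sup>2)) \<in> borel_measurable lborel" by measurable
  then have "AE x in lborel. (\<Sum>n. ennreal (4 ^ n * (norm (g n x))\<^sup>2)) \<noteq> \<infinity>"
    by (rule nn_integral_noteq_infinite[OF _ less_imp_neq[OF fin]])
  then show ?thesis
  proof eventually_elim
    case (elim x)
    have s: "summable (\<lambda>n. 4 ^ n * (norm (g n x))\<^sup>2)"
      by (rule summable_suminf_not_top) (use elim in auto)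
    then have "Bseq (\<lambda>n. 4 ^ n * (norm (g n x))\<^sup>2)"
      by (intro convergent_imp_Bseq convergentI[OF summable_LIMSEQ_zero])
    then obtain K where K: "K > 0" "\<And>n. \<bar>4 ^ n * (norm (g n x))\<^sup>2\<bar> \<le> K" by (auto simp: Bseq_def)
    show ?case
    proof (rule summable_comparison_test'[of "\<lambda>n. sqrt K * (1/2) ^ n" 0])
      show "summable (\<lambda>n. sqrt K * (1/2) ^ n)" by (intro summable_mult summable_geometric) auto
      fix n
      have four: "(4::real) ^ n = (2 ^ n)\<^sup>2"
        using power_mult[of "2::real" 2 n] power_mult[of "2::real" n 2] by (simp add: mult.commute)
      have "(2 ^ n * norm (g n x))\<^sup>2 \<le> K" using K(2)[of n] unfolding four by (simp add: power_mult_distrib)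
      then have "2 ^ n * norm (g n x) \<le> sqrt K" by (rule real_le_rsqrt)
      then have "norm (g n x) \<le> sqrt K / 2 ^ n" by (simp add: pos_le_divide_eq mult.commute)
      then show "norm (norm (g n x)) \<le> sqrt K * (1/2) ^ n" by (simp add: power_one_over)
    qed
  qed
qed

text \<open>
  Used twice to pass to the limit in the weak equation: once in the solution, once in the test function.
\<close>

lemma has_vector_derivative_uniform_limit:
  fixes F :: "nat \<Rightarrow> real \<Rightarrow> complex"
  assumes D: "\<And>n s. (F n has_vector_derivative F' n s) (at s)"
    and lim: "\<And>s. (\<lambda>n. F n s) \<longlonglongrightarrow> G s"
    and d: "d > 0"
    and unif: "\<And>e. e > 0 \<Longrightarrow> \<forall>\<^sub>F n in sequentially. \<forall>s\<in>ball t d. norm (F' n s - G' s) \<le> e"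
  shows "(G has_vector_derivative G' t) (at t)"
proof -
  have "\<exists>g. \<forall>s\<in>ball t d. (\<lambda>n. F n s) \<longlonglongrightarrow> g s \<and> (g has_derivative (\<lambda>h. h *\<^sub>R G' s)) (at s within ball t d)"
  proof (rule has_derivative_sequence[where l = "G t" and f' = "\<lambda>n s h. h *\<^sub>R F' n s" and ?x0.0 = t])
    show "(F n has_derivative (\<lambda>h. h *\<^sub>R F' n s)) (at s within ball t d)" for n s
      using D[of n s] unfolding has_vector_derivative_def by (rule has_derivative_at_withinI)
    show "(\<lambda>n. F n t) \<longlonglongrightarrow> G t" by (rule lim)
    show "t \<in> ball t d" using d by simp
    fix e :: real assume "e > 0"
    from unif[OF this] show "\<forall>\<^sub>F n in sequentially. \<forall>s\<in>ball t d. \<forall>h. norm (h *\<^sub>R F' n s - h *\<^sub>R G' s) \<le> e * norm h"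
    proof eventually_elim
      case (elim n)
      show ?case
      proof (intro ballI allI)
        fix s h assume "s \<in> ball t d"
        with elim have "norm (F' n s - G' s) \<le> e" by blast
        then have "\<bar>h\<bar> * norm (F' n s - G' s) \<le> \<bar>h\<bar> * e" by (intro mult_left_mono) auto
        then show "norm (h *\<^sub>R F' n s - h *\<^sub>R G' s) \<le> e * norm h"
          unfolding scaleR_diff_right[symmetric] norm_scaleR real_norm_def by (simp only: mult.commute)
      qed
    qed
  qed (rule convex_ball)
  then obtain g where g: "\<forall>s\<in>ball t d. (\<lambda>n. F n s) \<longlonglongrightarrow> g s \<and> (g has_derivative (\<lambda>h. h *\<^sub>R G' s)) (at s within ball t d)" ..
  have t: "t \<in> ball t d" using d by simp
  have eq: "g s = G s" if "s \<in> ball t d" for s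
    using g[THEN bspec, OF that, THEN conjunct1] lim by (rule LIMSEQ_unique)
  have "(g has_derivative (\<lambda>h. h *\<^sub>R G' t)) (at t)"
    using g[THEN bspec, OF t, THEN conjunct2] by (simp only: at_within_open[OF t open_ball])
  from has_derivative_transform_within_open[OF this open_ball t eq]
  show ?thesis unfolding has_vector_derivative_def .
qed

section \<open>Gaussians and packet sums solve the Schroedinger equation\<close>

lemma gaussian_dominated_L2:
  fixes f :: "'a::euclidean_space \<Rightarrow> complex"
  assumes "c > 0" "f \<in> borel_measurable lborel" "\<And>x. norm (f x) \<le> M * exp (- c * (norm x)\<^sup>2)"
  shows "f \<in> L2"
  by (rule L2_dominated[OF gaussian_weight_L2[OF assms(1)], of _ M]) (use assms in auto)

lemma gflow_L2:
  assumes "Re B > 0"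
  shows "gflow B w t \<in> L2" "laplacian (gflow B w t) \<in> L2"
proof -
  obtain M c where M: "c > 0" "M \<ge> 0"
    "\<And>x. (1 + norm x)\<^sup>2 * norm (gflow B w t x) \<le> M * exp (- c * (norm x)\<^sup>2)"
    using gflow_bound[OF assms, of "\<bar>t\<bar>" w] by (metis order_refl)
  obtain N where N: "N \<ge> 0" "\<And>x. norm (laplacian (gflow B w t) x) \<le> N * ((1 + norm x)\<^sup>2 * norm (gflow B w t x))"
    using laplacian_gflow_bound[OF assms, of "\<bar>t\<bar>" w] by (metis order_refl)
  have m: "gflow B w t \<in> borel_measurable lborel"
    using continuous_gflow[of UNIV B w t] by (simp add: borel_measurable_continuous_onI)
  show "gflow B w t \<in> L2"
  proof (rule gaussian_dominated_L2[OF M(1) m, of M])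
    fix x
    have "1 * norm (gflow B w t x) \<le> (1 + norm x)\<^sup>2 * norm (gflow B w t x)"
      by (intro mult_right_mono one_le_power) auto
    then show "norm (gflow B w t x) \<le> M * exp (- c * (norm x)\<^sup>2)" using M(3)[of x] by linarith
  qed
  have "laplacian (gflow B w t) = (\<lambda>x. \<Sum>b\<in>Basis. gflow2 B w t b b x)"
    by (rule ext) (rule C2_laplacian[OF C2_gflow])
  then have "continuous_on UNIV (laplacian (gflow B w t))"
    using C2_cont2[OF C2_gflow, of _ _ B w t] by (auto intro!: continuous_on_sum)
  then have m': "laplacian (gflow B w t) \<in> borel_measurable lborel" by (simp add: borel_measurable_continuous_onI)
  show "laplacian (gflow B w t) \<in> L2"
  proof (rule gaussian_dominated_L2[OF M(1) m', of "N * M"])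
    fix x
    have "norm (laplacian (gflow B w t) x) \<le> N * ((1 + norm x)\<^sup>2 * norm (gflow B w t x))" by (rule N)
    also have "\<dots> \<le> N * (M * exp (- c * (norm x)\<^sup>2))" by (intro mult_left_mono M N)
    finally show "norm (laplacian (gflow B w t) x) \<le> N * M * exp (- c * (norm x)\<^sup>2)" by (simp only: mult.assoc)
  qed
qed

text \<open>
  The difference quotients converge pointwise, and the mean value inequality dominates them by a fixed
  Gaussian.
\<close>

lemma gflow_L2_derivative:
  fixes w :: "'a::euclidean_space \<Rightarrow> complex"
  assumes B: "Re B > 0"
  shows "((\<lambda>h. l2norm (\<lambda>x. (gflow B w (t + h) x - gflow B w t x) / of_real h - \<i> * laplacian (gflow B w t) x)) \<longlongrightarrow> 0) (at 0)"
  unfolding tendsto_at_iff_sequentially o_def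
proof (intro allI impI)
  fix X :: "nat \<Rightarrow> real" assume X: "\<forall>i. X i \<in> UNIV - {0}" "X \<longlonglongrightarrow> 0"
  obtain c M where M: "c > 0" "M \<ge> 0"
    "\<And>s x. \<bar>s\<bar> \<le> \<bar>t\<bar> + 1 \<Longrightarrow> (1 + norm x)\<^sup>2 * norm (gflow B w s x) \<le> M * exp (- c * (norm x)\<^sup>2)"
    by (rule gflow_bound[OF B, of "\<bar>t\<bar> + 1" w], rule that)
  obtain N where N: "N \<ge> 0"
    "\<And>s x. \<bar>s\<bar> \<le> \<bar>t\<bar> + 1 \<Longrightarrow> norm (laplacian (gflow B w s) x) \<le> N * ((1 + norm x)\<^sup>2 * norm (gflow B w s x))"
    by (rule laplacian_gflow_bound[OF B, of "\<bar>t\<bar> + 1" w], rule that)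
  have lap: "norm (laplacian (gflow B w s) x) \<le> N * M * exp (- c * (norm x)\<^sup>2)" if "\<bar>s\<bar> \<le> \<bar>t\<bar> + 1" for s x
    using order_trans[OF N(2)[OF that] mult_left_mono[OF M(3)[OF that] N(1)]] by (simp only: mult.assoc)
  from X(2) have "\<forall>\<^sub>F i in sequentially. \<bar>X i\<bar> < 1"
    using order_tendstoD(2)[OF tendsto_rabs[OF X(2)], of 1] by simp
  then obtain i0 where "\<forall>i\<ge>i0. \<bar>X i\<bar> < 1" unfolding eventually_sequentially ..
  then have i0: "\<bar>X (i + i0)\<bar> \<le> 1" for i by (simp add: less_imp_le)
  let ?Y = "\<lambda>i. X (i + i0)"
  have Y0: "?Y i \<noteq> 0" for i using X(1) by simp
  have Y: "?Y \<longlonglongrightarrow> 0" using X(2) by (rule LIMSEQ_ignore_initial_segment)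
  have "(\<lambda>i. l2norm (\<lambda>x. (gflow B w (t + ?Y i) x - gflow B w t x) / of_real (?Y i) - \<i> * laplacian (gflow B w t) x)) \<longlonglongrightarrow> 0"
  proof (rule l2norm_dominated_convergence)
    show "(\<lambda>x. of_real (N * M) * of_real (exp (- c * (norm x)\<^sup>2))) \<in> L2"
      by (intro L2_cmult gaussian_weight_L2 M)
    show "(\<lambda>x. \<i> * laplacian (gflow B w t) x) \<in> L2" by (intro L2_cmult gflow_L2 B)
    show "(\<lambda>x. (gflow B w (t + ?Y i) x - gflow B w t x) / of_real (?Y i)) \<in> borel_measurable lborel" for i
    proof -
      have [measurable]: "gflow B w s \<in> borel_measurable borel" for s
        using L2_measurable[OF gflow_L2(1)[OF B]] by simp
      show ?thesis by measurable
    qed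
    show "norm ((gflow B w (t + ?Y i) x - gflow B w t x) / of_real (?Y i)) \<le> norm (of_real (N * M) * complex_of_real (exp (- c * (norm x)\<^sup>2)))" for i x
    proof -
      have "norm (gflow B w (t + ?Y i) x - gflow B w t x) \<le> N * M * exp (- c * (norm x)\<^sup>2) * \<bar>t + ?Y i - t\<bar>"
      proof (rule vector_mean_value_bound[where f = "\<lambda>s. gflow B w s x"])
        fix s assume "s \<in> closed_segment t (t + ?Y i)"
        then have "\<bar>s\<bar> \<le> \<bar>t\<bar> + 1" using i0[of i] by (auto simp: closed_segment_eq_real_ivl split: if_splits)
        from lap[OF this] show "norm (\<i> * laplacian (gflow B w s) x) \<le> N * M * exp (- c * (norm x)\<^sup>2)"
          by (simp add: norm_mult)
      qed (rule gflow_time_derivative[OF B])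
      then have "norm (gflow B w (t + ?Y i) x - gflow B w t x) / \<bar>?Y i\<bar> \<le> N * M * exp (- c * (norm x)\<^sup>2)"
        using Y0[of i] by (simp add: pos_divide_le_eq)
      moreover have "norm (of_real (N * M) * complex_of_real (exp (- c * (norm x)\<^sup>2))) = N * M * exp (- c * (norm x)\<^sup>2)"
        unfolding norm_mult norm_of_real using M(2) N(1) by simp
      ultimately show ?thesis by (simp only: norm_divide norm_of_real)
    qed
    show "AE x in lborel. (\<lambda>i. (gflow B w (t + ?Y i) x - gflow B w t x) / of_real (?Y i)) \<longlonglongrightarrow> \<i> * laplacian (gflow B w t) x"
    proof (rule AE_I2)
      fix x
      have "((\<lambda>h. (gflow B w (t + h) x - gflow B w t x) / of_real h) \<longlongrightarrow> \<i> * laplacian (gflow B w t) x) (at 0)"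
        using gflow_time_derivative[OF B, of w x t]
        by (simp add: has_vector_derivative_iff_quotient scaleR_conv_of_real divide_inverse mult.commute)
      then show "(\<lambda>i. (gflow B w (t + ?Y i) x - gflow B w t x) / of_real (?Y i)) \<longlonglongrightarrow> \<i> * laplacian (gflow B w t) x"
        by (rule filterlim_compose) (use Y Y0 in \<open>auto simp: filterlim_at\<close>)
    qed
  qed
  then show "(\<lambda>i. l2norm (\<lambda>x. (gflow B w (t + X i) x - gflow B w t x) / of_real (X i) - \<i> * laplacian (gflow B w t) x)) \<longlonglongrightarrow> 0"
    by (rule LIMSEQ_offset[of _ i0])
qed

lemma L2_differentiable_imp_continuous:
  fixes G :: "real \<Rightarrow> 'a::euclidean_space \<Rightarrow> complex"
  assumes G: "\<And>s. G s \<in> L2" and D: "D \<in> L2"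
    and lim: "((\<lambda>h. l2norm (\<lambda>x. (G (t + h) x - G t x) / of_real h - D x)) \<longlongrightarrow> 0) (at 0)"
  shows "((\<lambda>s. l2norm (\<lambda>x. G s x - G t x)) \<longlongrightarrow> 0) (at t)"
proof -
  have "((\<lambda>h. \<bar>h\<bar> * (l2norm (\<lambda>x. (G (t + h) x - G t x) / of_real h - D x) + l2norm D)) \<longlongrightarrow> \<bar>0\<bar> * (0 + l2norm D)) (at 0)"
    by (intro tendsto_intros lim)
  then have lim0: "((\<lambda>h. \<bar>h\<bar> * (l2norm (\<lambda>x. (G (t + h) x - G t x) / of_real h - D x) + l2norm D)) \<longlongrightarrow> 0) (at 0)" by simp
  have "((\<lambda>h. l2norm (\<lambda>x. G (t + h) x - G t x)) \<longlongrightarrow> 0) (at 0)"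
  proof (rule Lim_null_comparison[OF _ lim0])
    show "\<forall>\<^sub>F h in at 0. norm (l2norm (\<lambda>x. G (t + h) x - G t x))
        \<le> \<bar>h\<bar> * (l2norm (\<lambda>x. (G (t + h) x - G t x) / of_real h - D x) + l2norm D)"
      unfolding eventually_at_filter
    proof (rule always_eventually, intro allI impI)
      fix h :: real assume h: "h \<noteq> 0"
      have Q: "(\<lambda>x. (G (t + h) x - G t x) / of_real h) \<in> L2"
        using L2_cmult[OF L2_diff[OF G[of "t + h"] G[of t]], of "inverse (of_real h)"] by (simp add: divide_inverse mult.commute)
      have "l2norm (\<lambda>x. G (t + h) x - G t x) = l2norm (\<lambda>x. of_real h * ((G (t + h) x - G t x) / of_real h))"
        using h by simp
      also have "\<dots> = \<bar>h\<bar> * l2norm (\<lambda>x. (G (t + h) x - G t x) / of_real h)" by (simp only: l2norm_cmult norm_of_real real_norm_def)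
      also have "\<dots> \<le> \<bar>h\<bar> * (l2norm D + l2norm (\<lambda>x. (G (t + h) x - G t x) / of_real h - D x))"
        by (intro mult_left_mono l2norm_le_add_diff Q D) auto
      finally show "norm (l2norm (\<lambda>x. G (t + h) x - G t x))
        \<le> \<bar>h\<bar> * (l2norm (\<lambda>x. (G (t + h) x - G t x) / of_real h - D x) + l2norm D)" by (simp add: add.commute)
    qed
  qed
  then show ?thesis using LIM_offset_zero_iff[of t "\<lambda>s. l2norm (\<lambda>x. G s x - G t x)" 0] by simp
qed

lemma L2_derivative_pairing:
  fixes G :: "real \<Rightarrow> 'a::euclidean_space \<Rightarrow> complex"
  assumes G: "\<And>s. G s \<in> L2" and D: "D \<in> L2" and v: "v \<in> L2"
    and lim: "((\<lambda>h. l2norm (\<lambda>x. (G (t + h) x - G t x) / of_real h - D x)) \<longlongrightarrow> 0) (at 0)"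
  shows "((\<lambda>s. LINT x|lborel. G s x * v x) has_vector_derivative (LINT x|lborel. D x * v x)) (at t)"
proof -
  have Q: "(\<lambda>x. (G (t + h) x - G t x) / of_real h) \<in> L2" for h
    using L2_cmult[OF L2_diff[OF G[of "t + h"] G[of t]], of "inverse (of_real h)"] by (simp add: divide_inverse mult.commute)
  have "((\<lambda>h. LINT x|lborel. (G (t + h) x - G t x) / of_real h * v x) \<longlongrightarrow> (LINT x|lborel. D x * v x)) (at 0)"
    by (rule L2_pairing_tendsto[OF Q D lim v v]) (simp add: l2norm_def)
  moreover have "(LINT x|lborel. (G (t + h) x - G t x) / of_real h * v x)
      = ((LINT x|lborel. G (t + h) x * v x) - (LINT x|lborel. G t x * v x)) /\<^sub>R h" for h
  proof -
    have "(LINT x|lborel. (G (t + h) x - G t x) / of_real h * v x) = (LINT x|lborel. inverse (of_real h) * (G (t + h) x * v x - G t x * v x))"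
      by (simp add: divide_inverse algebra_simps)
    then show ?thesis using L2_mult_integrable[OF G v] by (simp add: scaleR_conv_of_real)
  qed
  ultimately show ?thesis by (simp add: has_vector_derivative_iff_quotient)
qed

lemma schroedinger_solution_iff:
  "schroedinger_solution f u \<longleftrightarrow>
     (\<forall>t. u t \<in> L2) \<and>
     (\<forall>t. ((\<lambda>s. l2norm (\<lambda>x. u s x - u t x)) \<longlongrightarrow> 0) (at t)) \<and>
     (AE x in lborel. u 0 x = f x) \<and>
     (\<forall>\<phi> t. test_function \<phi> \<longrightarrow>
        ((\<lambda>s. LINT x|lborel. u s x * \<phi> x) has_vector_derivative
           \<i> * (LINT x|lborel. u t x * laplacian \<phi> x)) (at t))"
proof -
  have "((\<lambda>s. Lp_norm 2 (\<lambda>x. u s x - u t x)) \<longlongrightarrow> 0) (at t) \<longleftrightarrow> ((\<lambda>s. l2norm (\<lambda>x. u s x - u t x)) \<longlongrightarrow> 0) (at t)"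
    if "\<And>t. u t \<in> L2" for t
  proof -
    have "(\<lambda>s. Lp_norm 2 (\<lambda>x. u s x - u t x)) = (\<lambda>s. ennreal (l2norm (\<lambda>x. u s x - u t x)))"
      using that by (intro ext Lp_norm_2_eq L2_diff)
    then show ?thesis using tendsto_ennreal_iff[of "\<lambda>s. l2norm (\<lambda>x. u s x - u t x)" "at t" 0] by (simp add: always_eventually)
  qed
  then show ?thesis unfolding schroedinger_solution_def by blast
qed

text \<open>
  Differentiate under the integral and move the Laplacian to the test function.
\<close>

lemma gflow_solution: 
  assumes B: "Re B > 0"
  shows "schroedinger_solution (gflow B w 0) (gflow B w)"
  unfolding schroedinger_solution_iff
proof (intro conjI allI impI)
  show "gflow B w t \<in> L2" for t by (rule gflow_L2[OF B])
  note L2 = gflow_L2(1)[OF B, of w] L2_cmult[OF gflow_L2(2)[OF B, of w], of \<i>]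
  show "((\<lambda>s. l2norm (\<lambda>x. gflow B w s x - gflow B w t x)) \<longlongrightarrow> 0) (at t)" for t
    by (rule L2_differentiable_imp_continuous[OF L2 gflow_L2_derivative[OF B]])
  fix \<phi> :: "'a \<Rightarrow> complex" and t assume \<phi>: "test_function \<phi>"
  obtain R where R: "\<And>x. norm x > R \<Longrightarrow> \<phi> x = 0" using test_function_support[OF \<phi>] by blast
  have "((\<lambda>s. LINT x|lborel. gflow B w s x * \<phi> x) has_vector_derivative (LINT x|lborel. \<i> * laplacian (gflow B w t) x * \<phi> x)) (at t)"
    by (rule L2_derivative_pairing[OF L2 test_function_L2(1)[OF \<phi>] gflow_L2_derivative[OF B]])
  moreover have "(LINT x|lborel. \<i> * laplacian (gflow B w t) x * \<phi> x) = \<i> * (LINT x|lborel. gflow B w t x * laplacian \<phi> x)"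
    using laplacian_self_adjoint[OF C2_gflow[of B w t] test_function_C2[OF \<phi>] R] by (simp add: mult.assoc)
  ultimately show "((\<lambda>s. LINT x|lborel. gflow B w s x * \<phi> x) has_vector_derivative
      \<i> * (LINT x|lborel. gflow B w t x * laplacian \<phi> x)) (at t)" by simp
qed simp

lemma schroedinger_solutionD:
  assumes "schroedinger_solution f u"
  shows solution_L2: "u t \<in> L2"
    and solution_continuous: "((\<lambda>s. l2norm (\<lambda>x. u s x - u t x)) \<longlongrightarrow> 0) (at t)"
    and solution_initial: "AE x in lborel. u 0 x = f x"
    and solution_weak: "test_function \<phi> \<Longrightarrow> ((\<lambda>s. LINT x|lborel. u s x * \<phi> x) has_vector_derivative
           \<i> * (LINT x|lborel. u t x * laplacian \<phi> x)) (at t)"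
  using assms unfolding schroedinger_solution_iff by blast+

lemma solution_add:
  assumes u: "schroedinger_solution f u" and v: "schroedinger_solution g v"
  shows "schroedinger_solution (\<lambda>x. f x + g x) (\<lambda>t x. u t x + v t x)"
  unfolding schroedinger_solution_iff
proof (intro conjI allI impI)
  note L2 = solution_L2[OF u] solution_L2[OF v]
  show "(\<lambda>x. u t x + v t x) \<in> L2" for t by (intro L2_add L2)
  show "((\<lambda>s. l2norm (\<lambda>x. u s x + v s x - (u t x + v t x))) \<longlongrightarrow> 0) (at t)" for t
  proof (rule Lim_null_comparison)
    show "((\<lambda>s. l2norm (\<lambda>x. u s x - u t x) + l2norm (\<lambda>x. v s x - v t x)) \<longlongrightarrow> 0) (at t)"
      by (rule tendsto_add_zero[OF solution_continuous[OF u] solution_continuous[OF v]])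
    show "\<forall>\<^sub>F s in at t. norm (l2norm (\<lambda>x. u s x + v s x - (u t x + v t x)))
        \<le> l2norm (\<lambda>x. u s x - u t x) + l2norm (\<lambda>x. v s x - v t x)"
    proof (rule always_eventually, rule allI)
      fix s
      show "norm (l2norm (\<lambda>x. u s x + v s x - (u t x + v t x))) \<le> l2norm (\<lambda>x. u s x - u t x) + l2norm (\<lambda>x. v s x - v t x)"
        using l2norm_triangle[OF L2_diff[OF L2(1)[of s] L2(1)[of t]] L2_diff[OF L2(2)[of s] L2(2)[of t]]]
        by (simp add: algebra_simps)
    qed
  qed
  show "AE x in lborel. u 0 x + v 0 x = f x + g x"
    using solution_initial[OF u] solution_initial[OF v] by eventually_elim simp
  fix \<phi> :: "'a \<Rightarrow> complex" and t assume \<phi>: "test_function \<phi>"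
  show "((\<lambda>s. LINT x|lborel. (u s x + v s x) * \<phi> x) has_vector_derivative
      \<i> * (LINT x|lborel. (u t x + v t x) * laplacian \<phi> x)) (at t)"
    using has_vector_derivative_add[OF solution_weak[OF u \<phi>, of t] solution_weak[OF v \<phi>, of t]]
    by (simp add: L2_mult_integrable L2 test_function_L2[OF \<phi>] distrib_left distrib_right)
qed

lemma solution_cmult:
  assumes u: "schroedinger_solution f u"
  shows "schroedinger_solution (\<lambda>x. c * f x) (\<lambda>t x. c * u t x)"
  unfolding schroedinger_solution_iff
proof (intro conjI allI impI)
  show "(\<lambda>x. c * u t x) \<in> L2" for t by (intro L2_cmult solution_L2[OF u])
  show "((\<lambda>s. l2norm (\<lambda>x. c * u s x - c * u t x)) \<longlongrightarrow> 0) (at t)" for t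
    using tendsto_mult_right_zero[OF solution_continuous[OF u, of t], of "norm c"]
    by (simp add: l2norm_cmult flip: right_diff_distrib)
  show "AE x in lborel. c * u 0 x = c * f x"
    using solution_initial[OF u] by eventually_elim simp
  fix \<phi> :: "'a \<Rightarrow> complex" and t assume \<phi>: "test_function \<phi>"
  show "((\<lambda>s. LINT x|lborel. c * u s x * \<phi> x) has_vector_derivative
      \<i> * (LINT x|lborel. c * u t x * laplacian \<phi> x)) (at t)"
    using has_vector_derivative_mult_right[OF solution_weak[OF u \<phi>, of t], of c]
    by (simp add: mult.assoc mult.left_commute)
qed

lemma packet_flow_solution: "schroedinger_solution (packet_sum l) (packet_flow l)"
proof (induction l)
  case Nil
  have "schroedinger_solution (\<lambda>x::'a. 0 * gflow (1/2) (\<lambda>_. 0) 0 x) (\<lambda>t x. 0 * gflow (1/2) (\<lambda>_. 0) t x)"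
    by (intro solution_cmult gflow_solution) simp
  then show ?case by (simp add: packet_flow_def[abs_def] packet_sum_def[abs_def])
next
  case (Cons p l)
  obtain c \<xi> where p: "p = (c, \<xi>)" by (cases p)
  have g0: "gflow (1/2) (\<lambda>b. \<i> * of_real (\<xi> \<bullet> b)) 0 = packet \<xi>"
    by (rule ext) (simp add: gflow_0 cdot_of_real packet_def)
  have "schroedinger_solution (\<lambda>x. c * gflow (1/2) (\<lambda>b. \<i> * of_real (\<xi> \<bullet> b)) 0 x + packet_sum l x)
      (\<lambda>t x. c * gflow (1/2) (\<lambda>b. \<i> * of_real (\<xi> \<bullet> b)) t x + packet_flow l t x)"
    by (intro solution_add solution_cmult gflow_solution Cons) simp
  moreover have "packet_flow (p # l) = (\<lambda>t x. c * gflow (1/2) (\<lambda>b. \<i> * of_real (\<xi> \<bullet> b)) t x + packet_flow l t x)"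
    by (intro ext) (simp add: p)
  moreover have "packet_sum (p # l) = (\<lambda>x. c * gflow (1/2) (\<lambda>b. \<i> * of_real (\<xi> \<bullet> b)) 0 x + packet_sum l x)"
    unfolding g0 by (rule ext) (simp add: p)
  ultimately show ?case by simp
qed

section \<open>Existence of solutions\<close>

text \<open>
  The evolution of packet sums is isometric, and differences of packet sums are packet sums.
\<close>

lemma packet_flow_diff:
  "l2norm (\<lambda>x. packet_flow l t x - packet_flow l' t x) = l2norm (\<lambda>x. packet_sum l x - packet_sum l' x)"
proof -
  let ?l = "l @ map (\<lambda>(c, \<xi>). (- 1 * c, \<xi>)) l'"
  have "packet_flow ?l t = (\<lambda>x. packet_flow l t x - packet_flow l' t x)"
    unfolding fun_eq_iff packet_flow_simps packet_flow_cmult by simp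
  moreover have "packet_sum ?l = (\<lambda>x. packet_sum l x - packet_sum l' x)"
    unfolding fun_eq_iff packet_sum_simps packet_sum_cmult by simp
  ultimately show ?thesis using packet_flow_isometry[of ?l t] by simp
qed

text \<open>
  The evolutions of approximating packet sums form Cauchy sequences, uniformly in time, because the
  evolution is isometric. Approximation at the rate \<open>4\<^sup>-\<^sup>n\<close> makes one sequence converge almost
  everywhere at all times, so that the limit can be taken pointwise; the same almost everywhere
  convergence later feeds Fatou's lemma.
\<close>

theorem solution_exists:
  fixes f :: "'a::euclidean_space \<Rightarrow> complex"
  assumes f: "f \<in> L2" and l: "\<And>n. l2norm (\<lambda>x. f x - packet_sum (l n) x) \<le> (1/4) ^ n"
  obtains u where "schroedinger_solution f u" "\<And>t. AE x in lborel. (\<lambda>n. packet_flow (l n) t x) \<longlonglongrightarrow> u t x"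
proof -
  let ?v = "\<lambda>n. packet_flow (l n)"
  note vL = packet_flow_norm(1)
  define u where "u t x = lim (\<lambda>n. ?v n t x)" for t x
  have Cauchy: "l2norm (\<lambda>x. ?v n t x - ?v m t x) \<le> 2 * (1/4) ^ n" if "n \<le> m" for n m t
  proof -
    have "l2norm (\<lambda>x. ?v n t x - ?v m t x) \<le> l2norm (\<lambda>x. packet_sum (l n) x - f x) + l2norm (\<lambda>x. f x - packet_sum (l m) x)"
      unfolding packet_flow_diff by (intro l2norm_triangle_diff packet_sum_L2 f)
    also have "\<dots> \<le> (1/4) ^ n + (1/4) ^ m"
      by (intro add_mono l) (use l in \<open>simp add: l2norm_minus_commute[of _ f]\<close>)
    also have "(1/4::real) ^ m \<le> (1/4) ^ n" using that by (intro power_decreasing) auto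
    finally show ?thesis by simp
  qed
  have conv: "AE x in lborel. (\<lambda>n. ?v n t x) \<longlonglongrightarrow> u t x" for t
  proof -
    have "AE x in lborel. summable (\<lambda>n. norm (?v (Suc n) t x - ?v n t x))"
    proof (rule fast_decay_AE_summable[of _ 2])
      show "l2norm (\<lambda>x. ?v (Suc n) t x - ?v n t x) \<le> 2 * (1/4) ^ n" for n
        using Cauchy[of n "Suc n" t] by (simp add: l2norm_minus_commute[of "?v (Suc n) t"])
    qed (intro L2_diff vL)
    then show ?thesis
    proof eventually_elim
      case (elim x)
      then have "summable (\<lambda>n. ?v (Suc n) t x - ?v n t x)" by (rule summable_norm_cancel)
      then have "convergent (\<lambda>n. \<Sum>i<n. ?v (Suc i) t x - ?v i t x)" by (simp add: summable_iff_convergent)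
      then have "convergent (\<lambda>n. ?v n t x - ?v 0 t x)" 
        unfolding sum_lessThan_telescope[of "\<lambda>i. ?v i t x"] .
      then have "convergent (\<lambda>n. (?v n t x - ?v 0 t x) + ?v 0 t x)" by (intro convergent_add convergent_const)
      then show ?case by (simp add: u_def convergent_LIMSEQ_iff)
    qed
  qed
  have um: "u t \<in> borel_measurable lborel" for t
    unfolding u_def using L2_measurable[OF vL] by (intro borel_measurable_lim_metric) auto
  have rest: "(\<lambda>x. ?v n t x - u t x) \<in> L2 \<and> l2norm (\<lambda>x. ?v n t x - u t x) \<le> 2 * (1/4) ^ n" for n t
  proof -
    let ?d = "\<lambda>m x. ?v n t x - ?v (n + m) t x"
    have L: "?d m \<in> L2" "l2norm (?d m) \<le> 2 * (1/4) ^ n" for m by (intro L2_diff vL) (rule Cauchy, simp)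
    have m: "(\<lambda>x. ?v n t x - u t x) \<in> borel_measurable lborel"
      using L2_measurable[OF vL] um by measurable
    have "AE x in lborel. (\<lambda>m. ?d m x) \<longlonglongrightarrow> ?v n t x - u t x"
      using conv[of t]
    proof eventually_elim
      case (elim x)
      have "(\<lambda>m. ?v (n + m) t x) \<longlonglongrightarrow> u t x"
        using LIMSEQ_ignore_initial_segment[OF elim, of n] by (simp add: add.commute)
      then show ?case by (intro tendsto_intros)
    qed
    from L2_Fatou[OF L m this] show ?thesis by blast
  qed
  have uL: "u t \<in> L2" for t
    using L2_diff[OF vL[of "l 0" t] rest[THEN conjunct1, of 0 t]] by simp
  have small: "(\<lambda>n. 2 * (1/4::real) ^ n) \<longlonglongrightarrow> 0"
    using tendsto_mult_right_zero[OF LIMSEQ_power_zero[of "1/4::real"], of 2] by simp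
  have "schroedinger_solution f u"
    unfolding schroedinger_solution_iff
  proof (intro conjI allI impI)
    show "u t \<in> L2" for t by (rule uL)
    show "((\<lambda>s. l2norm (\<lambda>x. u s x - u t x)) \<longlongrightarrow> 0) (at t)" for t
    proof (rule tendstoI)
      fix e :: real assume e: "e > 0"
      obtain n where n: "2 * (1/4::real) ^ n < e / 3"
        using order_tendstoD(2)[OF small, of "e/3"] e by (auto simp: eventually_sequentially)
      have "\<forall>\<^sub>F s in at t. l2norm (\<lambda>x. ?v n s x - ?v n t x) < e / 3"
        using order_tendstoD(2)[OF solution_continuous[OF packet_flow_solution[of "l n"], of t], of "e/3"] e by simp
      then show "\<forall>\<^sub>F s in at t. dist (l2norm (\<lambda>x. u s x - u t x)) 0 < e"
      proof eventually_elim
        case (elim s)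
        have "l2norm (\<lambda>x. u s x - u t x) \<le> l2norm (\<lambda>x. u s x - ?v n s x) + l2norm (\<lambda>x. ?v n s x - u t x)"
          by (intro l2norm_triangle_diff uL vL)
        also have "l2norm (\<lambda>x. ?v n s x - u t x) \<le> l2norm (\<lambda>x. ?v n s x - ?v n t x) + l2norm (\<lambda>x. ?v n t x - u t x)"
          by (intro l2norm_triangle_diff uL vL)
        finally have "l2norm (\<lambda>x. u s x - u t x) \<le> l2norm (\<lambda>x. u s x - ?v n s x) + (l2norm (\<lambda>x. ?v n s x - ?v n t x) + l2norm (\<lambda>x. ?v n t x - u t x))"
          by simp
        moreover have "l2norm (\<lambda>x. u s x - ?v n s x) \<le> 2 * (1/4) ^ n"
          using rest[of n s] by (simp add: l2norm_minus_commute[of "u s"])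
        moreover have "l2norm (\<lambda>x. ?v n t x - u t x) \<le> 2 * (1/4) ^ n" using rest[of n t] by simp
        ultimately show ?case using elim n by simp
      qed
    qed
    show "AE x in lborel. u 0 x = f x"
    proof -
      have le3: "l2norm (\<lambda>x. u 0 x - f x) \<le> 3 * (1/4) ^ n" for n
      proof -
        have "l2norm (\<lambda>x. u 0 x - f x) \<le> l2norm (\<lambda>x. u 0 x - ?v n 0 x) + l2norm (\<lambda>x. ?v n 0 x - f x)"
          by (intro l2norm_triangle_diff uL vL f)
        moreover have "l2norm (\<lambda>x. u 0 x - ?v n 0 x) \<le> 2 * (1/4) ^ n"
          using rest[of n 0] by (simp add: l2norm_minus_commute[of "u 0"])
        moreover have "l2norm (\<lambda>x. ?v n 0 x - f x) \<le> (1/4) ^ n"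
          using l[of n] by (simp add: packet_flow_0 l2norm_minus_commute[of _ f])
        ultimately show ?thesis by simp
      qed
      have lim3: "(\<lambda>n. 3 * (1/4::real) ^ n) \<longlonglongrightarrow> 0"
        using tendsto_mult_right_zero[OF LIMSEQ_power_zero[of "1/4::real"], of 3] by simp
      have "l2norm (\<lambda>x. u 0 x - f x) \<le> 0"
        by (rule LIMSEQ_le_const[OF lim3]) (use le3 in blast)
      then have "l2norm (\<lambda>x. u 0 x - f x) = 0" using l2norm_nonneg[of "\<lambda>x. u 0 x - f x"] by linarith
      then show ?thesis using l2norm_eq_0_iff[OF L2_diff[OF uL f]] by simp
    qed
    fix \<phi> :: "'a \<Rightarrow> complex" and t assume \<phi>: "test_function \<phi>"
    note \<phi>L = test_function_L2[OF \<phi>]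
    have close: "norm ((LINT x|lborel. ?v n s x * \<psi> x) - (LINT x|lborel. u s x * \<psi> x)) \<le> 2 * (1/4) ^ n * l2norm \<psi>"
      if \<psi>: "\<psi> \<in> L2" for n s \<psi>
    proof -
      have "(LINT x|lborel. ?v n s x * \<psi> x) - (LINT x|lborel. u s x * \<psi> x) = (LINT x|lborel. (?v n s x - u s x) * \<psi> x)"
        unfolding left_diff_distrib
        by (rule Bochner_Integration.integral_diff[symmetric, OF L2_mult_integrable[OF vL \<psi>] L2_mult_integrable[OF uL \<psi>]])
      also have "norm \<dots> \<le> l2norm (\<lambda>x. ?v n s x - u s x) * l2norm \<psi>"
        by (intro L2_Cauchy_Schwarz L2_diff uL vL \<psi>)
      also have "\<dots> \<le> 2 * (1/4) ^ n * l2norm \<psi>" by (intro mult_right_mono) (use rest in auto)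
      finally show ?thesis .
    qed
    have small': "(\<lambda>n. 2 * (1/4::real) ^ n * a) \<longlonglongrightarrow> 0" for a
      using tendsto_mult_left_zero[OF small] .
    show "((\<lambda>s. LINT x|lborel. u s x * \<phi> x) has_vector_derivative \<i> * (LINT x|lborel. u t x * laplacian \<phi> x)) (at t)"
    proof (rule has_vector_derivative_uniform_limit[where d = 1 and F = "\<lambda>n s. LINT x|lborel. ?v n s x * \<phi> x"
          and F' = "\<lambda>n s. \<i> * (LINT x|lborel. ?v n s x * laplacian \<phi> x)" and G' = "\<lambda>s. \<i> * (LINT x|lborel. u s x * laplacian \<phi> x)"])
      show "((\<lambda>s. LINT x|lborel. ?v n s x * \<phi> x) has_vector_derivative \<i> * (LINT x|lborel. ?v n s x * laplacian \<phi> x)) (at s)" for n s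
        by (rule solution_weak[OF packet_flow_solution \<phi>])
      show "(\<lambda>n. LINT x|lborel. ?v n s x * \<phi> x) \<longlonglongrightarrow> (LINT x|lborel. u s x * \<phi> x)" for s
        by (rule LIM_zero_cancel, rule Lim_null_comparison[OF _ small'[of "l2norm \<phi>"]])
           (intro always_eventually allI close \<phi>L)
      fix e :: real assume e: "e > 0"
      have "\<forall>\<^sub>F n in sequentially. 2 * (1/4::real) ^ n * l2norm (laplacian \<phi>) < e"
        using order_tendstoD(2)[OF small' e] .
      then show "\<forall>\<^sub>F n in sequentially. \<forall>s\<in>ball t 1. norm (\<i> * (LINT x|lborel. ?v n s x * laplacian \<phi> x)
          - \<i> * (LINT x|lborel. u s x * laplacian \<phi> x)) \<le> e"
      proof eventually_elim
        case (elim n)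
        then show ?case using close[OF \<phi>L(2), of n]
          by (auto simp: norm_mult simp flip: right_diff_distrib intro: order_trans[OF _ less_imp_le])
      qed
    qed simp
  qed
  then show thesis using conv by (rule that)
qed

section \<open>Uniqueness of solutions\<close>

text \<open>The weak equation extends from test functions to Gaussians by cutting the Gaussians off.\<close>

lemma cutoff_gaussian_converges:
  fixes w :: "'a::euclidean_space \<Rightarrow> complex" and t :: real
  assumes B: "Re B > 0"
  defines "\<phi> \<equiv> \<lambda>n x. cutoff (real (Suc n)) x * gflow B w t x"
  shows "test_function (\<phi> n)"
    and "(\<lambda>n. l2norm (\<lambda>x. \<phi> n x - gflow B w t x)) \<longlonglongrightarrow> 0"
    and "(\<lambda>n. l2norm (\<lambda>x. laplacian (\<phi> n) x - laplacian (gflow B w t) x)) \<longlonglongrightarrow> 0"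
proof -
  let ?G = "gflow B w t" and ?G1 = "gflow1 B w t" and ?G2 = "gflow2 B w t"
  let ?z = "gflow_denom B t"
  let ?R = "\<lambda>n. real (Suc n)"
  let ?F2 = "\<lambda>n b c x. cutoff2 (?R n) b c x * ?G x + cutoff1 (?R n) b x * ?G1 c x + cutoff1 (?R n) c x * ?G1 b x + cutoff (?R n) x * ?G2 b c x"
  have C2: "C2_with (\<phi> n) (\<lambda>b x. cutoff1 (?R n) b x * ?G x + cutoff (?R n) x * ?G1 b x) (?F2 n)" for n
    unfolding \<phi>_def by (intro C2_mult C2_cutoff C2_gflow) simp
  show test: "test_function (\<phi> n)" for n
    by (rule C2_test_function[OF C2, of "?R n"]) (simp add: \<phi>_def cutoff_support)
  define K where "K b = (norm (w b) + 2 * norm B) / norm ?z" for b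
  define L where "L = 2 * norm B / norm ?z"
  have L: "L \<ge> 0" by (simp add: L_def)
  have G1: "norm (?G1 b x) \<le> K b * (1 + norm x) * norm (?G x)" if "b \<in> Basis" for b x
  proof -
    have "norm (w b - 2 * B * of_real (x \<bullet> b)) \<le> norm (w b) + 2 * norm B * norm x"
      using norm_triangle_ineq4[of "w b" "2 * B * of_real (x \<bullet> b)"] mult_left_mono[OF Basis_le_norm[OF that, of x], of "2 * norm B"]
      by (simp add: norm_mult)
    also have "\<dots> \<le> (norm (w b) + 2 * norm B) * (1 + norm x)" by (simp add: algebra_simps)
    finally have "norm (w b - 2 * B * of_real (x \<bullet> b)) / norm ?z \<le> (norm (w b) + 2 * norm B) * (1 + norm x) / norm ?z"
      by (rule divide_right_mono) simp
    then have "norm (?G x) * (norm (w b - 2 * B * of_real (x \<bullet> b)) / norm ?z) \<le> norm (?G x) * (K b * (1 + norm x))"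
      by (intro mult_left_mono) (auto simp: K_def)
    then show ?thesis by (simp only: gflow1_def norm_mult norm_divide mult.commute mult.left_commute)
  qed
  have P: "1 \<le> (1 + norm x)\<^sup>2" "(1 + norm x) * norm x \<le> (1 + norm x)\<^sup>2" "24 * (norm x)\<^sup>2 + 6 \<le> 30 * (1 + norm x)\<^sup>2" for x :: 'a
  proof -
    have n: "0 \<le> norm x" "0 \<le> (norm x)\<^sup>2" by auto
    have e: "(1 + norm x)\<^sup>2 = 1 + 2 * norm x + (norm x)\<^sup>2" "(1 + norm x) * norm x = norm x + (norm x)\<^sup>2"
      by (simp_all add: power2_eq_square algebra_simps)
    show "1 \<le> (1 + norm x)\<^sup>2" "(1 + norm x) * norm x \<le> (1 + norm x)\<^sup>2"
      unfolding e using n by linarith+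
    have "24 * c + 6 \<le> 30 * (1 + 2 * a + c)" if "0 \<le> a" "0 \<le> c" for a c :: real
      using that by (simp add: algebra_simps)
    from this[OF n] show "24 * (norm x)\<^sup>2 + 6 \<le> 30 * (1 + norm x)\<^sup>2" unfolding e .
  qed
  have K0: "K b \<ge> 0" for b by (simp add: K_def)
  have G2: "norm (?G2 b b x) \<le> ((K b)\<^sup>2 + L) * ((1 + norm x)\<^sup>2 * norm (?G x))" if "b \<in> Basis" for b x
  proof (cases "?G x = 0")
    case True then show ?thesis by (simp add: gflow2_def)
  next
    case False
    let ?l = "(w b - 2 * B * of_real (x \<bullet> b)) / ?z"
    have "norm (?G x) * norm ?l \<le> norm (?G x) * (K b * (1 + norm x))"
      using G1[OF that, of x] by (simp only: gflow1_def norm_mult mult.commute mult.left_commute)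
    then have l: "norm ?l \<le> K b * (1 + norm x)" using False by simp
    have "norm (?l * ?l - 2 * B * of_real (b \<bullet> b) / ?z) \<le> norm ?l * norm ?l + L"
      using norm_triangle_ineq4[of "?l * ?l" "2 * B * of_real (b \<bullet> b) / ?z"] that
      by (simp add: norm_mult norm_divide L_def)
    also have "norm ?l * norm ?l \<le> (K b * (1 + norm x)) * (K b * (1 + norm x))"
      by (intro mult_mono l) (use K0 in auto)
    also have "L \<le> L * (1 + norm x)\<^sup>2" using mult_left_mono[OF P(1) L] by simp
    finally have "norm (?l * ?l - 2 * B * of_real (b \<bullet> b) / ?z) \<le> ((K b)\<^sup>2 + L) * (1 + norm x)\<^sup>2"
      by (simp add: power2_eq_square algebra_simps)
    then have "norm (?G x) * norm (?l * ?l - 2 * B * of_real (b \<bullet> b) / ?z) \<le> norm (?G x) * (((K b)\<^sup>2 + L) * (1 + norm x)\<^sup>2)"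
      by (rule mult_left_mono) simp
    then show ?thesis by (simp only: gflow2_def norm_mult mult.commute mult.left_commute)
  qed
  define Q where "Q x = (1 + norm x)\<^sup>2 * norm (?G x)" for x
  define N where "N = (\<Sum>b\<in>(Basis::'a set). 30 + 12 * K b + ((K b)\<^sup>2 + L))"
  have Q0: "Q x \<ge> 0" for x by (simp add: Q_def)
  have GQ: "norm (?G x) \<le> Q x" for x
    using mult_right_mono[OF P(1)[of x], of "norm (?G x)"] by (simp add: Q_def)
  have R1: "?R n \<ge> 1" for n by simp
  have c2: "norm (cutoff2 (?R n) b b x * ?G x) \<le> 30 * Q x / ?R n" if b: "b \<in> Basis" for n b x
  proof -
    have "norm (cutoff2 (?R n) b b x * ?G x) \<le> (30 * (1 + norm x)\<^sup>2) / ?R n * norm (?G x)"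
      unfolding norm_mult
      by (intro mult_right_mono order_trans[OF cutoff_bounds(3)[OF R1 b]] divide_right_mono P) auto
    then show ?thesis by (simp add: Q_def)
  qed
  have c1: "norm (cutoff1 (?R n) b x * ?G1 b x) \<le> 6 * K b * Q x / ?R n" if b: "b \<in> Basis" for n b x
  proof -
    have "norm (cutoff1 (?R n) b x * ?G1 b x) \<le> (6 * norm x / ?R n) * (K b * (1 + norm x) * norm (?G x))"
      unfolding norm_mult using K0 by (intro mult_mono cutoff_bounds(2)[OF R1 b] G1 b) auto
    also have "\<dots> = 6 * K b * (((1 + norm x) * norm x) * norm (?G x)) / ?R n" by simp
    also have "\<dots> \<le> 6 * K b * Q x / ?R n"
      unfolding Q_def using K0 by (intro divide_right_mono mult_left_mono mult_right_mono P) auto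
    finally show ?thesis .
  qed
  have c0: "norm (cutoff (?R n) x * ?G2 b b x) \<le> ((K b)\<^sup>2 + L) * Q x" if b: "b \<in> Basis" for n b x
  proof -
    have "norm (cutoff (?R n) x * ?G2 b b x) \<le> 1 * (((K b)\<^sup>2 + L) * Q x)"
      unfolding norm_mult Q_def by (intro mult_mono cutoff_bounds(1)[OF R1 b] G2 b) auto
    then show ?thesis by simp
  qed
  obtain M c where Mc: "c > 0" "M \<ge> 0"
    "\<And>s x. \<bar>s\<bar> \<le> \<bar>t\<bar> \<Longrightarrow> (1 + norm x)\<^sup>2 * norm (gflow B w s x) \<le> M * exp (- c * (norm x)\<^sup>2)"
    by (rule gflow_bound[OF B, of "\<bar>t\<bar>" w], rule that)
  have cont: "continuous_on UNIV ?G" by (rule continuous_gflow)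
  have Qm: "(\<lambda>x. complex_of_real (Q x)) \<in> borel_measurable lborel"
  proof -
    have "continuous_on UNIV (\<lambda>x. complex_of_real (Q x))" unfolding Q_def by (intro continuous_intros cont)
    then show ?thesis by (simp add: borel_measurable_continuous_onI)
  qed
  have QL: "(\<lambda>x. complex_of_real (Q x)) \<in> L2"
  proof (rule gaussian_dominated_L2[OF Mc(1) Qm, of M])
    show "norm (complex_of_real (Q x)) \<le> M * exp (- c * (norm x)\<^sup>2)" for x
      unfolding norm_of_real abs_of_nonneg[OF Q0] unfolding Q_def by (rule Mc(3)) simp
  qed
  have \<phi>m: "\<phi> n \<in> borel_measurable lborel" "laplacian (\<phi> n) \<in> borel_measurable lborel" for n
    by (rule L2_measurable, rule test_function_L2, rule test)+
  show "(\<lambda>n. l2norm (\<lambda>x. \<phi> n x - ?G x)) \<longlonglongrightarrow> 0"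
  proof (rule l2norm_dominated_convergence[OF gflow_L2(1)[OF B, of w t] \<phi>m(1) gflow_L2(1)[OF B]])
    show "norm (\<phi> n x) \<le> norm (?G x)" for n x
    proof -
      obtain b :: 'a where "b \<in> Basis" using nonempty_Basis by blast
      from mult_right_mono[OF cutoff_bounds(1)[OF R1 this, of n x], of "norm (?G x)"] show ?thesis
        by (simp add: \<phi>_def norm_mult)
    qed
    show "AE x in lborel. (\<lambda>n. \<phi> n x) \<longlonglongrightarrow> ?G x"
    proof (rule AE_I2)
      fix x
      have "(\<lambda>n. \<phi> n x) \<longlonglongrightarrow> 1 * ?G x" unfolding \<phi>_def by (intro tendsto_intros cutoff_tendsto)
      then show "(\<lambda>n. \<phi> n x) \<longlonglongrightarrow> ?G x" by simp
    qed
  qed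
  have lapG: "laplacian ?G x = (\<Sum>b\<in>Basis. ?G2 b b x)" for x by (rule C2_laplacian[OF C2_gflow])
  have lap\<phi>: "laplacian (\<phi> n) x = (\<Sum>b\<in>Basis. ?F2 n b b x)" for n x by (rule C2_laplacian[OF C2])
  have inv0: "(\<lambda>n. a / ?R n) \<longlonglongrightarrow> 0" for a :: real
    using tendsto_mult_right_zero[OF LIMSEQ_inverse_real_of_nat, of a] by (simp add: divide_inverse)
  show "(\<lambda>n. l2norm (\<lambda>x. laplacian (\<phi> n) x - laplacian ?G x)) \<longlonglongrightarrow> 0"
  proof (rule l2norm_dominated_convergence[OF L2_cmult[OF QL, of "of_real N"] \<phi>m(2) gflow_L2(2)[OF B]])
    show "norm (laplacian (\<phi> n) x) \<le> norm (complex_of_real N * of_real (Q x))" for n x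
    proof -
      have "norm (?F2 n b b x) \<le> (30 + 12 * K b + ((K b)\<^sup>2 + L)) * Q x" if b: "b \<in> Basis" for b
      proof -
        have div: "a / ?R n \<le> a" if "a \<ge> 0" for a using that by (simp add: divide_le_eq mult_le_cancel_left1)
        have "norm (?F2 n b b x) \<le> norm (cutoff2 (?R n) b b x * ?G x) + norm (cutoff1 (?R n) b x * ?G1 b x)
            + norm (cutoff1 (?R n) b x * ?G1 b x) + norm (cutoff (?R n) x * ?G2 b b x)"
          by (intro norm_triangle_le add_mono order_refl)
        also have "\<dots> \<le> 30 * Q x + 6 * K b * Q x + 6 * K b * Q x + ((K b)\<^sup>2 + L) * Q x"
          using Q0[of x] K0[of b]
          by (intro add_mono c0 b order_trans[OF c2[OF b]] order_trans[OF c1[OF b]] div) auto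
        also have "\<dots> = (30 + 12 * K b + ((K b)\<^sup>2 + L)) * Q x" by (simp add: algebra_simps)
        finally show ?thesis .
      qed
      then have "norm (laplacian (\<phi> n) x) \<le> N * Q x"
        unfolding lap\<phi> N_def sum_distrib_right by (rule sum_norm_le)
      also have "\<dots> \<le> \<bar>N * Q x\<bar>" by (rule abs_ge_self)
      finally show ?thesis by (simp add: norm_mult abs_mult)
    qed
    show "AE x in lborel. (\<lambda>n. laplacian (\<phi> n) x) \<longlonglongrightarrow> laplacian ?G x"
    proof (rule AE_I2)
      fix x
      have "(\<lambda>n. ?F2 n b b x) \<longlonglongrightarrow> 0 + 0 + 0 + 1 * ?G2 b b x" if b: "b \<in> Basis" for b
      proof (intro tendsto_add tendsto_mult tendsto_const cutoff_tendsto)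
        show "(\<lambda>n. cutoff2 (?R n) b b x * ?G x) \<longlonglongrightarrow> 0"
          by (rule Lim_null_comparison[OF _ inv0[of "30 * Q x"]]) (intro always_eventually allI c2 b)
        show "(\<lambda>n. cutoff1 (?R n) b x * ?G1 b x) \<longlonglongrightarrow> 0" "(\<lambda>n. cutoff1 (?R n) b x * ?G1 b x) \<longlonglongrightarrow> 0"
          by (rule Lim_null_comparison[OF _ inv0[of "6 * K b * Q x"]], intro always_eventually allI c1 b)+
      qed
      then show "(\<lambda>n. laplacian (\<phi> n) x) \<longlonglongrightarrow> laplacian ?G x"
        unfolding lap\<phi> lapG by (intro tendsto_sum) simp
    qed
  qed
qed

text \<open>
  The norm of \<open>u s\<close> is bounded for \<open>s\<close> near \<open>t\<close>, so the derivatives converge uniformly there.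
\<close>

lemma solution_weak_gaussian:
  fixes w :: "'a::euclidean_space \<Rightarrow> complex"
  assumes u: "schroedinger_solution f u" and B: "Re B > 0"
  shows "((\<lambda>s. LINT x|lborel. u s x * gflow B w \<tau> x) has_vector_derivative
     \<i> * (LINT x|lborel. u t x * laplacian (gflow B w \<tau>) x)) (at t)"
proof -
  note conv = cutoff_gaussian_converges[OF B, where w = w and t = \<tau>]
  let ?\<phi> = "\<lambda>n x. cutoff (real (Suc n)) x * gflow B w \<tau> x"
  note uL = solution_L2[OF u] and \<phi>L = test_function_L2[OF conv(1)] and GL = gflow_L2[OF B, of w \<tau>]
  have close: "norm ((LINT x|lborel. u s x * g x) - (LINT x|lborel. u s x * h x)) \<le> l2norm (u s) * l2norm (\<lambda>x. g x - h x)"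
    if "g \<in> L2" "h \<in> L2" for g h s
  proof -
    have "(LINT x|lborel. u s x * g x) - (LINT x|lborel. u s x * h x) = (LINT x|lborel. u s x * (g x - h x))"
      unfolding right_diff_distrib
      by (rule Bochner_Integration.integral_diff[symmetric, OF L2_mult_integrable[OF uL that(1)] L2_mult_integrable[OF uL that(2)]])
    then show ?thesis using L2_Cauchy_Schwarz[OF uL L2_diff[OF that], of s] by simp
  qed
  have "\<forall>\<^sub>F s in at t. l2norm (\<lambda>x. u s x - u t x) < 1"
    using order_tendstoD(2)[OF solution_continuous[OF u, of t], of 1] by simp
  then obtain d where d: "d > 0" "\<And>s. s \<noteq> t \<Longrightarrow> dist s t < d \<Longrightarrow> l2norm (\<lambda>x. u s x - u t x) < 1"
    by (auto simp: eventually_at)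
  define A where "A = l2norm (u t) + 1"
  have A: "A > 0" unfolding A_def using l2norm_nonneg[of "u t"] by linarith
  have uA: "l2norm (u s) \<le> A" if "s \<in> ball t d" for s
  proof (cases "s = t")
    case False
    then show ?thesis
      using d(2)[OF False] that l2norm_le_add_diff[OF uL[of s] uL[of t]] by (simp add: A_def dist_commute)
  qed (simp add: A_def)
  show ?thesis
  proof (rule has_vector_derivative_uniform_limit[where d = d and F = "\<lambda>n s. LINT x|lborel. u s x * ?\<phi> n x"
        and F' = "\<lambda>n s. \<i> * (LINT x|lborel. u s x * laplacian (?\<phi> n) x)"
        and G' = "\<lambda>s. \<i> * (LINT x|lborel. u s x * laplacian (gflow B w \<tau>) x)"])
    show "((\<lambda>s. LINT x|lborel. u s x * ?\<phi> n x) has_vector_derivative \<i> * (LINT x|lborel. u s x * laplacian (?\<phi> n) x)) (at s)" for n s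
      by (rule solution_weak[OF u conv(1)])
    show "(\<lambda>n. LINT x|lborel. u s x * ?\<phi> n x) \<longlonglongrightarrow> (LINT x|lborel. u s x * gflow B w \<tau> x)" for s
      by (rule LIM_zero_cancel, rule Lim_null_comparison[OF _ tendsto_mult_right_zero[OF conv(2), of "l2norm (u s)"]])
         (intro always_eventually allI close \<phi>L GL)
    fix e :: real assume e: "e > 0"
    have "\<forall>\<^sub>F n in sequentially. A * l2norm (\<lambda>x. laplacian (?\<phi> n) x - laplacian (gflow B w \<tau>) x) < e"
      using order_tendstoD(2)[OF tendsto_mult_right_zero[OF conv(3), of A] e] .
    then show "\<forall>\<^sub>F n in sequentially. \<forall>s\<in>ball t d. norm (\<i> * (LINT x|lborel. u s x * laplacian (?\<phi> n) x)
        - \<i> * (LINT x|lborel. u s x * laplacian (gflow B w \<tau>) x)) \<le> e"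
    proof eventually_elim
      case (elim n)
      show ?case
      proof
        fix s assume s: "s \<in> ball t d"
        have "norm ((LINT x|lborel. u s x * laplacian (?\<phi> n) x) - (LINT x|lborel. u s x * laplacian (gflow B w \<tau>) x))
            \<le> l2norm (u s) * l2norm (\<lambda>x. laplacian (?\<phi> n) x - laplacian (gflow B w \<tau>) x)"
          by (intro close \<phi>L GL)
        also have "\<dots> \<le> A * l2norm (\<lambda>x. laplacian (?\<phi> n) x - laplacian (gflow B w \<tau>) x)"
          by (intro mult_right_mono uA s) simp
        finally show "norm (\<i> * (LINT x|lborel. u s x * laplacian (?\<phi> n) x)
            - \<i> * (LINT x|lborel. u s x * laplacian (gflow B w \<tau>) x)) \<le> e"
          using elim by (simp add: norm_mult right_diff_distrib[symmetric] del: right_diff_distrib)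
      qed
    qed
  qed (rule d)
qed

text \<open>
  Pairing a solution with a Gaussian that evolves backwards in time gives a conserved quantity.
\<close>

lemma solution_gaussian_pairing:
  fixes w :: "'a::euclidean_space \<Rightarrow> complex"
  assumes u: "schroedinger_solution f u" and f: "f \<in> L2" and B: "Re B > 0"
  shows "(LINT x|lborel. u T x * gflow B w 0 x) = (LINT x|lborel. f x * gflow B w T x)"
proof -
  let ?G = "gflow B w"
  note uL = solution_L2[OF u] and GL = gflow_L2[OF B, of w]
  define h where "h s = (LINT x|lborel. u s x * ?G (T - s) x)" for s
  \<comment> \<open>The two factors contribute \<open>D\<close> and \<open>- D\<close>. The increment of \<open>h\<close> is split so that the Gaussian moves
    first, against the solution at the later time.\<close>
  have "(h has_vector_derivative 0) (at s)" for s
  proof -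
    define D where "D = (LINT x|lborel. u s x * (\<i> * laplacian (?G (T - s)) x))"
    have "((\<lambda>k. (LINT x|lborel. u (s + k) x * ((?G (T - s + - k) x - ?G (T - s) x) / of_real (- k)))) \<longlongrightarrow> D) (at 0)"
      unfolding D_def
    proof (rule L2_pairing_tendsto)
      show "(\<lambda>x. (?G (T - s + - k) x - ?G (T - s) x) / of_real (- k)) \<in> L2" for k
        using L2_cmult[OF L2_diff[OF GL(1)[of "T - s + - k"] GL(1)[of "T - s"]], of "inverse (of_real (- k))"]
        by (simp only: divide_inverse mult.commute)
      show "((\<lambda>k. l2norm (\<lambda>x. u (s + k) x - u s x)) \<longlongrightarrow> 0) (at 0)"
        using LIM_offset_zero[OF solution_continuous[OF u, of s]] .
      have "filterlim (\<lambda>k::real. - k) (at 0) (at 0)"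
        using tendsto_minus[OF tendsto_ident_at[of "0::real" UNIV]] by (simp add: filterlim_at eventually_at_filter)
      from filterlim_compose[OF gflow_L2_derivative[OF B, where w = w and t = "T - s"] this]
      show "((\<lambda>k. l2norm (\<lambda>x. (?G (T - s + - k) x - ?G (T - s) x) / of_real (- k) - \<i> * laplacian (?G (T - s)) x)) \<longlongrightarrow> 0) (at 0)" .
    qed (intro uL L2_cmult GL)+
    then have "((\<lambda>k. - (LINT x|lborel. u (s + k) x * ((?G (T - s + - k) x - ?G (T - s) x) / of_real (- k)))) \<longlongrightarrow> - D) (at 0)"
      by (rule tendsto_minus)
    moreover have "((\<lambda>k. ((LINT x|lborel. u (s + k) x * ?G (T - s) x) - (LINT x|lborel. u s x * ?G (T - s) x)) /\<^sub>R k) \<longlongrightarrow> D) (at 0)"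
    proof -
      have "D = \<i> * (LINT x|lborel. u s x * laplacian (?G (T - s)) x)"
        unfolding D_def by (simp add: mult.left_commute)
      then show ?thesis
        using solution_weak_gaussian[OF u B, of w "T - s" s] by (simp add: has_vector_derivative_iff_quotient)
    qed
    ultimately have lim: "((\<lambda>k. - (LINT x|lborel. u (s + k) x * ((?G (T - s + - k) x - ?G (T - s) x) / of_real (- k)))
       + ((LINT x|lborel. u (s + k) x * ?G (T - s) x) - (LINT x|lborel. u s x * ?G (T - s) x)) /\<^sub>R k) \<longlongrightarrow> - D + D) (at 0)"
      by (rule tendsto_add)
    have eq: "- (LINT x|lborel. u (s + k) x * ((?G (T - s + - k) x - ?G (T - s) x) / of_real (- k)))
       + ((LINT x|lborel. u (s + k) x * ?G (T - s) x) - (LINT x|lborel. u s x * ?G (T - s) x)) /\<^sub>R k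
       = (h (s + k) - h s) /\<^sub>R k" for k
    proof -
      have "(LINT x|lborel. u (s + k) x * ((?G (T - s + - k) x - ?G (T - s) x) / of_real (- k)))
          = (LINT x|lborel. - inverse (of_real k) * (u (s + k) x * ?G (T - (s + k)) x - u (s + k) x * ?G (T - s) x))"
      proof (intro Bochner_Integration.integral_cong refl)
        have "a * ((b - c) / of_real (- k)) = - inverse (of_real k) * (a * b - a * c)" for a b c :: complex
          by (cases "k = 0") (simp_all add: field_simps)
        moreover have "T - s + - k = T - (s + k)" by simp
        ultimately show "u (s + k) x * ((?G (T - s + - k) x - ?G (T - s) x) / of_real (- k))
            = - inverse (of_real k) * (u (s + k) x * ?G (T - (s + k)) x - u (s + k) x * ?G (T - s) x)" for x
          by (simp only:)
      qed
      also have "\<dots> = - inverse (of_real k) * (h (s + k) - (LINT x|lborel. u (s + k) x * ?G (T - s) x))"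
        unfolding h_def integral_mult_right_zero
        by (simp only: Bochner_Integration.integral_diff[OF L2_mult_integrable[OF uL GL(1)] L2_mult_integrable[OF uL GL(1)]])
      finally have e: "(LINT x|lborel. u (s + k) x * ((?G (T - s + - k) x - ?G (T - s) x) / of_real (- k)))
          = - inverse (of_real k) * (h (s + k) - (LINT x|lborel. u (s + k) x * ?G (T - s) x))" .
      have "- (- inverse (of_real k) * (a - b)) + (b - c) /\<^sub>R k = (a - c) /\<^sub>R k" for a b c :: complex
        by (simp add: scaleR_conv_of_real right_diff_distrib)
      then show ?thesis unfolding e h_def[of s] .
    qed
    show ?thesis using lim unfolding eq has_vector_derivative_iff_quotient by (simp only: left_minus)
  qed
  then have "(h has_vector_derivative 0) (at s within UNIV)" for s by simp
  from has_vector_derivative_zero_constant[OF convex_UNIV this]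
  obtain c where "\<And>s. h s = c" by (metis UNIV_I)
  then have "h T = h 0" by (simp only:)
  moreover have "h 0 = (LINT x|lborel. f x * ?G T x)"
  proof -
    have "AE x in lborel. u 0 x * ?G T x = f x * ?G T x"
      using solution_initial[OF u] by eventually_elim simp
    then show ?thesis unfolding h_def diff_zero
      by (intro integral_cong_AE borel_measurable_integrable L2_mult_integrable uL GL f)
  qed
  ultimately have "h T = (LINT x|lborel. f x * ?G T x)" by (simp only:)
  then show ?thesis unfolding h_def by (simp only: diff_self)
qed

text \<open>
  By the conservation law the difference of two solutions is orthogonal to every packet at every time,
  and the packet sums are dense.
\<close>

theorem solution_unique:
  fixes u v :: "real \<Rightarrow> 'a::euclidean_space \<Rightarrow> complex"
  assumes u: "schroedinger_solution f u" and v: "schroedinger_solution f v"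
  shows "AE x in lborel. u t x = v t x"
proof -
  define g where "g x = u t x + - 1 * v t x" for x
  have "schroedinger_solution (\<lambda>x. f x + - 1 * f x) (\<lambda>t x. u t x + - 1 * v t x)"
    by (intro solution_add solution_cmult u v)
  then have sol: "schroedinger_solution (\<lambda>x. 0) (\<lambda>t x. u t x + - 1 * v t x)" by simp
  have gL: "g \<in> L2" using solution_L2[OF sol, of t] by (simp only: g_def[abs_def])
  have packet: "(LINT x|lborel. g x * packet \<xi> x) = 0" for \<xi>
  proof -
    have g0: "gflow (1/2) (\<lambda>b. \<i> * of_real (\<xi> \<bullet> b)) 0 = packet \<xi>"
      by (rule ext) (simp add: gflow_0 cdot_of_real packet_def)
    have "(LINT x|lborel. g x * gflow (1/2) (\<lambda>b. \<i> * of_real (\<xi> \<bullet> b)) 0 x) = (LINT x|lborel. 0 * gflow (1/2) (\<lambda>b. \<i> * of_real (\<xi> \<bullet> b)) t x)"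
      unfolding g_def by (rule solution_gaussian_pairing[OF sol L2_zero]) simp
    then show ?thesis unfolding g0 by simp
  qed
  have sum: "(LINT x|lborel. g x * packet_sum l x) = 0" for l
  proof (induction l)
    case (Cons p l)
    have "(LINT x|lborel. g x * packet_sum (p # l) x) = (LINT x|lborel. fst p * (g x * packet (snd p) x) + g x * packet_sum l x)"
      by (simp add: algebra_simps)
    also have "\<dots> = 0"
      using L2_mult_integrable[OF gL packet_L2[of "snd p"]] L2_mult_integrable[OF gL packet_sum_L2[of l]] packet Cons
      by simp
    finally show ?case .
  qed simp
  have gc: "(\<lambda>x. cnj (g x)) \<in> L2" by (rule L2_cnj[OF gL])
  have "(l2norm g)\<^sup>2 \<le> l2norm g * e" if e: "e > 0" for e
  proof -
    from gc have "(\<lambda>x. cnj (g x)) \<in> packet_closure" by (simp add: packet_sums_dense)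
    then obtain l where l: "l2norm (\<lambda>x. cnj (g x) - packet_sum l x) < e" using e by (rule packet_closureE)
    have "complex_of_real ((l2norm g)\<^sup>2) = (LINT x|lborel. g x * cnj (g x))"
      unfolding l2norm_square complex_norm_square[symmetric] by (rule integral_complex_of_real[symmetric])
    also have "\<dots> = (LINT x|lborel. g x * cnj (g x)) - (LINT x|lborel. g x * packet_sum l x)" by (simp add: sum)
    also have "\<dots> = (LINT x|lborel. g x * (cnj (g x) - packet_sum l x))"
      unfolding right_diff_distrib
      by (rule Bochner_Integration.integral_diff[symmetric, OF L2_mult_integrable[OF gL gc] L2_mult_integrable[OF gL packet_sum_L2]])
    finally have "norm (complex_of_real ((l2norm g)\<^sup>2)) \<le> l2norm g * l2norm (\<lambda>x. cnj (g x) - packet_sum l x)"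
      using L2_Cauchy_Schwarz[OF gL L2_diff[OF gc packet_sum_L2[of l]]] by simp
    also have "\<dots> \<le> l2norm g * e" using l by (intro mult_left_mono) auto
    finally show ?thesis by (simp add: norm_power)
  qed
  \<comment> \<open>Any \<open>e\<close> strictly between \<open>0\<close> and the norm of \<open>g\<close> gives a contradiction.\<close>
  from this[of "l2norm g / 2"] have "l2norm g = 0"
    using l2norm_nonneg[of g] by (cases "l2norm g = 0") (auto simp: power2_eq_square)
  then have "AE x in lborel. g x = 0" using l2norm_eq_0_iff[OF gL] by simp
  then show ?thesis by eventually_elim (simp add: g_def)
qed

corollary schroedinger_flow_AE:
  assumes "schroedinger_solution f u"
  shows "AE x in lborel. schroedinger_flow f t x = u t x"
proof -
  have "schroedinger_solution f (schroedinger_flow f)"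
    unfolding schroedinger_flow_def using assms by (rule someI[where P = "schroedinger_solution f"])
  then show ?thesis using assms by (rule solution_unique)
qed

section \<open>Integration in time\<close>

lemma norm_gflow_denom_square:
  "(norm (gflow_denom B t))\<^sup>2 = (1 - 4 * Im B * t)\<^sup>2 + (4 * Re B * t)\<^sup>2"
  by (simp add: gflow_denom_def cmod_power2)

text \<open>
  After completing the square the primitive is an arctangent.
\<close>

lemma gflow_denom_integral:
  assumes "Re B > 0"
  shows "has_bochner_integral lborel (\<lambda>t. 1 / (norm (gflow_denom B t))\<^sup>2) (pi / (4 * Re B))"
proof -
  define a b c where "a = Re B" and "b = Im B" and "c = a\<^sup>2 + b\<^sup>2"
  have a: "a > 0" using assms by (simp add: a_def)
  then have c: "c > 0" by (simp add: c_def sum_power2_gt_zero_iff)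
  let ?f = "\<lambda>t. 1 / (norm (gflow_denom B t))\<^sup>2"
  let ?F = "\<lambda>t. arctan ((4 * c * t - b) / a) / (4 * a)"
  have den: "a\<^sup>2 + (4 * c * t - b)\<^sup>2 = c * (norm (gflow_denom B t))\<^sup>2" for t
    unfolding norm_gflow_denom_square a_def[symmetric] b_def[symmetric] c_def
    by (simp add: power2_eq_square algebra_simps)
  have pos: "(norm (gflow_denom B t))\<^sup>2 > 0" for t
    using gflow_denom_nonzero[OF assms, of t] by simp
  have D: "DERIV ?F t :> ?f t" for t
  proof -
    have "DERIV ?F t :> inverse (1 + ((4 * c * t - b) / a)\<^sup>2) * (4 * c / a) / (4 * a)"
      using a by (auto intro!: derivative_eq_intros)
    moreover have "inverse (1 + ((4 * c * t - b) / a)\<^sup>2) * (4 * c / a) / (4 * a) = c / (a\<^sup>2 + (4 * c * t - b)\<^sup>2)"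
    proof -
      have "1 + ((4 * c * t - b) / a)\<^sup>2 = (a\<^sup>2 + (4 * c * t - b)\<^sup>2) / a\<^sup>2"
        using a by (simp add: power_divide add_divide_distrib)
      moreover have "inverse (S / a\<^sup>2) * (4 * c / a) / (4 * a) = c / S" for S
        using a by (cases "S = 0") (auto simp: power2_eq_square field_simps)
      ultimately show ?thesis by (simp only:)
    qed
    moreover have "c / (a\<^sup>2 + (4 * c * t - b)\<^sup>2) = ?f t" unfolding den using c by simp
    ultimately show ?thesis by simp
  qed
  have cont: "isCont ?f t" for t
    using gflow_denom_nonzero[OF assms, of t] unfolding gflow_denom_def by (intro continuous_intros) auto
  have "filterlim (\<lambda>t. (4 * c * t - b) / a) at_top at_top" "filterlim (\<lambda>t. (4 * c * t - b) / a) at_bot at_bot"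
    using a c by real_asymp+
  then have "((\<lambda>t. arctan ((4 * c * t - b) / a)) \<longlongrightarrow> pi / 2) at_top" "((\<lambda>t. arctan ((4 * c * t - b) / a)) \<longlongrightarrow> - (pi / 2)) at_bot"
    using filterlim_compose[OF tendsto_arctan_at_top] filterlim_compose[OF tendsto_arctan_at_bot] by blast+
  then have lims: "(?F \<longlongrightarrow> pi / 2 / (4 * a)) at_top" "(?F \<longlongrightarrow> - (pi / 2) / (4 * a)) at_bot"
    using a by (intro tendsto_divide tendsto_const; simp)+
  have set: "set_integrable lborel (einterval (-\<infinity>) \<infinity>) ?f" "(LBINT t=-\<infinity>..\<infinity>. ?f t) = pi / 2 / (4 * a) - - (pi / 2) / (4 * a)"
    using lims
    by (intro interval_integral_FTC_nonneg[where F = ?F] D cont; simp add: ereal_tendsto_simps1)+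
  have "integrable lborel ?f"
    using set(1) by (simp add: set_integrable_def einterval_def)
  moreover have "(LINT t|lborel. ?f t) = pi / (4 * a)"
    using set(2) a by (simp add: interval_lebesgue_integral_def set_lebesgue_integral_def einterval_def)
  ultimately show ?thesis by (simp add: has_bochner_integral_iff a_def)
qed

lemma norm_om_square_denom: "(norm (om t))\<^sup>2 = 1 / (norm (gflow_denom (1/2) t))\<^sup>2"
  by (simp add: om_def gflow_denom_def norm_divide power_divide)

lemma om_integral: "has_bochner_integral lborel (\<lambda>t. (norm (om t))\<^sup>2) (pi / 2)"
  using gflow_denom_integral[of "1/2"] by (simp add: norm_om_square_denom)

lemma om_has_vector_derivative: "(om has_vector_derivative - 2 * \<i> * (om t)\<^sup>2) (at t)"
proof -
  have "((\<lambda>z. 1 / (1 + 2 * \<i> * z)) has_field_derivative - 2 * \<i> * (om t)\<^sup>2) (at (of_real t))"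
    using om_denom[of t] by (auto intro!: derivative_eq_intros simp: om_def power2_eq_square)
  from has_vector_derivative_real_field[OF this] show ?thesis by (simp add: om_def[abs_def])
qed

lemma continuous_om [continuous_intros]: "continuous_on A om" "isCont om t"
proof -
  show "isCont om t" for t using om_has_vector_derivative by (rule has_vector_derivative_continuous)
  then show "continuous_on A om" by (intro continuous_at_imp_continuous_on) simp
qed

lemma continuous_ze [continuous_intros]: "continuous_on A ze" "isCont ze t"
  unfolding ze_def[abs_def] by (intro continuous_intros)+

lemma ze_measurable [measurable]: "ze \<in> borel_measurable borel"
  by (intro borel_measurable_continuous_onI continuous_intros)

lemma om_weight_integrable:
  assumes "continuous_on UNIV (f :: real \<Rightarrow> complex)" "\<And>t. norm (f t) \<le> M"
  shows "integrable lborel (\<lambda>t. of_real ((norm (om t))\<^sup>2) * f t)"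
proof (rule Bochner_Integration.integrable_bound)
  show "integrable lborel (\<lambda>t. (norm (om t))\<^sup>2 * M)"
    using om_integral by (auto simp: has_bochner_integral_iff)
  have "continuous_on UNIV (\<lambda>t. of_real ((norm (om t))\<^sup>2) * f t)"
    by (intro continuous_intros assms)
  then show "(\<lambda>t. of_real ((norm (om t))\<^sup>2) * f t) \<in> borel_measurable lborel"
    by (simp add: borel_measurable_continuous_onI)
  have "norm (of_real ((norm (om t))\<^sup>2) * f t) \<le> norm ((norm (om t))\<^sup>2 * M)" for t
  proof -
    have "(norm (om t))\<^sup>2 * norm (f t) \<le> (norm (om t))\<^sup>2 * M" by (intro mult_left_mono assms) auto
    also have "\<dots> \<le> \<bar>(norm (om t))\<^sup>2 * M\<bar>" by (rule abs_ge_self)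
    finally show ?thesis by (simp add: norm_mult norm_power)
  qed
  then show "AE t in lborel. norm (of_real ((norm (om t))\<^sup>2) * f t) \<le> norm ((norm (om t))\<^sup>2 * M)" by simp
qed

text \<open>
  The map \<open>ze\<close> parametrises the unit circle without the point \<open>-1\<close>, and \<open>\<bar>om\<bar>\<^sup>2 dt\<close> is a multiple of
  the arc length; since \<open>\<bar>om\<bar>\<^sup>2 ze = \<i>/4 ze'\<close>, the powers of \<open>ze\<close> are orthogonal.
\<close>

lemma ze_power_integral:
  assumes n: "n > 0"
  shows "(LINT t|lborel. of_real ((norm (om t))\<^sup>2) * ze t ^ n) = 0"
proof -
  let ?f = "\<lambda>t. of_real ((norm (om t))\<^sup>2) * ze t ^ n"
  let ?F = "\<lambda>t. \<i> / (4 * of_nat n) * ze t ^ n"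
  have int: "integrable lborel ?f"
    by (rule om_weight_integrable[of _ 1]) (auto simp: norm_power norm_ze intro!: continuous_intros)
  have D: "(?F has_vector_derivative ?f t) (at t)" for t
  proof -
    have "(ze has_vector_derivative 2 * (- 2 * \<i> * (om t)\<^sup>2) - 0) (at t)"
      unfolding ze_def[abs_def]
      by (intro has_vector_derivative_diff has_vector_derivative_mult_right om_has_vector_derivative has_vector_derivative_const)
    then have ze': "(ze has_vector_derivative - 4 * \<i> * (om t)\<^sup>2) (at t)" by (simp add: mult.assoc)
    have "((\<lambda>z. \<i> / (4 * of_nat n) * z ^ n) has_field_derivative \<i> / (4 * of_nat n) * (of_nat n * ze t ^ (n - Suc 0))) (at (ze t))"
      by (auto intro!: derivative_eq_intros)
    from field_vector_diff_chain_at[OF ze' this]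
    have "(?F has_vector_derivative (- 4 * \<i> * (om t)\<^sup>2) * (\<i> / (4 * of_nat n) * (of_nat n * ze t ^ (n - Suc 0)))) (at t)"
      by (simp add: o_def mult.assoc)
    moreover have "(- 4 * \<i> * (om t)\<^sup>2) * (\<i> / (4 * of_nat n) * (of_nat n * ze t ^ (n - Suc 0))) = ?f t"
    proof -
      have "(- 4 * \<i> * (om t)\<^sup>2) * (\<i> / (4 * of_nat n) * (of_nat n * ze t ^ (n - Suc 0))) = (om t)\<^sup>2 * ze t ^ (n - Suc 0)"
      proof -
        have "\<i> / (4 * of_nat n) * (of_nat n * ze t ^ (n - Suc 0)) = \<i> / 4 * ze t ^ (n - Suc 0)"
          using n by simp
        then show ?thesis by (simp only:) (simp add: algebra_simps)
      qed
      also have "(om t)\<^sup>2 * ze t ^ (n - Suc 0) = of_real ((norm (om t))\<^sup>2) * ze t * ze t ^ (n - Suc 0)"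
        unfolding complex_norm_square power2_eq_square[of "om t"] using ze_eq(1)[of t] by (metis mult.assoc mult.commute)
      also have "of_real ((norm (om t))\<^sup>2) * ze t * ze t ^ (n - Suc 0) = ?f t"
        using n by (simp add: mult.assoc flip: power_Suc)
      finally show ?thesis .
    qed
    ultimately show ?thesis by simp
  qed
  have om0: "(om \<longlongrightarrow> 0) at_top" "(om \<longlongrightarrow> 0) at_bot"
  proof -
    have "((\<lambda>t. sqrt (1 / (1 + 4 * t\<^sup>2))) \<longlongrightarrow> 0) at_top" "((\<lambda>t. sqrt (1 / (1 + 4 * t\<^sup>2))) \<longlongrightarrow> 0) at_bot"
      by real_asymp+
    moreover have "sqrt (1 / (1 + 4 * t\<^sup>2)) = norm (om t)" for t
      unfolding norm_om_square[symmetric] by simp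
    ultimately show "(om \<longlongrightarrow> 0) at_top" "(om \<longlongrightarrow> 0) at_bot"
      by (simp_all add: tendsto_norm_zero_iff)
  qed
  have lims: "(?F \<longlongrightarrow> \<i> / (4 * of_nat n) * (2 * 0 - 1) ^ n) at_top" "(?F \<longlongrightarrow> \<i> / (4 * of_nat n) * (2 * 0 - 1) ^ n) at_bot"
    unfolding ze_def by (intro tendsto_intros om0)+
  have cont: "isCont ?f t" for t by (intro continuous_intros)
  have "(LBINT t=-\<infinity>..\<infinity>. ?f t) = \<i> / (4 * of_nat n) * (2 * 0 - 1) ^ n - \<i> / (4 * of_nat n) * (2 * 0 - 1) ^ n"
  proof (rule interval_integral_FTC_integrable[where F = ?F])
    show "set_integrable lborel (einterval (-\<infinity>) \<infinity>) ?f"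
      using int by (simp add: set_integrable_def einterval_def)
  qed (use D cont lims in \<open>auto simp: ereal_tendsto_simps1\<close>)
  then show ?thesis by (simp add: interval_lebesgue_integral_def set_lebesgue_integral_def einterval_def)
qed

lemma ze_orthogonal:
  "(LINT t|lborel. of_real ((norm (om t))\<^sup>2) * (ze t ^ m * cnj (ze t) ^ n)) = (if m = n then of_real (pi / 2) else 0)"
proof -
  have one: "ze t * cnj (ze t) = 1" for t
    using complex_norm_square[of "ze t"] by (simp add: norm_ze)
  have red: "ze t ^ (k + n) * cnj (ze t) ^ n = ze t ^ k" "ze t ^ m * cnj (ze t) ^ (k + m) = cnj (ze t) ^ k" for t k
    by (simp_all add: power_add mult.assoc power_mult_distrib[symmetric] one)
  consider "m = n" | k where "k > 0" "m = k + n" | k where "k > 0" "n = k + m"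
    by (metis add.commute less_imp_add_positive linorder_neqE_nat)
  then show ?thesis
  proof cases
    case 1
    have "ze t ^ m * cnj (ze t) ^ n = 1" for t using red(1)[of t 0] 1 by simp
    then have "(LINT t|lborel. of_real ((norm (om t))\<^sup>2) * (ze t ^ m * cnj (ze t) ^ n)) = (LINT t|lborel. complex_of_real ((norm (om t))\<^sup>2))"
      by simp
    also have "\<dots> = of_real (pi / 2)"
      unfolding integral_complex_of_real has_bochner_integral_integral_eq[OF om_integral] ..
    finally show ?thesis using 1 by simp
  next
    case 2
    then show ?thesis using ze_power_integral[of k] by (simp add: red)
  next
    case 3
    have "(LINT t|lborel. of_real ((norm (om t))\<^sup>2) * cnj (ze t) ^ k) = cnj (LINT t|lborel. of_real ((norm (om t))\<^sup>2) * ze t ^ k)"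
      using Bochner_Integration.integral_cnj[of lborel "\<lambda>t. of_real ((norm (om t))\<^sup>2) * ze t ^ k"] by simp
    then show ?thesis using 3 ze_power_integral[of k] by (simp add: red)
  qed
qed

definition exp_poly :: "nat \<Rightarrow> complex \<Rightarrow> complex" where
  "exp_poly N z = (\<Sum>n<N. z ^ n / fact n)"

lemma exp_poly_tendsto: "(\<lambda>N. exp_poly N z) \<longlonglongrightarrow> exp z"
  using summable_LIMSEQ[OF summable_exp[of z]] exp_converges[of z]
  by (simp add: exp_poly_def sums_def scaleR_conv_of_real divide_inverse mult.commute)

lemma norm_exp_poly: "norm (exp_poly N z) \<le> exp (norm z)"
proof -
  have "norm (exp_poly N z) \<le> (\<Sum>n<N. norm z ^ n / fact n)"
    unfolding exp_poly_def by (rule sum_norm_le) (simp add: norm_divide norm_power norm_fact)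
  also have "\<dots> \<le> exp (norm z)"
    using sum_le_suminf[OF sums_summable[OF exp_converges[of "norm z"]], of "{..<N}"] sums_unique[OF exp_converges[of "norm z"]]
    by (simp add: divide_inverse mult.commute)
  finally show ?thesis .
qed

text \<open>
  Expanding both exponentials, only the terms with equal powers of \<open>ze\<close> and \<open>cnj ze\<close> survive.
\<close>

lemma ze_exp_integral:
  fixes \<beta> \<beta>' :: real
  shows "integrable lborel (\<lambda>t. of_real ((norm (om t))\<^sup>2) * (exp (of_real \<beta> * ze t) * cnj (exp (of_real \<beta>' * ze t))))"
    and "(\<lambda>N. of_real (pi / 2) * (\<Sum>n<N. of_real ((\<beta> * \<beta>') ^ n / (fact n)\<^sup>2))) \<longlonglongrightarrow>
      (LINT t|lborel. of_real ((norm (om t))\<^sup>2) * (exp (of_real \<beta> * ze t) * cnj (exp (of_real \<beta>' * ze t))))"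
proof -
  let ?M = "exp \<bar>\<beta>\<bar> * exp \<bar>\<beta>'\<bar>"
  have b: "norm (exp_poly N (of_real \<beta> * ze t)) \<le> exp \<bar>\<beta>\<bar>" for N \<beta> t
    using norm_exp_poly[of N "of_real \<beta> * ze t"] by (simp add: norm_mult norm_ze)
  have be: "norm (exp (of_real \<beta> * ze t)) \<le> exp \<bar>\<beta>\<bar>" for \<beta> t
    using norm_exp[of "of_real \<beta> * ze t"] by (simp add: norm_mult norm_ze)
  show int: "integrable lborel (\<lambda>t. of_real ((norm (om t))\<^sup>2) * (exp (of_real \<beta> * ze t) * cnj (exp (of_real \<beta>' * ze t))))"
  proof (rule om_weight_integrable[of _ ?M])
    show "norm (exp (of_real \<beta> * ze t) * cnj (exp (of_real \<beta>' * ze t))) \<le> ?M" for t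
      unfolding norm_mult complex_mod_cnj by (intro mult_mono be) auto
  qed (intro continuous_intros)
  let ?s = "\<lambda>N t. of_real ((norm (om t))\<^sup>2) * (exp_poly N (of_real \<beta> * ze t) * cnj (exp_poly N (of_real \<beta>' * ze t)))"
  have cp: "continuous_on UNIV (\<lambda>t. exp_poly N (of_real \<beta> * ze t))" for N \<beta>
    unfolding exp_poly_def by (intro continuous_intros) auto
  have ints: "integrable lborel (?s N)" for N
  proof (rule om_weight_integrable[of _ ?M])
    show "norm (exp_poly N (of_real \<beta> * ze t) * cnj (exp_poly N (of_real \<beta>' * ze t))) \<le> ?M" for t
      unfolding norm_mult complex_mod_cnj by (intro mult_mono b) auto
  qed (intro continuous_intros cp)
  have "(\<lambda>N. LINT t|lborel. ?s N t) \<longlonglongrightarrow>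
      (LINT t|lborel. of_real ((norm (om t))\<^sup>2) * (exp (of_real \<beta> * ze t) * cnj (exp (of_real \<beta>' * ze t))))"
  proof (rule integral_dominated_convergence)
    show "integrable lborel (\<lambda>t. (norm (om t))\<^sup>2 * ?M)"
      using om_integral by (auto simp: has_bochner_integral_iff)
    show "AE t in lborel. (\<lambda>N. ?s N t) \<longlonglongrightarrow> of_real ((norm (om t))\<^sup>2) * (exp (of_real \<beta> * ze t) * cnj (exp (of_real \<beta>' * ze t)))"
      by (intro AE_I2 tendsto_intros exp_poly_tendsto)
    show "AE t in lborel. norm (?s N t) \<le> (norm (om t))\<^sup>2 * ?M" for N
    proof (rule AE_I2)
      fix t
      have "norm (?s N t) = (norm (om t))\<^sup>2 * (norm (exp_poly N (of_real \<beta> * ze t)) * norm (exp_poly N (of_real \<beta>' * ze t)))"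
        by (simp add: norm_mult norm_power)
      also have "\<dots> \<le> (norm (om t))\<^sup>2 * ?M" by (intro mult_left_mono mult_mono b) auto
      finally show "norm (?s N t) \<le> (norm (om t))\<^sup>2 * ?M" .
    qed
  qed (use int ints in \<open>auto dest: borel_measurable_integrable\<close>)
  moreover have eq: "(LINT t|lborel. ?s N t) = of_real (pi / 2) * (\<Sum>n<N. of_real ((\<beta> * \<beta>') ^ n / (fact n)\<^sup>2))" for N
  proof -
    have i: "integrable lborel (\<lambda>t. of_real ((norm (om t))\<^sup>2) * (ze t ^ m * cnj (ze t) ^ n))" for m n
      by (rule om_weight_integrable[of _ 1]) (auto simp: norm_mult norm_power norm_ze intro!: continuous_intros)
    let ?c = "\<lambda>m n. complex_of_real (\<beta> ^ m / fact m * (\<beta>' ^ n / fact n))"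
    have "?s N t = (\<Sum>m<N. \<Sum>n<N. ?c m n * (of_real ((norm (om t))\<^sup>2) * (ze t ^ m * cnj (ze t) ^ n)))" for t
    proof -
      have "exp_poly N (of_real \<beta> * ze t) * cnj (exp_poly N (of_real \<beta>' * ze t))
          = (\<Sum>m<N. \<Sum>n<N. ((of_real \<beta> * ze t) ^ m / fact m) * cnj ((of_real \<beta>' * ze t) ^ n / fact n))"
        by (simp add: exp_poly_def sum_product)
      also have "\<dots> = (\<Sum>m<N. \<Sum>n<N. ?c m n * (ze t ^ m * cnj (ze t) ^ n))"
        by (intro sum.cong refl) (simp add: power_mult_distrib)
      finally have e: "exp_poly N (of_real \<beta> * ze t) * cnj (exp_poly N (of_real \<beta>' * ze t)) = \<dots>" .
      show ?thesis unfolding e sum_distrib_left by (intro sum.cong refl) (simp only: mult.left_commute)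
    qed
    then have "(LINT t|lborel. ?s N t) = (\<Sum>m<N. \<Sum>n<N. ?c m n * (LINT t|lborel. of_real ((norm (om t))\<^sup>2) * (ze t ^ m * cnj (ze t) ^ n)))"
      by (simp only:)
         (intro has_bochner_integral_integral_eq has_bochner_integral_sum has_bochner_integral_mult_right
            has_bochner_integral_integrable i)
    also have "\<dots> = (\<Sum>m<N. \<Sum>n<N. if n = m then ?c m m * of_real (pi / 2) else 0)"
      unfolding ze_orthogonal by (intro sum.cong refl) auto
    also have "\<dots> = (\<Sum>m<N. ?c m m * of_real (pi / 2))" by (intro sum.cong refl) (simp add: sum.delta)
    also have "\<dots> = of_real (pi / 2) * (\<Sum>n<N. of_real ((\<beta> * \<beta>') ^ n / (fact n)\<^sup>2))"
      unfolding sum_distrib_left by (intro sum.cong refl) (simp add: power_mult_distrib power2_eq_square mult_ac)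
    finally show ?thesis .
  qed
  ultimately show "(\<lambda>N. of_real (pi / 2) * (\<Sum>n<N. of_real ((\<beta> * \<beta>') ^ n / (fact n)\<^sup>2))) \<longlonglongrightarrow>
      (LINT t|lborel. of_real ((norm (om t))\<^sup>2) * (exp (of_real \<beta> * ze t) * cnj (exp (of_real \<beta>' * ze t))))"
    by (simp only: eq)
qed

section \<open>Positive semidefinite kernels\<close>

definition psd_kernel :: "'j set \<Rightarrow> ('j \<Rightarrow> 'j \<Rightarrow> complex) \<Rightarrow> bool" where
  "psd_kernel J K \<longleftrightarrow> (\<forall>C. gram_form J C K \<in> \<real>\<^sub>\<ge>\<^sub>0)"

lemma psd_kernel_one: "psd_kernel J (\<lambda>_ _. 1)"
proof -
  have "gram_form J C (\<lambda>_ _. 1) = of_real ((norm (\<Sum>j\<in>J. C j))\<^sup>2)" for C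
    unfolding norm_sum_square gram_form_def by simp
  then show ?thesis by (simp add: psd_kernel_def del: of_real_power)
qed

lemma psd_kernel_rank_one: "psd_kernel J (\<lambda>i j. a i * cnj (a j) * K i j)" if "psd_kernel J K"
proof -
  have "gram_form J C (\<lambda>i j. a i * cnj (a j) * K i j) = gram_form J (\<lambda>j. C j * a j) K" for C
    unfolding gram_form_def by (intro sum.cong refl) (simp add: mult_ac)
  then show ?thesis using that by (simp add: psd_kernel_def)
qed

lemma gram_form_scale: "gram_form J C (\<lambda>i j. r * K i j) = r * gram_form J C K"
  unfolding gram_form_def sum_distrib_left by (intro sum.cong refl) (simp add: mult_ac)

lemma gram_form_sum: "gram_form J C (\<lambda>i j. \<Sum>n\<in>A. K n i j) = (\<Sum>n\<in>A. gram_form J C (K n))"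
  unfolding gram_form_def sum_distrib_left by (simp add: sum.swap[of _ _ A])

lemma gram_form_diff: "gram_form J C (\<lambda>i j. K i j - L i j) = gram_form J C K - gram_form J C L"
  unfolding gram_form_def by (simp add: right_diff_distrib sum_subtractf)

lemma gram_form_tendsto:
  "(\<lambda>n. gram_form J C (K n)) \<longlonglongrightarrow> gram_form J C L" if "\<And>i j. i \<in> J \<Longrightarrow> j \<in> J \<Longrightarrow> (\<lambda>n. K n i j) \<longlonglongrightarrow> L i j"
  unfolding gram_form_def by (intro tendsto_sum tendsto_mult_left that)

lemma psd_kernel_scale: "psd_kernel J (\<lambda>i j. of_real r * K i j)" if "psd_kernel J K" "0 \<le> r"
  using that by (simp add: psd_kernel_def gram_form_scale nonneg_Reals_mult_I)

lemma psd_kernel_sum: "psd_kernel J (\<lambda>i j. \<Sum>n\<in>A. K n i j)" if "\<And>n. n \<in> A \<Longrightarrow> psd_kernel J (K n)"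
proof -
  have "(\<Sum>n\<in>A. gram_form J C (K n)) \<in> \<real>\<^sub>\<ge>\<^sub>0" for C
    using that by (induction A rule: infinite_finite_induct) (auto simp: psd_kernel_def intro: nonneg_Reals_add_I)
  then show ?thesis by (simp add: psd_kernel_def gram_form_sum)
qed

lemma psd_kernel_limit:
  assumes "\<And>n. psd_kernel J (K n)" "\<And>i j. i \<in> J \<Longrightarrow> j \<in> J \<Longrightarrow> (\<lambda>n. K n i j) \<longlonglongrightarrow> L i j"
  shows "psd_kernel J L"
  unfolding psd_kernel_def
proof
  fix C
  show "gram_form J C L \<in> \<real>\<^sub>\<ge>\<^sub>0"
    by (rule Lim_in_closed_set[OF closed_nonneg_Reals_complex _ _ gram_form_tendsto[OF assms(2)]])
       (use assms(1) in \<open>auto simp: psd_kernel_def\<close>)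
qed

text \<open>
  The exponential series of the rank one kernel \<open>a\<^sub>i cnj a\<^sub>j\<close> consists of positive rank one kernels.
\<close>

lemma psd_kernel_exp: "psd_kernel J (\<lambda>i j. exp (a i * cnj (a j) / 4) * K i j)" if K: "psd_kernel J K"
proof (rule psd_kernel_limit)
  show "psd_kernel J (\<lambda>i j. \<Sum>n<N. of_real (1 / (4 ^ n * fact n)) * (a i ^ n * cnj (a j ^ n) * K i j))" for N
    by (intro psd_kernel_sum psd_kernel_scale psd_kernel_rank_one[where a = "\<lambda>i. a i ^ n" for n] K) simp
  show "(\<lambda>N. \<Sum>n<N. of_real (1 / (4 ^ n * fact n)) * (a i ^ n * cnj (a j ^ n) * K i j)) \<longlonglongrightarrow> exp (a i * cnj (a j) / 4) * K i j" for i j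
  proof -
    have "(\<Sum>n<N. of_real (1 / (4 ^ n * fact n)) * (a i ^ n * cnj (a j ^ n) * K i j)) = exp_poly N (a i * cnj (a j) / 4) * K i j" for N
      unfolding exp_poly_def sum_distrib_right
      by (intro sum.cong refl) (simp add: power_divide power_mult_distrib)
    then show ?thesis by (simp add: tendsto_mult exp_poly_tendsto)
  qed
qed

definition gauss_kernel :: "('j \<Rightarrow> complex) \<Rightarrow> 'j \<Rightarrow> 'j \<Rightarrow> complex" where
  "gauss_kernel a i j = of_real (exp (- ((norm (a i - a j))\<^sup>2 / 4)))"

lemma gauss_kernel_expand:
  "gauss_kernel a i j = of_real (exp (- ((norm (a i))\<^sup>2 / 4))) * cnj (of_real (exp (- ((norm (a j))\<^sup>2 / 4)))) *
     (exp (a i * cnj (a j) / 4) * (exp (cnj (a i) * cnj (cnj (a j)) / 4) * 1))"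
proof -
  have "complex_of_real (- ((norm (a i - a j))\<^sup>2 / 4)) = of_real (- ((norm (a i))\<^sup>2 / 4)) + of_real (- ((norm (a j))\<^sup>2 / 4))
      + a i * cnj (a j) / 4 + cnj (a i) * a j / 4"
    unfolding of_real_minus of_real_divide complex_norm_square by (simp add: field_simps)
  then have "exp (complex_of_real (- ((norm (a i - a j))\<^sup>2 / 4))) = exp (of_real (- ((norm (a i))\<^sup>2 / 4))) * exp (of_real (- ((norm (a j))\<^sup>2 / 4)))
      * exp (a i * cnj (a j) / 4) * exp (cnj (a i) * a j / 4)"
    by (simp only: exp_add)
  then show ?thesis unfolding gauss_kernel_def exp_of_real by (simp only: complex_cnj_complex_of_real complex_cnj_cnj mult_1_right mult.assoc)
qed

text \<open>
  By polarisation a Gaussian kernel is a rank one kernel times two exponentials of rank one kernels, one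
  in \<open>a\<close> and one in its conjugate.
\<close>

lemma psd_gauss_kernel: "psd_kernel J (\<lambda>i j. gauss_kernel a i j * K i j)" if K: "psd_kernel J K"
proof -
  have "psd_kernel J (\<lambda>i j. of_real (exp (- ((norm (a i))\<^sup>2 / 4))) * cnj (of_real (exp (- ((norm (a j))\<^sup>2 / 4)))) *
     (exp (a i * cnj (a j) / 4) * (exp (cnj (a i) * cnj (cnj (a j)) / 4) * K i j)))"
    by (intro psd_kernel_rank_one[where a = "\<lambda>i. of_real (exp (- ((norm (a i))\<^sup>2 / 4)))"]
      psd_kernel_exp[where a = a] psd_kernel_exp[where a = "\<lambda>i. cnj (a i)"] K)
  then show ?thesis unfolding gauss_kernel_expand by (simp only: mult.assoc mult_1_left)
qed

text \<open>
  In the double power series of \<open>exp (b\<^sub>i cnj b\<^sub>j / 4) exp (cnj b\<^sub>i b\<^sub>j / 4)\<close> every term is a positive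
  rank one kernel; \<open>diag_series\<close> collects the diagonal terms, so removing it leaves a positive
  kernel.
\<close>

definition diag_series :: "nat \<Rightarrow> complex \<Rightarrow> complex \<Rightarrow> complex" where
  "diag_series N b b' = (\<Sum>n<N. of_real (((norm b)\<^sup>2 / 4 * ((norm b')\<^sup>2 / 4)) ^ n / (fact n)\<^sup>2))"

lemma psd_kernel_off_diagonal:
  assumes K: "psd_kernel J K" and D: "\<And>i j. i \<in> J \<Longrightarrow> j \<in> J \<Longrightarrow> (\<lambda>N. diag_series N (b i) (b j)) \<longlonglongrightarrow> D i j"
  shows "psd_kernel J (\<lambda>i j. (exp (b i * cnj (b j) / 4) * exp (cnj (b i) * b j / 4) - D i j) * K i j)"
proof (rule psd_kernel_limit)
  let ?A = "\<lambda>N. {(m, n). m < N \<and> n < N \<and> m \<noteq> (n::nat)}"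
  let ?T = "\<lambda>m n i j. of_real (1 / (4 ^ m * fact m * (4 ^ n * fact n))) * ((b i ^ m * cnj (b i) ^ n) * cnj (b j ^ m * cnj (b j) ^ n) * K i j)"
  show "psd_kernel J (\<lambda>i j. \<Sum>p\<in>?A N. ?T (fst p) (snd p) i j)" for N
    by (intro psd_kernel_sum psd_kernel_scale psd_kernel_rank_one[where a = "\<lambda>i. b i ^ m * cnj (b i) ^ n" for m n] K) simp
  fix i j assume ij: "i \<in> J" "j \<in> J"
  let ?z = "b i * cnj (b j) / 4" and ?z' = "cnj (b i) * b j / 4"
  have "(\<Sum>p\<in>?A N. ?T (fst p) (snd p) i j) = (exp_poly N ?z * exp_poly N ?z' - diag_series N (b i) (b j)) * K i j" for N
  proof -
    have T: "?T m n i j = (?z ^ m / fact m) * (?z' ^ n / fact n) * K i j" for m n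
      by (simp add: power_divide power_mult_distrib mult_ac)
    have all: "(\<Sum>p\<in>{..<N} \<times> {..<N}. ?T (fst p) (snd p) i j) = exp_poly N ?z * exp_poly N ?z' * K i j"
    proof -
      have p: "exp_poly N ?z * exp_poly N ?z'
          = (\<Sum>p\<in>{..<N} \<times> {..<N}. (?z ^ fst p / fact (fst p)) * (?z' ^ snd p / fact (snd p)))"
        unfolding exp_poly_def sum_product sum.cartesian_product by (simp only: split_def)
      show ?thesis unfolding T p sum_distrib_right ..
    qed
    have diag: "(\<Sum>p\<in>(\<lambda>n. (n, n)) ` {..<N}. ?T (fst p) (snd p) i j) = diag_series N (b i) (b j) * K i j"
    proof -
      have dg: "(?z ^ n / fact n) * (?z' ^ n / fact n) = of_real (((norm (b i))\<^sup>2 / 4 * ((norm (b j))\<^sup>2 / 4)) ^ n / (fact n)\<^sup>2)" for n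
      proof -
        have "(?z ^ n / fact n) * (?z' ^ n / fact n) = (?z * ?z') ^ n / (fact n)\<^sup>2"
          unfolding power_mult_distrib[of ?z ?z'] power2_eq_square[of "fact n"] by (rule times_divide_times_eq)
        also have "?z * ?z' = of_real ((norm (b i))\<^sup>2 / 4 * ((norm (b j))\<^sup>2 / 4))"
          unfolding of_real_mult of_real_divide complex_norm_square by simp
        finally show ?thesis by simp
      qed
      have "(\<Sum>p\<in>(\<lambda>n. (n, n)) ` {..<N}. ?T (fst p) (snd p) i j)
          = (\<Sum>n<N. (?z ^ n / fact n) * (?z' ^ n / fact n) * K i j)"
        unfolding T by (subst sum.reindex) (simp_all add: inj_on_def)
      then show ?thesis unfolding diag_series_def sum_distrib_right dg .
    qed
    have "{..<N} \<times> {..<N} = ?A N \<union> (\<lambda>n. (n, n)) ` {..<N}" by auto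
    moreover have "finite (?A N)" by (rule finite_subset[of _ "{..<N} \<times> {..<N}"]) auto
    ultimately have "(\<Sum>p\<in>{..<N} \<times> {..<N}. ?T (fst p) (snd p) i j)
        = (\<Sum>p\<in>?A N. ?T (fst p) (snd p) i j) + (\<Sum>p\<in>(\<lambda>n. (n, n)) ` {..<N}. ?T (fst p) (snd p) i j)"
      by (simp only:) (rule sum.union_disjoint, auto)
    then show ?thesis unfolding all diag by (simp add: left_diff_distrib)
  qed
  then show "(\<lambda>N. \<Sum>p\<in>?A N. ?T (fst p) (snd p) i j) \<longlonglongrightarrow> (exp ?z * exp ?z' - D i j) * K i j"
    by (simp only:) (intro tendsto_mult tendsto_diff tendsto_const exp_poly_tendsto D ij)
qed

section \<open>The sharp trace inequality\<close>

text \<open>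
  This is the square integral, over time and over the subspace, of the restriction of a free wave to a
  subspace of codimension two, \<open>b\<close> being the frequency transverse to the subspace and \<open>a\<close> the one along
  it, bounded by the square norm of the initial datum. The kernels on the two sides of the inequality
  are \<open>exp (-(\<bar>b\<^sub>i\<bar>\<^sup>2 + \<bar>b\<^sub>j\<bar>\<^sup>2)/4)\<close> times the diagonal part of a positive double series and times the
  whole series.
\<close>

theorem trace_inequality:
  fixes a b C :: "'j \<Rightarrow> complex"
  assumes J: "finite J"
  defines "e \<equiv> \<lambda>t i. exp (- ((1 - ze t) * of_real ((norm (b i))\<^sup>2 / 4)))"
  defines "H \<equiv> \<lambda>t. gram_form J C (\<lambda>i j. gauss_kernel a i j * e t i * cnj (e t j))"
  shows "integrable lborel (\<lambda>t. (norm (om t))\<^sup>2 * Re (H t))"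
    and "(LINT t|lborel. (norm (om t))\<^sup>2 * Re (H t))
       \<le> pi / 2 * Re (gram_form J C (\<lambda>i j. gauss_kernel a i j * gauss_kernel b i j))"
proof -
  define \<beta> where "\<beta> i = (norm (b i))\<^sup>2 / 4" for i
  define E where "E i = complex_of_real (exp (- \<beta> i))" for i
  let ?g = "\<lambda>i j t. of_real ((norm (om t))\<^sup>2) * (exp (of_real (\<beta> i) * ze t) * cnj (exp (of_real (\<beta> j) * ze t)))"
  have e: "e t i = E i * exp (of_real (\<beta> i) * ze t)" for t i
  proof -
    have "- ((1 - ze t) * of_real (\<beta> i)) = of_real (- \<beta> i) + of_real (\<beta> i) * ze t" by (simp add: algebra_simps)
    then show ?thesis unfolding e_def E_def \<beta>_def[symmetric] by (simp only: exp_add exp_of_real)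
  qed
  have weighted: "of_real ((norm (om t))\<^sup>2) * H t = gram_form J C (\<lambda>i j. E i * cnj (E j) * (gauss_kernel a i j * ?g i j t))" for t
    unfolding H_def e gram_form_def sum_distrib_left
    by (intro sum.cong refl) (simp only: mult_ac complex_cnj_mult)
  define D where "D i j = (LINT t|lborel. ?g i j t) / of_real (pi / 2)" for i j
  have int: "integrable lborel (?g i j)" for i j by (rule ze_exp_integral(1))
  have Dlim: "(\<lambda>N. diag_series N (b i) (b j)) \<longlonglongrightarrow> D i j" for i j
  proof -
    have "(\<lambda>N. of_real (pi / 2) * (\<Sum>n<N. of_real ((\<beta> i * \<beta> j) ^ n / (fact n)\<^sup>2)) / of_real (pi / 2)) \<longlonglongrightarrow> D i j"
      unfolding D_def by (intro tendsto_divide ze_exp_integral(2) tendsto_const) simp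
    then show ?thesis by (simp add: diag_series_def \<beta>_def)
  qed
  have intH: "integrable lborel (\<lambda>t. of_real ((norm (om t))\<^sup>2) * H t)"
    unfolding weighted gram_form_def by (intro Bochner_Integration.integrable_sum integrable_mult_right int)
  have "(LINT t|lborel. of_real ((norm (om t))\<^sup>2) * H t)
      = gram_form J C (\<lambda>i j. E i * cnj (E j) * (gauss_kernel a i j * (LINT t|lborel. ?g i j t)))"
    unfolding weighted gram_form_def
    by (intro has_bochner_integral_integral_eq has_bochner_integral_sum has_bochner_integral_mult_right
          has_bochner_integral_integrable int)
  also have "\<dots> = of_real (pi / 2) * gram_form J C (\<lambda>i j. E i * cnj (E j) * (gauss_kernel a i j * D i j))"
    unfolding D_def gram_form_def sum_distrib_left by (intro sum.cong refl) simp
  finally have I: "(LINT t|lborel. of_real ((norm (om t))\<^sup>2) * H t)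
      = of_real (pi / 2) * gram_form J C (\<lambda>i j. E i * cnj (E j) * (gauss_kernel a i j * D i j))" .
  have "psd_kernel J (\<lambda>i j. E i * cnj (E j) * ((exp (b i * cnj (b j) / 4) * exp (cnj (b i) * b j / 4) - D i j) * (gauss_kernel a i j * 1)))"
    by (intro psd_kernel_rank_one psd_kernel_off_diagonal psd_gauss_kernel psd_kernel_one Dlim)
  moreover have "E i * cnj (E j) * ((exp (b i * cnj (b j) / 4) * exp (cnj (b i) * b j / 4) - D i j) * (gauss_kernel a i j * 1))
      = gauss_kernel a i j * gauss_kernel b i j - E i * cnj (E j) * (gauss_kernel a i j * D i j)" for i j
    unfolding gauss_kernel_expand[of b] E_def \<beta>_def by (simp add: algebra_simps)
  ultimately have "gram_form J C (\<lambda>i j. gauss_kernel a i j * gauss_kernel b i j)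
      - gram_form J C (\<lambda>i j. E i * cnj (E j) * (gauss_kernel a i j * D i j)) \<in> \<real>\<^sub>\<ge>\<^sub>0"
    by (simp add: psd_kernel_def gram_form_diff)
  then have le: "Re (gram_form J C (\<lambda>i j. E i * cnj (E j) * (gauss_kernel a i j * D i j)))
      \<le> Re (gram_form J C (\<lambda>i j. gauss_kernel a i j * gauss_kernel b i j))"
    by (simp add: complex_nonneg_Reals_iff)
  have Re: "(norm (om t))\<^sup>2 * Re (H t) = Re (of_real ((norm (om t))\<^sup>2) * H t)" for t
    by (simp only: times_complex.sel Re_complex_of_real Im_complex_of_real mult_zero_left diff_0_right)
  show "integrable lborel (\<lambda>t. (norm (om t))\<^sup>2 * Re (H t))"
    unfolding Re by (rule integrable_Re[OF intH])
  have "(LINT t|lborel. (norm (om t))\<^sup>2 * Re (H t)) = Re (LINT t|lborel. of_real ((norm (om t))\<^sup>2) * H t)"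
    unfolding Re by (rule integral_Re[OF intH])
  also have "\<dots> = pi / 2 * Re (gram_form J C (\<lambda>i j. E i * cnj (E j) * (gauss_kernel a i j * D i j)))"
    unfolding I by (simp only: times_complex.sel Re_complex_of_real Im_complex_of_real mult_zero_left diff_0_right)
  also have "\<dots> \<le> pi / 2 * Re (gram_form J C (\<lambda>i j. gauss_kernel a i j * gauss_kernel b i j))"
    by (intro mult_left_mono le) simp
  finally show "(LINT t|lborel. (norm (om t))\<^sup>2 * Re (H t))
       \<le> pi / 2 * Re (gram_form J C (\<lambda>i j. gauss_kernel a i j * gauss_kernel b i j))" .
qed

section \<open>The Strichartz inequality for packet sums\<close>

lemma gram_form_product:
  "gram_form (I \<times> J) (\<lambda>p. C (fst p) * C' (snd p)) (\<lambda>p q. K (fst p) (fst q) * K' (snd p) (snd q))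
    = gram_form I C K * gram_form J C' K'"
proof -
  have "gram_form I C K * gram_form J C' K'
      = (\<Sum>i\<in>I. \<Sum>i'\<in>J. \<Sum>j\<in>I. \<Sum>j'\<in>J. (C i * cnj (C j) * K i j) * (C' i' * cnj (C' j') * K' i' j'))"
    unfolding gram_form_def sum_product ..
  also have "\<dots> = (\<Sum>i\<in>I. \<Sum>i'\<in>J. \<Sum>j\<in>I. \<Sum>j'\<in>J. C i * C' i' * cnj (C j * C' j') * (K i j * K' i' j'))"
    by (intro sum.cong refl) (simp add: mult_ac)
  also have "\<dots> = gram_form (I \<times> J) (\<lambda>p. C (fst p) * C' (snd p)) (\<lambda>p q. K (fst p) (fst q) * K' (snd p) (snd q))"
    unfolding gram_form_def sum.cartesian_product' by simp
  finally show ?thesis ..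
qed

lemma of_real_exp_minus_add:
  "complex_of_real (exp (- (r + s))) = of_real (exp (- r)) * of_real (exp (- s))"
  unfolding of_real_mult[symmetric] exp_add[symmetric] by simp

definition free_kernel :: "('j \<Rightarrow> 'a::euclidean_space) \<Rightarrow> 'j \<Rightarrow> 'j \<Rightarrow> complex" where
  "free_kernel S i j = of_real (exp (- ((norm (S i - S j))\<^sup>2 / 4)))"

text \<open>
  The Gram form of the frequencies is the \<open>L\<^sup>2\<close> norm up to a constant, so its powers, which are the forms
  with product kernels, are powers of the norm.
\<close>

lemma free_gram_eq:
  fixes l :: "(complex \<times> 'a::euclidean_space) list"
  shows "gram_form {..<length l} (\<lambda>j. fst (l ! j)) (free_kernel (\<lambda>j. snd (l ! j)))
     = of_real ((l2norm (packet_sum l))\<^sup>2 / sqrt pi ^ DIM('a))"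
proof -
  let ?G = "gram_form {..<length l} (\<lambda>j. fst (l ! j)) (free_kernel (\<lambda>j. snd (l ! j)))"
  have "?G = of_real (Re ?G)"
    using packet_power_integral(2)[where k = 1 and J = "{..<length l}" and \<beta> = "\<lambda>_. 0" and t = 0
        and \<sigma> = "\<lambda>j. (norm (snd (l ! j)))\<^sup>2" and S = "\<lambda>j. snd (l ! j)" and C = "\<lambda>j. fst (l ! j)"]
    by (simp add: free_kernel_def[abs_def])
  moreover have "(l2norm (packet_sum l))\<^sup>2 = sqrt pi ^ DIM('a) * Re ?G"
    using packet_flow_norm(2)[of l 0] by (simp add: packet_flow_0[abs_def] free_kernel_def[abs_def])
  ultimately show ?thesis by (metis nonzero_mult_div_cancel_left pi_gt_zero power_not_zero real_sqrt_eq_0_iff less_irrefl)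
qed

text \<open>The kernels of the square and of the cube of a packet sum, as functions of time.\<close>

definition pair_form :: "(complex \<times> 'a::euclidean_space) list \<Rightarrow> real \<Rightarrow> complex" where
  "pair_form l t = gram_form ({..<length l} \<times> {..<length l}) (\<lambda>p. fst (l ! fst p) * fst (l ! snd p))
     (\<lambda>p q. of_real (exp (- ((norm (snd (l ! fst p) + snd (l ! snd p) - (snd (l ! fst q) + snd (l ! snd q))))\<^sup>2 / (4 * 2))))
        * exp (- ((1 - ze t) * of_real ((norm (snd (l ! fst p) - snd (l ! snd p)))\<^sup>2 / 2 / 4)))
        * cnj (exp (- ((1 - ze t) * of_real ((norm (snd (l ! fst q) - snd (l ! snd q)))\<^sup>2 / 2 / 4)))))"

lemma packet_flow_fourth_power:
  fixes l :: "(complex \<times> 'a::euclidean_space) list"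
  shows "has_bochner_integral lborel (\<lambda>x. norm (packet_flow l t x) ^ 4)
      (norm (om t) ^ (2 * DIM('a)) * (sqrt (pi / (2 * (norm (om t))\<^sup>2)) ^ DIM('a) * Re (pair_form l t)))"
    and "pair_form l t = of_real (Re (pair_form l t))"
proof -
  let ?J = "{..<length l} \<times> {..<length l}"
  let ?S = "\<lambda>p. snd (l ! fst p) + snd (l ! snd p)"
  let ?\<sigma> = "\<lambda>p. (norm (snd (l ! fst p)))\<^sup>2 + (norm (snd (l ! snd p)))\<^sup>2"
  let ?\<beta> = "\<lambda>p. (norm (snd (l ! fst p) - snd (l ! snd p)))\<^sup>2 / 2"
  let ?C = "\<lambda>p. fst (l ! fst p) * fst (l ! snd p)"
  let ?U = "\<lambda>x. \<Sum>p\<in>?J. ?C p * exp (om t * (- of_real (2 * (norm x)\<^sup>2 / 2) + \<i> * of_real (?S p \<bullet> x) - \<i> * of_real t * of_real (?\<sigma> p)))"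
  have \<beta>: "?\<sigma> p = (norm (?S p))\<^sup>2 / 2 + ?\<beta> p" for p
    by (simp add: power2_norm_eq_inner inner_add_left inner_add_right inner_diff_left inner_diff_right inner_commute field_simps)
  have fin: "finite ?J" by simp
  note int = packet_power_integral[where k = 2 and J = ?J and C = ?C and S = ?S and \<sigma> = ?\<sigma> and \<beta> = ?\<beta> and t = t, OF zero_less_numeral fin \<beta>]
  show "pair_form l t = of_real (Re (pair_form l t))"
    using int(2) unfolding pair_form_def by simp
  have "(packet_flow l t x)\<^sup>2 = csqrt (om t) ^ (2 * DIM('a)) * ?U x" for x
  proof -
    let ?E = "\<lambda>j. om t * (- of_real ((norm x)\<^sup>2) / 2 + \<i> * of_real (snd (l ! j) \<bullet> x) - \<i> * of_real t * of_real ((norm (snd (l ! j)))\<^sup>2))"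
    have "(\<Sum>j<length l. fst (l ! j) * exp (?E j))\<^sup>2 = (\<Sum>p\<in>?J. (fst (l ! fst p) * exp (?E (fst p))) * (fst (l ! snd p) * exp (?E (snd p))))"
      unfolding power2_eq_square sum_product sum.cartesian_product by (simp only: split_def)
    also have "\<dots> = ?U x"
    proof (intro sum.cong refl)
      fix p
      have "?E (fst p) + ?E (snd p) = om t * (- of_real (2 * (norm x)\<^sup>2 / 2) + \<i> * of_real (?S p \<bullet> x) - \<i> * of_real t * of_real (?\<sigma> p))"
        by (simp add: inner_add_left algebra_simps)
      then show "(fst (l ! fst p) * exp (?E (fst p))) * (fst (l ! snd p) * exp (?E (snd p)))
         = ?C p * exp (om t * (- of_real (2 * (norm x)\<^sup>2 / 2) + \<i> * of_real (?S p \<bullet> x) - \<i> * of_real t * of_real (?\<sigma> p)))"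
        by (simp only: exp_add[symmetric] mult_ac)
    qed
    finally show ?thesis unfolding packet_flow_nth power_mult_distrib
      by (simp only: power_mult[symmetric] mult.commute[of 2])
  qed
  then have "norm (packet_flow l t x) ^ 4 = norm (om t) ^ (2 * DIM('a)) * (norm (?U x))\<^sup>2" for x
  proof -
    have "norm (packet_flow l t x) ^ 4 = (norm ((packet_flow l t x)\<^sup>2))\<^sup>2" by (simp add: norm_power flip: power_mult)
    also have "\<dots> = (norm (csqrt (om t)) ^ (2 * DIM('a)))\<^sup>2 * (norm (?U x))\<^sup>2"
      unfolding \<open>(packet_flow l t x)\<^sup>2 = csqrt (om t) ^ (2 * DIM('a)) * ?U x\<close> norm_mult norm_power power_mult_distrib ..
    also have "(norm (csqrt (om t)) ^ (2 * DIM('a)))\<^sup>2 = norm (om t) ^ (2 * DIM('a))"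
      unfolding norm_csqrt power_mult[symmetric] mult.commute[of "2 * DIM('a)" 2]
      by (simp only: power_mult[of "sqrt (norm (om t))" 2 "2 * DIM('a)"] real_sqrt_pow2 norm_ge_zero)
    finally show ?thesis .
  qed
  then show "has_bochner_integral lborel (\<lambda>x. norm (packet_flow l t x) ^ 4)
      (norm (om t) ^ (2 * DIM('a)) * (sqrt (pi / (2 * (norm (om t))\<^sup>2)) ^ DIM('a) * Re (pair_form l t)))"
    using has_bochner_integral_mult_right[OF int(1), of "norm (om t) ^ (2 * DIM('a))"]
    unfolding pair_form_def by simp
qed

definition triple_form :: "(complex \<times> 'a::euclidean_space) list \<Rightarrow> real \<Rightarrow> complex" where
  "triple_form l t = gram_form ({..<length l} \<times> {..<length l} \<times> {..<length l}) (\<lambda>p. fst (l ! fst p) * (fst (l ! fst (snd p)) * fst (l ! snd (snd p))))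
     (\<lambda>p q. of_real (exp (- ((norm (snd (l ! fst p) + snd (l ! fst (snd p)) + snd (l ! snd (snd p))
              - (snd (l ! fst q) + snd (l ! fst (snd q)) + snd (l ! snd (snd q)))))\<^sup>2 / (4 * 3))))
        * exp (- ((1 - ze t) * of_real (((norm (snd (l ! fst p)))\<^sup>2 + (norm (snd (l ! fst (snd p))))\<^sup>2 + (norm (snd (l ! snd (snd p))))\<^sup>2
            - (norm (snd (l ! fst p) + snd (l ! fst (snd p)) + snd (l ! snd (snd p))))\<^sup>2 / 3) / 4)))
        * cnj (exp (- ((1 - ze t) * of_real (((norm (snd (l ! fst q)))\<^sup>2 + (norm (snd (l ! fst (snd q))))\<^sup>2 + (norm (snd (l ! snd (snd q))))\<^sup>2
            - (norm (snd (l ! fst q) + snd (l ! fst (snd q)) + snd (l ! snd (snd q))))\<^sup>2 / 3) / 4)))))"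

lemma packet_flow_sixth_power:
  fixes l :: "(complex \<times> 'a::euclidean_space) list"
  shows "has_bochner_integral lborel (\<lambda>x. norm (packet_flow l t x) ^ 6)
      (norm (om t) ^ (3 * DIM('a)) * (sqrt (pi / (3 * (norm (om t))\<^sup>2)) ^ DIM('a) * Re (triple_form l t)))"
proof -
  let ?J = "{..<length l} \<times> {..<length l} \<times> {..<length l}"
  let ?S = "\<lambda>p. snd (l ! fst p) + snd (l ! fst (snd p)) + snd (l ! snd (snd p))"
  let ?\<sigma> = "\<lambda>p. (norm (snd (l ! fst p)))\<^sup>2 + (norm (snd (l ! fst (snd p))))\<^sup>2 + (norm (snd (l ! snd (snd p))))\<^sup>2"
  let ?\<beta> = "\<lambda>p. ?\<sigma> p - (norm (?S p))\<^sup>2 / 3"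
  let ?C = "\<lambda>p. fst (l ! fst p) * (fst (l ! fst (snd p)) * fst (l ! snd (snd p)))"
  let ?U = "\<lambda>x. \<Sum>p\<in>?J. ?C p * exp (om t * (- of_real (3 * (norm x)\<^sup>2 / 2) + \<i> * of_real (?S p \<bullet> x) - \<i> * of_real t * of_real (?\<sigma> p)))"
  have \<beta>: "?\<sigma> p = (norm (?S p))\<^sup>2 / 3 + ?\<beta> p" for p by simp
  have fin: "finite ?J" by simp
  note int = packet_power_integral[where k = 3 and J = ?J and C = ?C and S = ?S and \<sigma> = ?\<sigma> and \<beta> = ?\<beta> and t = t, OF zero_less_numeral fin \<beta>]
  have "(packet_flow l t x) ^ 3 = csqrt (om t) ^ (3 * DIM('a)) * ?U x" for x
  proof -
    let ?E = "\<lambda>j. om t * (- of_real ((norm x)\<^sup>2) / 2 + \<i> * of_real (snd (l ! j) \<bullet> x) - \<i> * of_real t * of_real ((norm (snd (l ! j)))\<^sup>2))"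
    have "(\<Sum>j<length l. fst (l ! j) * exp (?E j)) ^ 3
       = (\<Sum>p\<in>?J. (fst (l ! fst p) * exp (?E (fst p))) * ((fst (l ! fst (snd p)) * exp (?E (fst (snd p)))) * (fst (l ! snd (snd p)) * exp (?E (snd (snd p))))))"
    proof -
      have cube: "z ^ 3 = z * (z * z)" for z :: complex by (simp add: power3_eq_cube)
      have "(\<Sum>j<length l. fst (l ! j) * exp (?E j)) * (\<Sum>j<length l. fst (l ! j) * exp (?E j))
        = (\<Sum>p\<in>{..<length l} \<times> {..<length l}. (fst (l ! fst p) * exp (?E (fst p))) * (fst (l ! snd p) * exp (?E (snd p))))"
        unfolding sum_product sum.cartesian_product by (simp only: split_def)
      then show ?thesis unfolding cube by (simp only: sum_product sum.cartesian_product) (simp only: split_def)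
    qed
    also have "\<dots> = ?U x"
    proof (intro sum.cong refl)
      fix p
      have "?E (fst p) + (?E (fst (snd p)) + ?E (snd (snd p)))
          = om t * (- of_real (3 * (norm x)\<^sup>2 / 2) + \<i> * of_real (?S p \<bullet> x) - \<i> * of_real t * of_real (?\<sigma> p))"
        by (simp add: inner_add_left field_simps)
      from arg_cong[OF this, of exp]
      have "exp (?E (fst p)) * (exp (?E (fst (snd p))) * exp (?E (snd (snd p))))
          = exp (om t * (- of_real (3 * (norm x)\<^sup>2 / 2) + \<i> * of_real (?S p \<bullet> x) - \<i> * of_real t * of_real (?\<sigma> p)))"
        by (simp only: exp_add)
      then show "(fst (l ! fst p) * exp (?E (fst p))) * ((fst (l ! fst (snd p)) * exp (?E (fst (snd p)))) * (fst (l ! snd (snd p)) * exp (?E (snd (snd p)))))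
         = ?C p * exp (om t * (- of_real (3 * (norm x)\<^sup>2 / 2) + \<i> * of_real (?S p \<bullet> x) - \<i> * of_real t * of_real (?\<sigma> p)))"
        by (simp only: mult_ac)
    qed
    finally show ?thesis unfolding packet_flow_nth power_mult_distrib
      by (simp only: power_mult[symmetric] mult.commute[of 3])
  qed
  then have "norm (packet_flow l t x) ^ 6 = norm (om t) ^ (3 * DIM('a)) * (norm (?U x))\<^sup>2" for x
  proof -
    have "norm (packet_flow l t x) ^ 6 = (norm ((packet_flow l t x) ^ 3))\<^sup>2" by (simp add: norm_power flip: power_mult)
    also have "\<dots> = (norm (csqrt (om t)) ^ (3 * DIM('a)))\<^sup>2 * (norm (?U x))\<^sup>2"
      unfolding \<open>(packet_flow l t x) ^ 3 = csqrt (om t) ^ (3 * DIM('a)) * ?U x\<close> norm_mult norm_power power_mult_distrib ..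
    also have "(norm (csqrt (om t)) ^ (3 * DIM('a)))\<^sup>2 = norm (om t) ^ (3 * DIM('a))"
      unfolding norm_csqrt power_mult[symmetric] mult.commute[of "3 * DIM('a)" 2]
      by (simp only: power_mult[of "sqrt (norm (om t))" 2 "3 * DIM('a)"] real_sqrt_pow2 norm_ge_zero)
    finally show ?thesis .
  qed
  then show "has_bochner_integral lborel (\<lambda>x. norm (packet_flow l t x) ^ 6)
      (norm (om t) ^ (3 * DIM('a)) * (sqrt (pi / (3 * (norm (om t))\<^sup>2)) ^ DIM('a) * Re (triple_form l t)))"
    using has_bochner_integral_mult_right[OF int(1), of "norm (om t) ^ (3 * DIM('a))"]
    unfolding triple_form_def by simp
qed

text \<open>The plane \<open>\<real>\<^sup>2\<close> as \<open>\<complex>\<close>: here the sums and the differences of two frequencies are the \<open>a\<close> and \<open>b\<close> of the trace inequality.\<close>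

lemma strichartz_4_4_2:
  fixes l :: "(complex \<times> 'a::euclidean_space) list"
  assumes d: "DIM('a) = 2"
  shows "integrable lborel (\<lambda>t. LINT x|lborel. norm (packet_flow l t x) ^ 4)"
    and "(LINT t|lborel. LINT x|lborel. norm (packet_flow l t x) ^ 4) \<le> l2norm (packet_sum l) ^ 4 / 4"
proof -
  obtain e1 e2 :: 'a where e: "Basis = {e1, e2}" "e1 \<noteq> e2"
    using d by (auto simp: card_2_iff)
  define \<iota> where "\<iota> x = Complex (x \<bullet> e1) (x \<bullet> e2)" for x :: 'a
  have \<iota>: "\<iota> (x + y) = \<iota> x + \<iota> y" "\<iota> (x - y) = \<iota> x - \<iota> y" for x y
    by (simp_all add: \<iota>_def inner_add_left inner_diff_left complex_eq_iff)
  have n\<iota>: "(norm (\<iota> x))\<^sup>2 = (norm x)\<^sup>2" for x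
  proof -
    have "(norm x)\<^sup>2 = (x \<bullet> e1)\<^sup>2 + (x \<bullet> e2)\<^sup>2"
      unfolding norm_square_Basis e(1) using e(2) by simp
    then show ?thesis by (simp add: \<iota>_def cmod_power2)
  qed
  let ?J = "{..<length l} \<times> {..<length l}"
  let ?C = "\<lambda>p. fst (l ! fst p) * fst (l ! snd p)"
  define a b where "a p = \<iota> (snd (l ! fst p) + snd (l ! snd p)) / of_real (sqrt 2)"
    and "b p = \<iota> (snd (l ! fst p) - snd (l ! snd p)) / of_real (sqrt 2)" for p
  have na: "(norm (a p - a q))\<^sup>2 = (norm (snd (l ! fst p) + snd (l ! snd p) - (snd (l ! fst q) + snd (l ! snd q))))\<^sup>2 / 2" for p q
    unfolding a_def diff_divide_distrib[symmetric] \<iota>(2)[symmetric] norm_divide power_divide n\<iota> by simp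
  have nb: "(norm (b p))\<^sup>2 = (norm (snd (l ! fst p) - snd (l ! snd p)))\<^sup>2 / 2" for p
    unfolding b_def norm_divide power_divide n\<iota> by simp
  have nb': "(norm (b p - b q))\<^sup>2 = (norm (snd (l ! fst p) - snd (l ! snd p) - (snd (l ! fst q) - snd (l ! snd q))))\<^sup>2 / 2" for p q
    unfolding b_def diff_divide_distrib[symmetric] \<iota>(2)[symmetric] norm_divide power_divide n\<iota> by simp
  have form: "pair_form l t = gram_form ?J ?C (\<lambda>p q. gauss_kernel a p q * exp (- ((1 - ze t) * of_real ((norm (b p))\<^sup>2 / 4)))
      * cnj (exp (- ((1 - ze t) * of_real ((norm (b q))\<^sup>2 / 4)))))" for t
    unfolding pair_form_def gauss_kernel_def na nb by simp
  have kernel: "gauss_kernel a p q * gauss_kernel b p q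
      = free_kernel (\<lambda>j. snd (l ! j)) (fst p) (fst q) * free_kernel (\<lambda>j. snd (l ! j)) (snd p) (snd q)" for p q
  proof -
    have par: "(norm (x + y - (x' + y')))\<^sup>2 / 2 / 4 + (norm (x - y - (x' - y')))\<^sup>2 / 2 / 4 = (norm (x - x'))\<^sup>2 / 4 + (norm (y - y'))\<^sup>2 / 4" for x y x' y' :: 'a
      by (simp add: power2_norm_eq_inner inner_add_left inner_add_right inner_diff_left inner_diff_right inner_commute field_simps)
    show ?thesis unfolding gauss_kernel_def free_kernel_def of_real_exp_minus_add[symmetric] na nb' par ..
  qed
  have gram: "Re (gram_form ?J ?C (\<lambda>p q. gauss_kernel a p q * gauss_kernel b p q)) = l2norm (packet_sum l) ^ 4 / pi\<^sup>2"
  proof -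
    have "gram_form ?J ?C (\<lambda>p q. gauss_kernel a p q * gauss_kernel b p q) = of_real ((l2norm (packet_sum l))\<^sup>2 / sqrt pi ^ DIM('a))
        * of_real ((l2norm (packet_sum l))\<^sup>2 / sqrt pi ^ DIM('a))"
      unfolding kernel free_gram_eq[symmetric] by (rule gram_form_product)
    also have "\<dots> = of_real (l2norm (packet_sum l) ^ 4 / pi\<^sup>2)"
      unfolding d of_real_mult[symmetric] by (simp add: power2_eq_square power4_eq_xxxx)
    finally show ?thesis by (simp only: Re_complex_of_real)
  qed
  have fin: "finite ?J" by simp
  note trace = trace_inequality[OF fin, where C = ?C and a = a and b = b, folded form]
  have inner: "(LINT x|lborel. norm (packet_flow l t x) ^ 4) = pi / 2 * ((norm (om t))\<^sup>2 * Re (pair_form l t))" for t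
  proof -
    have "(LINT x|lborel. norm (packet_flow l t x) ^ 4)
       = norm (om t) ^ (2 * 2) * (sqrt (pi / (2 * (norm (om t))\<^sup>2)) ^ 2 * Re (pair_form l t))"
      using has_bochner_integral_integral_eq[OF packet_flow_fourth_power(1)[of l t]] unfolding d .
    also have "\<dots> = pi / 2 * ((norm (om t))\<^sup>2 * Re (pair_form l t))"
      using om_nonzero[of t] by (simp add: power2_eq_square power4_eq_xxxx)
    finally show ?thesis .
  qed
  show "integrable lborel (\<lambda>t. LINT x|lborel. norm (packet_flow l t x) ^ 4)"
    unfolding inner by (intro integrable_mult_right trace(1))
  have "(LINT t|lborel. LINT x|lborel. norm (packet_flow l t x) ^ 4) = pi / 2 * (LINT t|lborel. (norm (om t))\<^sup>2 * Re (pair_form l t))"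
    unfolding inner by simp
  also have "\<dots> \<le> pi / 2 * (pi / 2 * (l2norm (packet_sum l) ^ 4 / pi\<^sup>2))"
    using trace(2) unfolding gram by (intro mult_left_mono) auto
  also have "\<dots> = l2norm (packet_sum l) ^ 4 / 4" by (simp add: power2_eq_square)
  finally show "(LINT t|lborel. LINT x|lborel. norm (packet_flow l t x) ^ 4) \<le> l2norm (packet_sum l) ^ 4 / 4" .
qed

text \<open>
  In one dimension the outer square doubles the number of factors: the real sums, and the real
  differences, of the two pairs are the coordinates of one complex number.
\<close>

lemma strichartz_4_8_1:
  fixes l :: "(complex \<times> 'a::euclidean_space) list"
  assumes d: "DIM('a) = 1"
  shows "integrable lborel (\<lambda>t. (LINT x|lborel. norm (packet_flow l t x) ^ 4)\<^sup>2)"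
    and "(LINT t|lborel. (LINT x|lborel. norm (packet_flow l t x) ^ 4)\<^sup>2) \<le> l2norm (packet_sum l) ^ 8 / 4"
proof -
  obtain e :: 'a where e: "Basis = {e}"
    using d by (auto simp: card_1_singleton_iff)
  have n: "(norm x)\<^sup>2 = (x \<bullet> e)\<^sup>2" for x :: 'a
    unfolding norm_square_Basis e by simp
  let ?s = "\<lambda>j. snd (l ! j) \<bullet> e"
  let ?J = "{..<length l} \<times> {..<length l}"
  let ?C = "\<lambda>p. fst (l ! fst p) * fst (l ! snd p)"
  let ?CC = "\<lambda>P. ?C (fst P) * ?C (snd P)"
  define a b where "a P = Complex (?s (fst (fst P)) + ?s (snd (fst P))) (?s (fst (snd P)) + ?s (snd (snd P))) / of_real (sqrt 2)"
    and "b P = Complex (?s (fst (fst P)) - ?s (snd (fst P))) (?s (fst (snd P)) - ?s (snd (snd P))) / of_real (sqrt 2)" for P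
  have na: "(norm (a P - a Q))\<^sup>2 = ((norm (snd (l ! fst (fst P)) + snd (l ! snd (fst P)) - (snd (l ! fst (fst Q)) + snd (l ! snd (fst Q)))))\<^sup>2
      + (norm (snd (l ! fst (snd P)) + snd (l ! snd (snd P)) - (snd (l ! fst (snd Q)) + snd (l ! snd (snd Q)))))\<^sup>2) / 2" for P Q
    unfolding a_def diff_divide_distrib[symmetric] norm_divide power_divide n
    by (simp add: cmod_power2 inner_add_left inner_diff_left)
  have nb: "(norm (b P))\<^sup>2 = (norm (snd (l ! fst (fst P)) - snd (l ! snd (fst P))))\<^sup>2 / 2 + (norm (snd (l ! fst (snd P)) - snd (l ! snd (snd P))))\<^sup>2 / 2" for P
    unfolding b_def norm_divide power_divide n by (simp add: cmod_power2 inner_diff_left)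
  have nb': "(norm (b P - b Q))\<^sup>2 = ((norm (snd (l ! fst (fst P)) - snd (l ! snd (fst P)) - (snd (l ! fst (fst Q)) - snd (l ! snd (fst Q)))))\<^sup>2
      + (norm (snd (l ! fst (snd P)) - snd (l ! snd (snd P)) - (snd (l ! fst (snd Q)) - snd (l ! snd (snd Q)))))\<^sup>2) / 2" for P Q
    unfolding b_def diff_divide_distrib[symmetric] norm_divide power_divide n
    by (simp add: cmod_power2 inner_diff_left)
  let ?H = "\<lambda>t. gram_form (?J \<times> ?J) ?CC (\<lambda>P Q. gauss_kernel a P Q * exp (- ((1 - ze t) * of_real ((norm (b P))\<^sup>2 / 4)))
      * cnj (exp (- ((1 - ze t) * of_real ((norm (b Q))\<^sup>2 / 4)))))"
  have form: "pair_form l t * pair_form l t = ?H t" for t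
  proof -
    let ?K = "\<lambda>p q. complex_of_real (exp (- ((norm (snd (l ! fst p) + snd (l ! snd p) - (snd (l ! fst q) + snd (l ! snd q))))\<^sup>2 / (4 * 2))))
        * exp (- ((1 - ze t) * of_real ((norm (snd (l ! fst p) - snd (l ! snd p)))\<^sup>2 / 2 / 4)))
        * cnj (exp (- ((1 - ze t) * of_real ((norm (snd (l ! fst q) - snd (l ! snd q)))\<^sup>2 / 2 / 4))))"
    have "?K (fst P) (fst Q) * ?K (snd P) (snd Q) = gauss_kernel a P Q * exp (- ((1 - ze t) * of_real ((norm (b P))\<^sup>2 / 4)))
      * cnj (exp (- ((1 - ze t) * of_real ((norm (b Q))\<^sup>2 / 4))))" for P Q
    proof -
      have e1: "exp (- ((1 - ze t) * of_real ((u / 2 + v / 2) / 4))) = exp (- ((1 - ze t) * of_real (u / 2 / 4))) * exp (- ((1 - ze t) * of_real (v / 2 / 4)))"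
        for u v :: real
        unfolding exp_add[symmetric] by (simp add: algebra_simps add_divide_distrib)
      have e2: "complex_of_real (exp (- ((u + v) / 2 / 4))) = of_real (exp (- (u / (4 * 2)))) * of_real (exp (- (v / (4 * 2))))" for u v :: real
        unfolding of_real_mult[symmetric] exp_add[symmetric] by (simp add: add_divide_distrib)
      show ?thesis unfolding gauss_kernel_def na nb e1 e2 complex_cnj_mult by (simp only: mult_ac)
    qed
    then show ?thesis unfolding pair_form_def gram_form_product[symmetric] by simp
  qed
  have sq: "(Re (pair_form l t))\<^sup>2 = Re (?H t)" for t
    using packet_flow_fourth_power(2)[of l t] unfolding form[symmetric]
    by (metis Re_complex_of_real of_real_mult power2_eq_square)
  have kernel: "gauss_kernel a P Q * gauss_kernel b P Q
      = (free_kernel (\<lambda>j. snd (l ! j)) (fst (fst P)) (fst (fst Q)) * free_kernel (\<lambda>j. snd (l ! j)) (snd (fst P)) (snd (fst Q)))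
      * (free_kernel (\<lambda>j. snd (l ! j)) (fst (snd P)) (fst (snd Q)) * free_kernel (\<lambda>j. snd (l ! j)) (snd (snd P)) (snd (snd Q)))" for P Q
  proof -
    have par: "(norm (x + y - (x' + y')))\<^sup>2 + (norm (x - y - (x' - y')))\<^sup>2 = 2 * ((norm (x - x'))\<^sup>2 + (norm (y - y'))\<^sup>2)" for x y x' y' :: 'a
      by (simp add: power2_norm_eq_inner inner_add_left inner_add_right inner_diff_left inner_diff_right inner_commute field_simps)
    have "(norm (a P - a Q))\<^sup>2 / 4 + (norm (b P - b Q))\<^sup>2 / 4
        = (norm (snd (l ! fst (fst P)) - snd (l ! fst (fst Q))))\<^sup>2 / 4 + (norm (snd (l ! snd (fst P)) - snd (l ! snd (fst Q))))\<^sup>2 / 4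
        + ((norm (snd (l ! fst (snd P)) - snd (l ! fst (snd Q))))\<^sup>2 / 4 + (norm (snd (l ! snd (snd P)) - snd (l ! snd (snd Q))))\<^sup>2 / 4)"
      unfolding na nb'
      using par[of "snd (l ! fst (fst P))" "snd (l ! snd (fst P))" "snd (l ! fst (fst Q))" "snd (l ! snd (fst Q))"]
        par[of "snd (l ! fst (snd P))" "snd (l ! snd (snd P))" "snd (l ! fst (snd Q))" "snd (l ! snd (snd Q))"]
      by argo
    then show ?thesis unfolding gauss_kernel_def free_kernel_def of_real_exp_minus_add[symmetric] by (simp only:)
  qed
  have fin: "finite (?J \<times> ?J)" by simp
  have gram: "Re (gram_form (?J \<times> ?J) ?CC (\<lambda>P Q. gauss_kernel a P Q * gauss_kernel b P Q)) = l2norm (packet_sum l) ^ 8 / pi\<^sup>2"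
  proof -
    let ?g = "complex_of_real ((l2norm (packet_sum l))\<^sup>2 / sqrt pi ^ DIM('a))"
    have two: "gram_form ?J ?C (\<lambda>p q. free_kernel (\<lambda>j. snd (l ! j)) (fst p) (fst q) * free_kernel (\<lambda>j. snd (l ! j)) (snd p) (snd q)) = ?g * ?g"
      unfolding free_gram_eq[symmetric] by (rule gram_form_product)
    have "gram_form (?J \<times> ?J) ?CC (\<lambda>P Q. gauss_kernel a P Q * gauss_kernel b P Q) = (?g * ?g) * (?g * ?g)"
      unfolding kernel two[symmetric] by (rule gram_form_product)
    also have "\<dots> = of_real (l2norm (packet_sum l) ^ 8 / pi\<^sup>2)"
    proof -
      have "((l2norm (packet_sum l))\<^sup>2 / sqrt pi * ((l2norm (packet_sum l))\<^sup>2 / sqrt pi)) * ((l2norm (packet_sum l))\<^sup>2 / sqrt pi * ((l2norm (packet_sum l))\<^sup>2 / sqrt pi))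
          = l2norm (packet_sum l) ^ 8 / (sqrt pi * sqrt pi * (sqrt pi * sqrt pi))"
        by (simp add: mult_ac flip: power_add)
      then show ?thesis unfolding d of_real_mult[symmetric] by (simp add: power2_eq_square)
    qed
    finally show ?thesis by (simp only: Re_complex_of_real)
  qed
  note trace = trace_inequality[OF fin, where C = ?CC and a = a and b = b, folded sq]
  have inner: "(LINT x|lborel. norm (packet_flow l t x) ^ 4)\<^sup>2 = pi / 2 * ((norm (om t))\<^sup>2 * (Re (pair_form l t))\<^sup>2)" for t
  proof -
    have "(LINT x|lborel. norm (packet_flow l t x) ^ 4)
       = norm (om t) ^ (2 * 1) * (sqrt (pi / (2 * (norm (om t))\<^sup>2)) ^ 1 * Re (pair_form l t))"
      using has_bochner_integral_integral_eq[OF packet_flow_fourth_power(1)[of l t]] unfolding d .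
    also have "\<dots> = norm (om t) * sqrt (pi / 2) * Re (pair_form l t)"
      using om_nonzero[of t] by (simp add: real_sqrt_divide real_sqrt_mult power2_eq_square)
    finally show ?thesis by (simp add: power_mult_distrib)
  qed
  show "integrable lborel (\<lambda>t. (LINT x|lborel. norm (packet_flow l t x) ^ 4)\<^sup>2)"
    unfolding inner by (intro integrable_mult_right trace(1))
  have "(LINT t|lborel. (LINT x|lborel. norm (packet_flow l t x) ^ 4)\<^sup>2) = pi / 2 * (LINT t|lborel. (norm (om t))\<^sup>2 * (Re (pair_form l t))\<^sup>2)"
    unfolding inner by simp
  also have "\<dots> \<le> pi / 2 * (pi / 2 * (l2norm (packet_sum l) ^ 8 / pi\<^sup>2))"
    using trace(2) unfolding gram by (intro mult_left_mono) auto
  also have "\<dots> = l2norm (packet_sum l) ^ 8 / 4" by (simp add: power2_eq_square)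
  finally show "(LINT t|lborel. (LINT x|lborel. norm (packet_flow l t x) ^ 4)\<^sup>2) \<le> l2norm (packet_sum l) ^ 8 / 4" .
qed

text \<open>
  Three real frequencies \<open>x, y, z\<close>: the rotation of \<open>\<real>\<^sup>3\<close> that takes the diagonal to the first axis has
  \<open>(x + y + z)/\<surd>3\<close> as first coordinate, and the other two form one complex number.
\<close>

lemma strichartz_6_6_1:
  fixes l :: "(complex \<times> 'a::euclidean_space) list"
  assumes d: "DIM('a) = 1"
  shows "integrable lborel (\<lambda>t. LINT x|lborel. norm (packet_flow l t x) ^ 6)"
    and "(LINT t|lborel. LINT x|lborel. norm (packet_flow l t x) ^ 6) \<le> l2norm (packet_sum l) ^ 6 / (2 * sqrt 3)"
proof -
  obtain e :: 'a where e: "Basis = {e}"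
    using d by (auto simp: card_1_singleton_iff)
  have n: "(norm x)\<^sup>2 = (x \<bullet> e)\<^sup>2" for x :: 'a
    unfolding norm_square_Basis e by simp
  let ?s = "\<lambda>j. snd (l ! j) \<bullet> e"
  let ?J = "{..<length l} \<times> {..<length l} \<times> {..<length l}"
  let ?C = "\<lambda>p. fst (l ! fst p) * (fst (l ! fst (snd p)) * fst (l ! snd (snd p)))"
  define a b where "a p = complex_of_real ((?s (fst p) + ?s (fst (snd p)) + ?s (snd (snd p))) / sqrt 3)"
    and "b p = Complex ((?s (fst p) - ?s (fst (snd p))) / sqrt 2) ((?s (fst p) + ?s (fst (snd p)) - 2 * ?s (snd (snd p))) / sqrt 6)" for p
  have na: "(norm (a p - a q))\<^sup>2 = (norm (snd (l ! fst p) + snd (l ! fst (snd p)) + snd (l ! snd (snd p))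
              - (snd (l ! fst q) + snd (l ! fst (snd q)) + snd (l ! snd (snd q)))))\<^sup>2 / 3" for p q
    unfolding a_def of_real_diff[symmetric] norm_of_real power2_abs diff_divide_distrib[symmetric] power_divide n
    by (simp add: inner_add_left inner_diff_left)
  have nb: "(norm (b p))\<^sup>2 = (norm (snd (l ! fst p)))\<^sup>2 + (norm (snd (l ! fst (snd p))))\<^sup>2 + (norm (snd (l ! snd (snd p))))\<^sup>2
            - (norm (snd (l ! fst p) + snd (l ! fst (snd p)) + snd (l ! snd (snd p))))\<^sup>2 / 3" for p
  proof -
    have "((x - y) / sqrt 2)\<^sup>2 + ((x + y - 2 * z) / sqrt 6)\<^sup>2 = x\<^sup>2 + y\<^sup>2 + z\<^sup>2 - (x + y + z)\<^sup>2 / 3" for x y z :: real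
      unfolding power_divide by (simp add: power2_eq_square field_simps)
    then show ?thesis unfolding b_def n cmod_power2 complex.sel by (simp only: inner_add_left)
  qed
  have form: "triple_form l t = gram_form ?J ?C (\<lambda>p q. gauss_kernel a p q * exp (- ((1 - ze t) * of_real ((norm (b p))\<^sup>2 / 4)))
      * cnj (exp (- ((1 - ze t) * of_real ((norm (b q))\<^sup>2 / 4)))))" for t
    unfolding triple_form_def gauss_kernel_def na nb by simp
  have kernel: "gauss_kernel a p q * gauss_kernel b p q
      = free_kernel (\<lambda>j. snd (l ! j)) (fst p) (fst q) * (free_kernel (\<lambda>j. snd (l ! j)) (fst (snd p)) (fst (snd q))
         * free_kernel (\<lambda>j. snd (l ! j)) (snd (snd p)) (snd (snd q)))" for p q
  proof -
    have id: "((x + y + z) / sqrt 3 - (x' + y' + z') / sqrt 3)\<^sup>2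
        + (((x - y) / sqrt 2 - (x' - y') / sqrt 2)\<^sup>2 + ((x + y - 2 * z) / sqrt 6 - (x' + y' - 2 * z') / sqrt 6)\<^sup>2)
        = (x - x')\<^sup>2 + ((y - y')\<^sup>2 + (z - z')\<^sup>2)" for x y z x' y' z' :: real
      unfolding diff_divide_distrib[symmetric] power_divide by (simp add: power2_eq_square field_simps)
    have "(norm (a p - a q))\<^sup>2 + (norm (b p - b q))\<^sup>2 = (norm (snd (l ! fst p) - snd (l ! fst q)))\<^sup>2
        + ((norm (snd (l ! fst (snd p)) - snd (l ! fst (snd q))))\<^sup>2 + (norm (snd (l ! snd (snd p)) - snd (l ! snd (snd q))))\<^sup>2)"
      unfolding a_def b_def n of_real_diff[symmetric] norm_of_real power2_abs cmod_power2 minus_complex.sel complex.sel inner_diff_left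
      by (rule id)
    then have "(norm (a p - a q))\<^sup>2 / 4 + (norm (b p - b q))\<^sup>2 / 4 = (norm (snd (l ! fst p) - snd (l ! fst q)))\<^sup>2 / 4
        + ((norm (snd (l ! fst (snd p)) - snd (l ! fst (snd q))))\<^sup>2 / 4 + (norm (snd (l ! snd (snd p)) - snd (l ! snd (snd q))))\<^sup>2 / 4)"
      by argo
    then show ?thesis unfolding gauss_kernel_def free_kernel_def of_real_exp_minus_add[symmetric] by (simp only:)
  qed
  have gram: "Re (gram_form ?J ?C (\<lambda>p q. gauss_kernel a p q * gauss_kernel b p q)) = l2norm (packet_sum l) ^ 6 / (pi * sqrt pi)"
  proof -
    let ?g = "complex_of_real ((l2norm (packet_sum l))\<^sup>2 / sqrt pi ^ DIM('a))"
    let ?F = "free_kernel (\<lambda>j. snd (l ! j))"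
    have two: "gram_form ({..<length l} \<times> {..<length l}) (\<lambda>p. fst (l ! fst p) * fst (l ! snd p)) (\<lambda>p q. ?F (fst p) (fst q) * ?F (snd p) (snd q)) = ?g * ?g"
      unfolding free_gram_eq[symmetric] by (rule gram_form_product)
    have "gram_form ?J ?C (\<lambda>p q. gauss_kernel a p q * gauss_kernel b p q) = ?g * (?g * ?g)"
      unfolding kernel two[symmetric] unfolding free_gram_eq[symmetric]
      by (rule gram_form_product[where C' = "\<lambda>p. fst (l ! fst p) * fst (l ! snd p)" and K' = "\<lambda>p q. ?F (fst p) (fst q) * ?F (snd p) (snd q)"])
    also have "\<dots> = of_real (l2norm (packet_sum l) ^ 6 / (pi * sqrt pi))"
    proof -
      have "(l2norm (packet_sum l))\<^sup>2 / sqrt pi * ((l2norm (packet_sum l))\<^sup>2 / sqrt pi * ((l2norm (packet_sum l))\<^sup>2 / sqrt pi))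
          = l2norm (packet_sum l) ^ 6 / (sqrt pi * sqrt pi * sqrt pi)"
        by (simp add: mult_ac flip: power_add)
      then show ?thesis unfolding d of_real_mult[symmetric] by simp
    qed
    finally show ?thesis by (simp only: Re_complex_of_real)
  qed
  have fin: "finite ?J" by simp
  note trace = trace_inequality[OF fin, where C = ?C and a = a and b = b, folded form]
  have inner: "(LINT x|lborel. norm (packet_flow l t x) ^ 6) = sqrt (pi / 3) * ((norm (om t))\<^sup>2 * Re (triple_form l t))" for t
  proof -
    have "(LINT x|lborel. norm (packet_flow l t x) ^ 6)
       = norm (om t) ^ (3 * 1) * (sqrt (pi / (3 * (norm (om t))\<^sup>2)) ^ 1 * Re (triple_form l t))"
      using has_bochner_integral_integral_eq[OF packet_flow_sixth_power(1)[of l t]] unfolding d .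
    also have "\<dots> = sqrt (pi / 3) * ((norm (om t))\<^sup>2 * Re (triple_form l t))"
      using om_nonzero[of t] by (simp add: real_sqrt_divide real_sqrt_mult power2_eq_square power3_eq_cube)
    finally show ?thesis .
  qed
  show "integrable lborel (\<lambda>t. LINT x|lborel. norm (packet_flow l t x) ^ 6)"
    unfolding inner by (intro integrable_mult_right trace(1))
  have "(LINT t|lborel. LINT x|lborel. norm (packet_flow l t x) ^ 6) = sqrt (pi / 3) * (LINT t|lborel. (norm (om t))\<^sup>2 * Re (triple_form l t))"
    unfolding inner by simp
  also have "\<dots> \<le> sqrt (pi / 3) * (pi / 2 * (l2norm (packet_sum l) ^ 6 / (pi * sqrt pi)))"
    using trace(2) unfolding gram by (intro mult_left_mono) auto
  also have "\<dots> = l2norm (packet_sum l) ^ 6 / (2 * sqrt 3)" by (simp add: real_sqrt_divide)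
  finally show "(LINT t|lborel. LINT x|lborel. norm (packet_flow l t x) ^ 6) \<le> l2norm (packet_sum l) ^ 6 / (2 * sqrt 3)" .
qed

section \<open>The Strichartz inequality for square-integrable functions\<close>

text \<open>
  The triple encodes \<open>p = m\<close> and \<open>q = m r\<close>, so that the mixed norm is a root of an integral in which only
  integer powers occur.
\<close>

definition admissible :: "nat \<Rightarrow> nat \<Rightarrow> nat \<Rightarrow> bool" where
  "admissible m r d \<longleftrightarrow> (m, r, d) \<in> {(6, 1, 1), (4, 2, 1), (4, 1, 2)}"

definition spacetime_integral :: "nat \<Rightarrow> nat \<Rightarrow> (real \<Rightarrow> 'a::euclidean_space \<Rightarrow> complex) \<Rightarrow> ennreal" where
  "spacetime_integral m r u = (\<integral>\<^sup>+t. (\<integral>\<^sup>+x. ennreal (norm (u t x) ^ m) \<partial>lborel) ^ r \<partial>lborel)"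

lemma admissible_cases:
  assumes "admissible m r d"
  obtains "m = 6" "r = 1" "d = 1" | "m = 4" "r = 2" "d = 1" | "m = 4" "r = 1" "d = 2"
  using assms by (auto simp: admissible_def)

lemma mixed_norm_eq:
  assumes "m > 0" "r > 0"
  shows "mixed_norm (real m) (real (m * r)) u = ennreal_powr (spacetime_integral m r u) (1 / real (m * r))"
proof -
  have "ennreal_powr (ennreal_powr X (1 / real m)) (real (m * r)) = X ^ r" for X
  proof (cases X)
    case (real x)
    have "(x powr (1 / real m)) powr (real (m * r)) = x powr real r"
      using assms by (simp add: powr_powr)
    also have "\<dots> = x ^ r" using real assms by (simp add: powr_realpow')
    finally show ?thesis using real by (simp add: ennreal_powr_ennreal ennreal_power)
  next
    case top
    then show ?thesis using assms by (simp add: ennreal_powr_def power_eq_top_ennreal)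
  qed
  moreover have "norm (u t x) powr real m = norm (u t x) ^ m" for t x
    using assms by (simp add: powr_realpow')
  ultimately show ?thesis by (simp add: mixed_norm_def Lp_norm_def spacetime_integral_def)
qed

lemma power_powr_inverse: "(x ^ k) powr (1 / real k) = x" if "0 \<le> x" "k > 0"
proof -
  have "x ^ k = x powr real k" using that by (simp add: powr_realpow')
  then have "(x ^ k) powr (1 / real k) = x powr 1" using that by (simp only: powr_powr) simp
  then show ?thesis using that by simp
qed

lemma powr_power: "(x powr a) ^ n = x powr (real n * a)" if "(x::real) > 0"
proof -
  have "(x powr a) ^ n = (x powr a) powr real n" using that by (simp add: powr_realpow)
  then show ?thesis by (simp add: powr_powr mult.commute)
qed

text \<open>
  The powers of the constant in the form in which they come out of the trace inequality.
\<close>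

lemma strichartz_const_power:
  "strichartz_const 6 1 ^ 6 = 1 / (2 * sqrt 3)" "strichartz_const 4 1 ^ 8 = 1 / 4" "strichartz_const 4 2 ^ 4 = 1 / 4"
proof -
  have "strichartz_const 6 1 = 6 powr (- (1 / 12)) * 2 powr (- (1 / 12))"
    by (simp add: strichartz_const_def)
  also have "\<dots> = (6 * 2) powr (- (1 / 12))" by (rule powr_mult[symmetric])
  finally have six: "strichartz_const 6 1 = (6 * 2) powr (- (1 / 12))" .
  have "strichartz_const 6 1 ^ 6 = (6 * 2) powr (real 6 * (- (1 / 12)))"
    unfolding six by (rule powr_power) simp
  also have "\<dots> = inverse (12 powr (1 / 2))" by (simp add: powr_minus)
  also have "\<dots> = 1 / sqrt 12" by (simp add: powr_half_sqrt inverse_eq_divide)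
  also have "sqrt 12 = 2 * sqrt 3" using real_sqrt_mult[of 4 3] by simp
  finally show "strichartz_const 6 1 ^ 6 = 1 / (2 * sqrt 3)" .
  have "((4::real) powr (- (1 / 8))) ^ 8 = 4 powr (real 8 * (- (1 / 8)))" by (rule powr_power) simp
  also have "\<dots> = inverse (4 powr 1)" by (simp add: powr_minus)
  finally have eight: "((4::real) powr (- (1 / 8))) ^ 8 = 1 / 4" by (simp add: inverse_eq_divide)
  have four: "strichartz_const 4 d = (4 powr (- (1 / 8))) ^ d" for d
    by (simp add: strichartz_const_def)
  show "strichartz_const 4 1 ^ 8 = 1 / 4" unfolding four using eight by simp
  show "strichartz_const 4 2 ^ 4 = 1 / 4" unfolding four power_mult[symmetric] using eight by simp
qed

lemma strichartz_const_nonneg: "strichartz_const p d \<ge> 0"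
  by (simp add: strichartz_const_def)

lemma strichartz_packet_sum:
  fixes l :: "(complex \<times> 'a::euclidean_space) list"
  assumes adm: "admissible m r DIM('a)"
  shows "(\<lambda>t. (\<integral>\<^sup>+x. ennreal (norm (packet_flow l t x) ^ m) \<partial>lborel) ^ r) \<in> borel_measurable lborel"
    and "spacetime_integral m r (packet_flow l) \<le> ennreal ((strichartz_const (real m) DIM('a) * l2norm (packet_sum l)) ^ (m * r))"
proof -
  let ?L = "\<lambda>t. LINT x|lborel. norm (packet_flow l t x) ^ m"
  have int: "integrable lborel (\<lambda>x. norm (packet_flow l t x) ^ m)" for t
    using adm packet_flow_fourth_power(1)[of l t] packet_flow_sixth_power(1)[of l t]
    by (auto simp: has_bochner_integral_iff elim!: admissible_cases)
  have inner: "(\<integral>\<^sup>+x. ennreal (norm (packet_flow l t x) ^ m) \<partial>lborel) ^ r = ennreal (?L t ^ r)" for t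
    using nn_integral_eq_integral[OF int[of t]] by (simp add: ennreal_power integral_nonneg_AE)
  have tint: "integrable lborel (\<lambda>t. ?L t ^ r)"
    using adm strichartz_4_4_2(1)[of l] strichartz_4_8_1(1)[of l] strichartz_6_6_1(1)[of l]
    by (cases rule: admissible_cases) auto
  have le: "(LINT t|lborel. ?L t ^ r) \<le> (strichartz_const (real m) DIM('a) * l2norm (packet_sum l)) ^ (m * r)"
    using adm strichartz_4_4_2(2)[of l] strichartz_4_8_1(2)[of l] strichartz_6_6_1(2)[of l]
    by (cases rule: admissible_cases) (auto simp: power_mult_distrib strichartz_const_power[unfolded One_nat_def])
  show "(\<lambda>t. (\<integral>\<^sup>+x. ennreal (norm (packet_flow l t x) ^ m) \<partial>lborel) ^ r) \<in> borel_measurable lborel"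
    unfolding inner using borel_measurable_integrable[OF tint] by measurable
  have "spacetime_integral m r (packet_flow l) = ennreal (LINT t|lborel. ?L t ^ r)"
    unfolding spacetime_integral_def inner
    by (rule nn_integral_eq_integral[OF tint]) (simp add: integral_nonneg_AE)
  also have "\<dots> \<le> ennreal ((strichartz_const (real m) DIM('a) * l2norm (packet_sum l)) ^ (m * r))"
    by (intro ennreal_leI le)
  finally show "spacetime_integral m r (packet_flow l) \<le> ennreal ((strichartz_const (real m) DIM('a) * l2norm (packet_sum l)) ^ (m * r))" .
qed

text \<open>
  Multiplication in \<open>[0, \<infinity>]\<close> is discontinuous at \<open>(0, \<infinity>)\<close>, but squaring is continuous everywhere.
\<close>

lemma power_le_liminf:
  fixes X :: "nat \<Rightarrow> ennreal"
  assumes "y \<le> liminf X" and r: "r = 1 \<or> r = 2"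
  shows "y ^ r \<le> liminf (\<lambda>n. X n ^ r)"
proof -
  define a where "a n = (INF k\<in>{n..}. X k)" for n
  have "incseq a" unfolding a_def by (intro monoI INF_superset_mono) auto
  then have "a \<longlonglongrightarrow> (SUP n. a n)" by (rule LIMSEQ_SUP)
  then have a: "a \<longlonglongrightarrow> liminf X" by (simp add: a_def liminf_SUP_INF)
  have "(\<lambda>n. a n * a n) \<longlonglongrightarrow> liminf X * liminf X"
    by (rule tendsto_mult_ennreal[OF a a]) auto
  with a r have "(\<lambda>n. a n ^ r) \<longlonglongrightarrow> liminf X ^ r" by (auto simp: power2_eq_square)
  moreover have "a n ^ r \<le> liminf (\<lambda>n. X n ^ r)" for n
  proof -
    have "a n ^ r \<le> (INF k\<in>{n..}. X k ^ r)"
      by (intro INF_greatest power_mono) (auto simp: a_def intro: INF_lower)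
    also have "\<dots> \<le> liminf (\<lambda>n. X n ^ r)" unfolding liminf_SUP_INF by (intro SUP_upper) simp
    finally show ?thesis .
  qed
  ultimately have "liminf X ^ r \<le> liminf (\<lambda>n. X n ^ r)" by (intro LIMSEQ_le_const2) auto
  then show ?thesis using power_mono[OF assms(1), of r] by (auto intro: order_trans)
qed

text \<open>
  The bound passes from packet sums to their limits by Fatou's lemma, applied in space at each time and
  then in time. By uniqueness the limit is the flow, whichever solution has been chosen.
\<close>

theorem strichartz_inequality:
  fixes f :: "'a::euclidean_space \<Rightarrow> complex"
  assumes adm: "admissible m r DIM('a)" and f: "f \<in> L2"
  shows "mixed_norm (real m) (real (m * r)) (schroedinger_flow f)
      \<le> ennreal (strichartz_const (real m) DIM('a)) * Lp_norm 2 f"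
proof -
  let ?C = "strichartz_const (real m) DIM('a)" and ?k = "m * r"
  have r: "r = 1 \<or> r = 2" and m: "m > 0" and r0: "r > 0" using adm by (auto simp: admissible_def)
  have "\<exists>l. l2norm (\<lambda>x. f x - packet_sum l x) \<le> (1/4) ^ n" for n
    using packet_closureE[of f "(1/4) ^ n"] f by (auto simp: packet_sums_dense intro: less_imp_le)
  then obtain l where l: "\<And>n. l2norm (\<lambda>x. f x - packet_sum (l n) x) \<le> (1/4) ^ n" by metis
  obtain u where u: "schroedinger_solution f u" "\<And>t. AE x in lborel. (\<lambda>n. packet_flow (l n) t x) \<longlonglongrightarrow> u t x"
    by (rule solution_exists[OF f l], rule that)
  let ?X = "\<lambda>n t. \<integral>\<^sup>+x. ennreal (norm (packet_flow (l n) t x) ^ m) \<partial>lborel"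
  let ?Y = "\<lambda>t. \<integral>\<^sup>+x. ennreal (norm (schroedinger_flow f t x) ^ m) \<partial>lborel"
  have "?Y t \<le> liminf (\<lambda>n. ?X n t)" for t
  proof -
    have "AE x in lborel. ennreal (norm (schroedinger_flow f t x) ^ m) = liminf (\<lambda>n. ennreal (norm (packet_flow (l n) t x) ^ m))"
      using u(2)[of t] schroedinger_flow_AE[OF u(1), of t]
    proof eventually_elim
      case (elim x)
      have "(\<lambda>n. ennreal (norm (packet_flow (l n) t x) ^ m)) \<longlonglongrightarrow> ennreal (norm (u t x) ^ m)"
        by (intro tendsto_ennrealI tendsto_intros elim)
      from lim_imp_Liminf[OF sequentially_bot this] elim(2) show ?case by (simp only:)
    qed
    then have "?Y t = (\<integral>\<^sup>+x. liminf (\<lambda>n. ennreal (norm (packet_flow (l n) t x) ^ m)) \<partial>lborel)"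
      by (rule nn_integral_cong_AE)
    also have "\<dots> \<le> liminf (\<lambda>n. ?X n t)"
    proof (rule nn_integral_liminf)
      show "(\<lambda>x. ennreal (norm (packet_flow (l n) t x) ^ m)) \<in> borel_measurable lborel" for n
        using L2_measurable[OF packet_flow_norm(1)[of "l n" t]] by measurable
    qed
    finally show ?thesis .
  qed
  then have Y: "?Y t ^ r \<le> liminf (\<lambda>n. ?X n t ^ r)" for t using r by (rule power_le_liminf)
  have norms: "(\<lambda>n. l2norm (packet_sum (l n))) \<longlonglongrightarrow> l2norm f"
  proof (rule LIM_zero_cancel, rule Lim_null_comparison)
    show "(\<lambda>n. (1/4::real) ^ n) \<longlonglongrightarrow> 0" by (rule LIMSEQ_power_zero) simp
    show "\<forall>\<^sub>F n in sequentially. norm (l2norm (packet_sum (l n)) - l2norm f) \<le> (1/4) ^ n"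
    proof (rule always_eventually, rule allI)
      fix n
      show "norm (l2norm (packet_sum (l n)) - l2norm f) \<le> (1/4) ^ n"
        using l[of n] l2norm_le_add_diff[OF f packet_sum_L2[of "l n"]] l2norm_le_add_diff[OF packet_sum_L2[of "l n"] f]
        by (simp add: l2norm_minus_commute[of "packet_sum (l n)"] abs_le_iff)
    qed
  qed
  have "spacetime_integral m r (schroedinger_flow f) \<le> (\<integral>\<^sup>+t. liminf (\<lambda>n. ?X n t ^ r) \<partial>lborel)"
    unfolding spacetime_integral_def by (intro nn_integral_mono Y)
  also have "\<dots> \<le> liminf (\<lambda>n. \<integral>\<^sup>+t. ?X n t ^ r \<partial>lborel)"
    by (rule nn_integral_liminf) (rule strichartz_packet_sum(1)[OF adm])
  also have "\<dots> \<le> liminf (\<lambda>n. ennreal ((?C * l2norm (packet_sum (l n))) ^ ?k))"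
    using strichartz_packet_sum(2)[OF adm] unfolding spacetime_integral_def
    by (intro Liminf_mono always_eventually) simp
  also have "\<dots> = ennreal ((?C * l2norm f) ^ ?k)"
    by (intro lim_imp_Liminf tendsto_ennrealI tendsto_intros norms) simp
  finally have le: "spacetime_integral m r (schroedinger_flow f) \<le> ennreal ((?C * l2norm f) ^ ?k)" .
  then obtain y where y: "spacetime_integral m r (schroedinger_flow f) = ennreal y" "0 \<le> y"
    by (cases "spacetime_integral m r (schroedinger_flow f)") (auto simp: top_unique)
  have CN: "0 \<le> ?C * l2norm f" by (simp add: strichartz_const_nonneg)
  have k: "?k > 0" using m r0 by simp
  have "y \<le> (?C * l2norm f) ^ ?k" using le y CN by simp
  then have "y powr (1 / real ?k) \<le> ((?C * l2norm f) ^ ?k) powr (1 / real ?k)"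
    using y(2) by (intro powr_mono2) auto
  also have "\<dots> = ?C * l2norm f"
    by (rule power_powr_inverse[OF CN k])
  finally have "mixed_norm (real m) (real ?k) (schroedinger_flow f) \<le> ennreal (?C * l2norm f)"
    unfolding mixed_norm_eq[OF m r0] y(1) by (simp add: ennreal_powr_ennreal y(2) ennreal_leI)
  then show ?thesis
    by (simp add: Lp_norm_2_eq[OF f] ennreal_mult strichartz_const_nonneg)
qed

section \<open>Gaussians attain equality\<close>

text \<open>
  The integrand is a real Gaussian. Its integral depends on time only through the modulus of
  \<open>gflow_denom\<close>, since the spreading of the packet compensates the drift exactly.
\<close>

lemma gflow_norm_power_integral:
  fixes w :: "'a::euclidean_space \<Rightarrow> complex"
  assumes B: "Re B > 0" and m: "m > 0"
  shows "has_bochner_integral lborel (\<lambda>x. norm (gflow B w t x) ^ m)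
    (sqrt (1 / norm (gflow_denom B t)) ^ (DIM('a) * m) * (sqrt (pi / (real m * Re B)) * norm (gflow_denom B t)) ^ DIM('a)
      * exp ((\<Sum>b\<in>Basis. (Re (w b))\<^sup>2) / (4 * Re B)) ^ m)"
proof -
  define z a where "z = gflow_denom B t" and "a = Re B"
  have a: "a > 0" using B by (simp add: a_def)
  have z: "norm z > 0" using gflow_denom_nonzero[OF B] by (simp add: z_def)
  define \<alpha> where "\<alpha> = real m * a / (norm z)\<^sup>2"
  have \<alpha>: "\<alpha> > 0" using a z m by (simp add: \<alpha>_def)
  define v where "v b = real m * Re (w b / z)" for b
  define D where "D = real m * (\<Sum>b\<in>Basis. Re (\<i> * of_real t * (w b)\<^sup>2 / z))"
  define K where "K = sqrt (1 / norm z) ^ (DIM('a) * m) * exp D"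
  have "has_bochner_integral lborel (\<lambda>x::'a. exp (- of_real \<alpha> * of_real ((norm x)\<^sup>2) + cdot (\<lambda>b. of_real (v b)) x))
     (of_real (sqrt (pi / \<alpha>)) ^ DIM('a) * exp ((\<Sum>b\<in>(Basis::'a set). (of_real (v b))\<^sup>2) / (4 * of_real \<alpha>)))"
    by (rule gaussian_integral[OF \<alpha>])
  also have "(\<lambda>x::'a. exp (- of_real \<alpha> * of_real ((norm x)\<^sup>2) + cdot (\<lambda>b. of_real (v b)) x))
     = (\<lambda>x. complex_of_real (exp (- \<alpha> * (norm x)\<^sup>2 + (\<Sum>b\<in>Basis. v b * (x \<bullet> b)))))"
    by (simp add: cdot_def exp_of_real [symmetric])
  also have "of_real (sqrt (pi / \<alpha>)) ^ DIM('a) * exp ((\<Sum>b\<in>(Basis::'a set). (of_real (v b))\<^sup>2) / (4 * of_real \<alpha>))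
     = complex_of_real (sqrt (pi / \<alpha>) ^ DIM('a) * exp ((\<Sum>b\<in>(Basis::'a set). (v b)\<^sup>2) / (4 * \<alpha>)))"
    by (simp add: exp_of_real [symmetric])
  finally have "has_bochner_integral lborel (\<lambda>x::'a. complex_of_real (exp (- \<alpha> * (norm x)\<^sup>2 + (\<Sum>b\<in>Basis. v b * (x \<bullet> b)))))
     (complex_of_real (sqrt (pi / \<alpha>) ^ DIM('a) * exp ((\<Sum>b\<in>(Basis::'a set). (v b)\<^sup>2) / (4 * \<alpha>))))" .
  from has_bochner_integral_of_real_imp(1)[OF this] have "has_bochner_integral lborel (\<lambda>x::'a. exp (- \<alpha> * (norm x)\<^sup>2 + (\<Sum>b\<in>Basis. v b * (x \<bullet> b))))
     (sqrt (pi / \<alpha>) ^ DIM('a) * exp ((\<Sum>b\<in>(Basis::'a set). (v b)\<^sup>2) / (4 * \<alpha>)))"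
    unfolding Re_complex_of_real .
  then have HB: "has_bochner_integral lborel (\<lambda>x::'a. K * exp (- \<alpha> * (norm x)\<^sup>2 + (\<Sum>b\<in>Basis. v b * (x \<bullet> b))))
     (K * (sqrt (pi / \<alpha>) ^ DIM('a) * exp ((\<Sum>b\<in>(Basis::'a set). (v b)\<^sup>2) / (4 * \<alpha>))))"
    by (intro has_bochner_integral_mult_right)
  have EE: "K * exp (- \<alpha> * (norm x)\<^sup>2 + (\<Sum>b\<in>Basis. v b * (x \<bullet> b))) = norm (gflow B w t x) ^ m" for x :: 'a
  proof -
    let ?q = "(- B * of_real ((norm x)\<^sup>2) + cdot w x + \<i> * of_real t * (\<Sum>b\<in>Basis. (w b)\<^sup>2)) / z"
    have "?q = - (of_real ((norm x)\<^sup>2) * (B / z)) + (\<Sum>b\<in>Basis. of_real (x \<bullet> b) * (w b / z)) + (\<Sum>b\<in>Basis. \<i> * of_real t * (w b)\<^sup>2 / z)"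
      by (simp add: cdot_def add_divide_distrib diff_divide_distrib sum_divide_distrib sum_distrib_left mult_ac)
    then have "Re ?q = - ((norm x)\<^sup>2 * Re (B / z)) + (\<Sum>b\<in>Basis. (x \<bullet> b) * Re (w b / z)) + (\<Sum>b\<in>Basis. Re (\<i> * of_real t * (w b)\<^sup>2 / z))"
      by (simp only: plus_complex.sel uminus_complex.sel Re_sum times_complex.sel Re_complex_of_real Im_complex_of_real mult_zero_left diff_0_right)
    also have "Re (B / z) = a / (norm z)\<^sup>2" unfolding z_def a_def by (rule Re_divide_gflow_denom)
    finally have Re_q: "Re ?q = - ((norm x)\<^sup>2 * (a / (norm z)\<^sup>2)) + (\<Sum>b\<in>Basis. (x \<bullet> b) * Re (w b / z))
        + (\<Sum>b\<in>Basis. Re (\<i> * of_real t * (w b)\<^sup>2 / z))" .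
    have "real m * Re ?q = D + (- \<alpha> * (norm x)\<^sup>2 + (\<Sum>b\<in>Basis. v b * (x \<bullet> b)))"
      unfolding Re_q D_def \<alpha>_def v_def by (simp add: algebra_simps sum_distrib_left)
    then have "exp (Re ?q) ^ m = exp D * exp (- \<alpha> * (norm x)\<^sup>2 + (\<Sum>b\<in>Basis. v b * (x \<bullet> b)))"
      by (simp only: exp_of_nat_mult [symmetric] exp_add [symmetric])
    moreover have "norm (gflow B w t x) = sqrt (1 / norm z) ^ DIM('a) * exp (Re ?q)"
      unfolding gflow_def z_def norm_mult norm_power norm_csqrt norm_exp_eq_Re by (simp add: norm_divide)
    ultimately show ?thesis unfolding K_def by (simp add: power_mult_distrib power_mult)
  qed
  have VV: "K * (sqrt (pi / \<alpha>) ^ DIM('a) * exp ((\<Sum>b\<in>(Basis::'a set). (v b)\<^sup>2) / (4 * \<alpha>)))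
     = sqrt (1 / norm z) ^ (DIM('a) * m) * (sqrt (pi / (real m * a)) * norm z) ^ DIM('a) * exp ((\<Sum>b\<in>(Basis::'a set). (Re (w b))\<^sup>2) / (4 * a)) ^ m"
  proof -
    have s: "sqrt (pi / \<alpha>) = sqrt (pi / (real m * a)) * norm z"
      using z unfolding \<alpha>_def by (simp add: real_sqrt_divide real_sqrt_mult)
    \<comment> \<open>Completing the square removes the dependence on \<open>t\<close>: with \<open>z = X + \<i> Y\<close> and \<open>Y = 4 a t\<close> the mixed terms cancel.\<close>
    have one: "(v b)\<^sup>2 / (4 * \<alpha>) + real m * Re (\<i> * of_real t * (w b)\<^sup>2 / z) = real m * ((Re (w b))\<^sup>2 / (4 * a))" for b
    proof -
      define p q X Y where "p = Re (w b)" and "q = Im (w b)" and "X = Re z" and "Y = Im z"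
      define N where "N = (norm z)\<^sup>2"
      have N: "N > 0" "N = X\<^sup>2 + Y\<^sup>2"
        using z by (simp add: N_def) (simp add: N_def X_def Y_def cmod_power2)
      have Y: "Y = 4 * a * t" by (simp add: Y_def z_def a_def gflow_denom_def)
      have r1: "Re (w b / z) = (p * X + q * Y) / N"
        by (simp add: Re_divide N_def p_def q_def X_def Y_def cmod_power2)
      have r2: "Re (\<i> * of_real t * (w b)\<^sup>2 / z) = - t * (2 * p * q * X - (p\<^sup>2 - q\<^sup>2) * Y) / N"
        unfolding Re_divide N_def cmod_power2
        by (simp add: p_def q_def X_def Y_def power2_eq_square algebra_simps)
      have "(p * X + q * Y)\<^sup>2 - Y * (2 * p * q * X - (p\<^sup>2 - q\<^sup>2) * Y) = p\<^sup>2 * N"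
        unfolding N(2) by (simp add: power2_eq_square algebra_simps)
      then have num: "(p * X + q * Y)\<^sup>2 = p\<^sup>2 * N + 4 * a * t * (2 * p * q * X - (p\<^sup>2 - q\<^sup>2) * Y)"
        unfolding Y by simp
      have "(v b)\<^sup>2 / (4 * \<alpha>) = real m * ((p * X + q * Y)\<^sup>2 / (4 * a * N))"
        unfolding v_def r1 \<alpha>_def N_def[symmetric] using m a N(1)
        by (simp add: power_mult_distrib power_divide power2_eq_square mult_ac)
      also have "(p * X + q * Y)\<^sup>2 / (4 * a * N) = p\<^sup>2 / (4 * a) + t * (2 * p * q * X - (p\<^sup>2 - q\<^sup>2) * Y) / N"
        unfolding num add_divide_distrib using a N(1) by simp
      finally have vb: "(v b)\<^sup>2 / (4 * \<alpha>) = real m * (p\<^sup>2 / (4 * a) + t * (2 * p * q * X - (p\<^sup>2 - q\<^sup>2) * Y) / N)" .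
      have "real m * (c + t * T / N) + real m * (- t * T / N) = real m * c" for c T
        by (simp add: algebra_simps)
      then show ?thesis unfolding vb r2 p_def[symmetric] .
    qed
    have "D + (\<Sum>b\<in>(Basis::'a set). (v b)\<^sup>2) / (4 * \<alpha>) = (\<Sum>b\<in>(Basis::'a set). (v b)\<^sup>2 / (4 * \<alpha>) + real m * Re (\<i> * of_real t * (w b)\<^sup>2 / z))"
      unfolding D_def sum.distrib sum_divide_distrib sum_distrib_left by (rule add.commute)
    also have "\<dots> = real m * ((\<Sum>b\<in>(Basis::'a set). (Re (w b))\<^sup>2) / (4 * a))"
      unfolding one sum_divide_distrib sum_distrib_left ..
    finally have E: "exp D * exp ((\<Sum>b\<in>(Basis::'a set). (v b)\<^sup>2) / (4 * \<alpha>)) = exp ((\<Sum>b\<in>(Basis::'a set). (Re (w b))\<^sup>2) / (4 * a)) ^ m"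
      by (simp only: exp_add [symmetric] exp_of_nat_mult [symmetric])
    have "c * exp D * (y * e) = c * y * (exp D * e)" for c y e :: real by (simp only: mult_ac)
    then show ?thesis unfolding K_def s E[symmetric] .
  qed
  show ?thesis using HB unfolding EE VV unfolding z_def a_def .
qed

text \<open>
  In each of the three cases the power of the modulus of \<open>gflow_denom\<close> that remains after the spatial
  integration is \<open>-2\<close>, which reflects \<open>2/q + d/p = d/2\<close>; its time integral is known.
\<close>

theorem gaussian_flow_equality:
  fixes w :: "'a::euclidean_space \<Rightarrow> complex"
  assumes adm: "admissible m r DIM('a)" and B: "Re B > 0" and A: "A \<noteq> 0"
  defines "g \<equiv> \<lambda>x. A * gflow B w 0 x"
  shows "g \<in> L2" "l2norm g > 0"
    and "mixed_norm (real m) (real (m * r)) (schroedinger_flow g) = ennreal (strichartz_const (real m) DIM('a) * l2norm g)"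
proof -
  have m: "m > 0" and r: "r > 0" using adm by (auto simp: admissible_def)
  let ?k = "m * r" and ?C = "strichartz_const (real m) DIM('a)"
  define K where "K = norm A * exp ((\<Sum>b\<in>(Basis::'a set). (Re (w b))\<^sup>2) / (4 * Re B))"
  let ?n = "\<lambda>t. norm (gflow_denom B t)"
  have K: "K > 0" using A by (simp add: K_def)
  show g: "g \<in> L2" unfolding g_def by (intro L2_cmult gflow_L2 B)
  have power: "has_bochner_integral lborel (\<lambda>x. norm (A * gflow B w t x) ^ k)
     (sqrt (1 / ?n t) ^ (DIM('a) * k) * (sqrt (pi / (real k * Re B)) * ?n t) ^ DIM('a) * K ^ k)" if "k > 0" for k t
  proof -
    have "has_bochner_integral lborel (\<lambda>x. norm A ^ k * norm (gflow B w t x) ^ k)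
       (norm A ^ k * (sqrt (1 / ?n t) ^ (DIM('a) * k) * (sqrt (pi / (real k * Re B)) * ?n t) ^ DIM('a)
         * exp ((\<Sum>b\<in>(Basis::'a set). (Re (w b))\<^sup>2) / (4 * Re B)) ^ k))"
      by (intro has_bochner_integral_mult_right gflow_norm_power_integral B that)
    then show ?thesis
      unfolding K_def norm_mult power_mult_distrib[of "norm A"] by (simp only: mult_ac)
  qed
  have norm2: "(l2norm g)\<^sup>2 = sqrt (pi / (2 * Re B)) ^ DIM('a) * K\<^sup>2"
    unfolding l2norm_square g_def using has_bochner_integral_integral_eq[OF power[of 2 0]]
    by (simp add: gflow_denom_def)
  have "(l2norm g)\<^sup>2 > 0" unfolding norm2 using K B by (intro mult_pos_pos zero_less_power) auto
  then have "l2norm g \<noteq> 0" by auto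
  then show pos: "l2norm g > 0" using l2norm_nonneg[of g] by linarith
  let ?R = "\<lambda>t. sqrt (1 / ?n t) ^ (DIM('a) * m) * (sqrt (pi / (real m * Re B)) * ?n t) ^ DIM('a) * K ^ m"
  have flow: "AE x in lborel. schroedinger_flow g t x = A * gflow B w t x" for t
    unfolding g_def by (intro schroedinger_flow_AE solution_cmult gflow_solution B)
  have inner: "(\<integral>\<^sup>+x. ennreal (norm (schroedinger_flow g t x) ^ m) \<partial>lborel) = ennreal (?R t)" for t
  proof -
    have "(\<integral>\<^sup>+x. ennreal (norm (schroedinger_flow g t x) ^ m) \<partial>lborel) = (\<integral>\<^sup>+x. ennreal (norm (A * gflow B w t x) ^ m) \<partial>lborel)"
      by (rule nn_integral_cong_AE) (use flow[of t] in eventually_elim, simp)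
    also have "\<dots> = ennreal (?R t)"
      using nn_integral_eq_integral[of lborel "\<lambda>x. norm (A * gflow B w t x) ^ m"] power[OF m, of t]
      by (simp add: has_bochner_integral_iff)
    finally show ?thesis .
  qed
  have R0: "?R t \<ge> 0" for t using B K by (intro mult_nonneg_nonneg zero_le_power) auto
  define Q where "Q = sqrt (pi / (real m * Re B)) ^ (DIM('a) * r) * K ^ ?k"
  have Rr: "?R t ^ r = Q * (1 / (?n t)\<^sup>2)" for t
  proof -
    have n: "?n t > 0" using gflow_denom_nonzero[OF B, of t] by simp
    have decay: "(sqrt (1 / ?n t) ^ (DIM('a) * m) * ?n t ^ DIM('a)) ^ r = 1 / (?n t)\<^sup>2"
    proof -
      define y S where "y = ?n t" and "S = sqrt (1 / ?n t)"
      have y: "y > 0" and S2: "S\<^sup>2 = 1 / y" using n by (simp_all add: y_def S_def)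
      have S4: "S ^ 4 = 1 / y\<^sup>2" and S6: "S ^ 6 = 1 / y ^ 3" and S8: "S ^ 8 = 1 / y ^ 4"
        using power_mult[of S 2 2] power_mult[of S 2 3] power_mult[of S 2 4] unfolding S2 power_one_over by simp_all
      from adm have "(S ^ (DIM('a) * m) * y ^ DIM('a)) ^ r = 1 / y\<^sup>2"
      proof (cases rule: admissible_cases)
        case 1
        have "S ^ 6 * y = 1 / y\<^sup>2" unfolding S6 using y by (simp add: power2_eq_square power3_eq_cube)
        then show ?thesis by (simp add: 1)
      next
        case 2
        have "(S ^ 4 * y)\<^sup>2 = 1 / y\<^sup>2" unfolding S4 using y by (simp add: power2_eq_square)
        then show ?thesis by (simp add: 2)
      next
        case 3
        have "S ^ 8 * y\<^sup>2 = 1 / y\<^sup>2" unfolding S8 using y by (simp add: power2_eq_square power4_eq_xxxx)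
        then show ?thesis by (simp add: 3)
      qed
      then show ?thesis by (simp only: y_def S_def)
    qed
    have regroup: "(s ^ (d * m) * (c * y) ^ d * k ^ m) ^ r = (s ^ (d * m) * y ^ d) ^ r * (c ^ (d * r) * k ^ (m * r))"
      for s c y k :: real and d
      by (simp add: power_mult_distrib power_mult)
    have "?R t ^ r = 1 / (?n t)\<^sup>2 * Q"
      using regroup[of "sqrt (1 / ?n t)" "DIM('a)" "sqrt (pi / (real m * Re B))" "?n t" K] unfolding decay Q_def[symmetric] .
    then show ?thesis by (rule trans) (rule mult.commute)
  qed
  have Q0: "Q \<ge> 0" using B K by (simp add: Q_def)
  have "spacetime_integral m r (schroedinger_flow g) = (\<integral>\<^sup>+t. ennreal (Q * (1 / (?n t)\<^sup>2)) \<partial>lborel)"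
    unfolding spacetime_integral_def inner ennreal_power[OF R0] Rr ..
  also have "\<dots> = ennreal (Q * (pi / (4 * Re B)))"
    using has_bochner_integral_mult_right[OF gflow_denom_integral[OF B], of Q] Q0
    by (intro nn_integral_eq_integral[THEN trans]) (auto simp: has_bochner_integral_iff)
  also have "Q * (pi / (4 * Re B)) = (?C * l2norm g) ^ ?k"
  proof -
    define s where "s = pi / (2 * Re B)"
    have s: "s > 0" "pi / (4 * Re B) = s / 2" using B by (simp_all add: s_def)
    have six: "pi / (6 * Re B) = s / 3" by (simp add: s_def)
    have root1: "sqrt (pi / (6 * Re B)) = sqrt s / sqrt 3"
      unfolding six by (rule real_sqrt_divide)
    have root2: "sqrt (pi / (4 * Re B)) ^ 2 = s / 2"
      unfolding s(2) by (rule real_sqrt_pow2) (use s(1) in simp)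
    have norm2: "(l2norm g)\<^sup>2 = sqrt s ^ DIM('a) * K\<^sup>2" using norm2 by (simp add: s_def)
    have mult3: "(x\<^sup>2) ^ 3 = x ^ 6" and mult4: "(x\<^sup>2) ^ 4 = x ^ 8" and mult2: "(x\<^sup>2)\<^sup>2 = x ^ 4" for x :: real
      using power_mult[of x 2 3] power_mult[of x 2 4] power_mult[of x 2 2] by simp_all
    have sc: "sqrt s ^ 3 = s * sqrt s" using s(1) by (simp add: power3_eq_cube)
    have ss: "sqrt s ^ 2 = s" using s(1) by simp
    from adm show ?thesis
    proof (cases rule: admissible_cases)
      case 1
      have "l2norm g ^ 6 = (sqrt s * K\<^sup>2) ^ 3" unfolding mult3[symmetric] norm2 1 by simp
      also have "\<dots> = s * sqrt s * K ^ 6"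
        unfolding power_mult_distrib mult3 sc ..
      finally have C: "(?C * l2norm g) ^ ?k = 1 / (2 * sqrt 3) * (s * sqrt s * K ^ 6)"
        unfolding power_mult_distrib 1 using strichartz_const_power(1) by simp
      have Q: "Q = sqrt s / sqrt 3 * K ^ 6" unfolding Q_def 1 using root1 by simp
      show ?thesis unfolding s(2) C Q by (simp add: mult_ac)
    next
      case 2
      have "l2norm g ^ 8 = (sqrt s * K\<^sup>2) ^ 4" unfolding mult4[symmetric] norm2 2 by simp
      also have "\<dots> = s\<^sup>2 * K ^ 8"
        unfolding power_mult_distrib mult4 mult2[of "sqrt s", symmetric] ss ..
      finally have C: "(?C * l2norm g) ^ ?k = 1 / 4 * (s\<^sup>2 * K ^ 8)"
        unfolding power_mult_distrib 2 using strichartz_const_power(2) by simp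
      have Q: "Q = s / 2 * K ^ 8" unfolding Q_def 2 using root2 by simp
      show ?thesis unfolding s(2) C Q by (simp add: power2_eq_square)
    next
      case 3
      have "l2norm g ^ 4 = (s * K\<^sup>2)\<^sup>2" unfolding mult2[symmetric] norm2 3 ss ..
      also have "\<dots> = s\<^sup>2 * K ^ 4" unfolding power_mult_distrib mult2 ..
      finally have C: "(?C * l2norm g) ^ ?k = 1 / 4 * (s\<^sup>2 * K ^ 4)"
        unfolding power_mult_distrib 3 using strichartz_const_power(3) by simp
      have Q: "Q = s / 2 * K ^ 4" unfolding Q_def 3 using root2 by simp
      show ?thesis unfolding s(2) C Q by (simp add: power2_eq_square)
    qed
  qed
  finally have st: "spacetime_integral m r (schroedinger_flow g) = ennreal ((?C * l2norm g) ^ ?k)" .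
  have CN: "0 \<le> ?C * l2norm g" by (simp add: strichartz_const_nonneg)
  have k: "?k > 0" using m r by simp
  have "((?C * l2norm g) ^ ?k) powr (1 / real ?k) = ?C * l2norm g"
    by (rule power_powr_inverse[OF CN k])
  then show "mixed_norm (real m) (real ?k) (schroedinger_flow g) = ennreal (?C * l2norm g)"
    unfolding mixed_norm_eq[OF m r] st by (simp add: ennreal_powr_ennreal CN)
qed

lemma gaussian_eq_gflow:
  fixes w :: "complex ^ 'd"
  shows "gaussian A B w = (\<lambda>x. A * gflow B (\<lambda>b. \<Sum>i\<in>UNIV. w $ i * of_real (b $ i)) 0 x)"
proof
  fix x :: "real ^ 'd"
  have "cdot (\<lambda>b. \<Sum>i\<in>UNIV. w $ i * of_real (b $ i)) x = (\<Sum>i\<in>UNIV. w $ i * of_real (x $ i))"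
  proof -
    have x: "x $ i = (\<Sum>b\<in>Basis. (x \<bullet> b) * b $ i)" for i
    proof -
      have "x $ i = (\<Sum>b\<in>Basis. (x \<bullet> b) *\<^sub>R b) $ i" by (simp add: euclidean_representation)
      then show ?thesis by simp
    qed
    have "cdot (\<lambda>b. \<Sum>i\<in>UNIV. w $ i * of_real (b $ i)) x = (\<Sum>i\<in>UNIV. \<Sum>b\<in>Basis. w $ i * of_real ((x \<bullet> b) * b $ i))"
      unfolding cdot_def sum_distrib_right by (subst sum.swap) (intro sum.cong refl, simp)
    also have "\<dots> = (\<Sum>i\<in>UNIV. w $ i * of_real (x $ i))"
      unfolding sum_distrib_left[symmetric] of_real_sum[symmetric] x[symmetric] ..
    finally show ?thesis .
  qed
  then show "gaussian A B w x = A * gflow B (\<lambda>b. \<Sum>i\<in>UNIV. w $ i * of_real (b $ i)) 0 x"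
    by (simp add: gaussian_def gflow_0)
qed

lemma strichartz_quotient_le:
  fixes f :: "'a::euclidean_space \<Rightarrow> complex"
  assumes adm: "admissible m r DIM('a)" and f: "f \<in> L2_nonzero"
  shows "strichartz_quotient (real m) (real (m * r)) f \<le> ennreal (strichartz_const (real m) DIM('a))"
proof -
  have fL: "f \<in> L2" and "l2norm f \<noteq> 0" using f by (auto simp: L2_nonzero_def l2norm_eq_0_iff)
  then have pos: "l2norm f > 0" using l2norm_nonneg[of f] by linarith
  have "strichartz_quotient (real m) (real (m * r)) f
      \<le> ennreal (strichartz_const (real m) DIM('a) * l2norm f) / ennreal (l2norm f)"
    using strichartz_inequality[OF adm fL] unfolding strichartz_quotient_def Lp_norm_2_eq[OF fL]
    by (simp add: divide_right_mono_ennreal ennreal_mult strichartz_const_nonneg)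
  also have "\<dots> = ennreal (strichartz_const (real m) DIM('a))"
    using pos by (simp add: divide_ennreal strichartz_const_nonneg)
  finally show ?thesis .
qed

theorem corollary4:
  fixes p q :: real
  assumes "(p, q, CARD('d::finite)) \<in> {(6, 6, 1), (4, 8, 1), (4, 4, 2)}"
  shows
    "(\<forall>f \<in> (L2 :: (real ^ 'd \<Rightarrow> complex) set).
        mixed_norm p q (schroedinger_flow f)
          \<le> ennreal (strichartz_const p CARD('d)) * Lp_norm 2 f) \<and>
     (\<forall>A B. \<forall>w :: complex ^ 'd. A \<noteq> 0 \<and> Re B > 0 \<longrightarrow>
        gaussian A B w \<in> L2_nonzero \<and>
        strichartz_quotient p q (gaussian A B w)
          = (SUP f \<in> (L2_nonzero :: (real ^ 'd \<Rightarrow> complex) set). strichartz_quotient p q f) \<and>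
        strichartz_quotient p q (gaussian A B w) = ennreal (strichartz_const p CARD('d)))"
proof -
  obtain m r where mr: "admissible m r CARD('d)" "p = real m" "q = real (m * r)"
  proof -
    from assms consider "p = 6" "q = 6" "CARD('d) = 1" | "p = 4" "q = 8" "CARD('d) = 1" | "p = 4" "q = 4" "CARD('d) = 2"
      by auto
    then show thesis
    proof cases
      case 1 then show thesis by (intro that[of 6 1]) (auto simp: admissible_def)
    next
      case 2 then show thesis by (intro that[of 4 2]) (auto simp: admissible_def)
    next
      case 3 then show thesis by (intro that[of 4 1]) (auto simp: admissible_def)
    qed
  qed
  have D: "DIM(real ^ 'd) = CARD('d)" by simp
  note adm = mr(1)[folded D]
  let ?C = "ennreal (strichartz_const p CARD('d))"
  have upper: "strichartz_quotient p q f \<le> ?C" if "f \<in> L2_nonzero" for f :: "real ^ 'd \<Rightarrow> complex"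
    using strichartz_quotient_le[OF adm that] unfolding mr D .
  have gauss: "gaussian A B w \<in> L2_nonzero" "strichartz_quotient p q (gaussian A B w) = ?C"
    if "A \<noteq> 0" "Re B > 0" for A B and w :: "complex ^ 'd"
  proof -
    note G = gaussian_flow_equality[OF adm that(2,1), where w = "\<lambda>b. \<Sum>i\<in>UNIV. w $ i * of_real (b $ i)", folded gaussian_eq_gflow]
    show "gaussian A B w \<in> L2_nonzero"
      using G(1,2) by (auto simp: L2_nonzero_def simp flip: l2norm_eq_0_iff)
    show "strichartz_quotient p q (gaussian A B w) = ?C"
      using G(2) unfolding strichartz_quotient_def mr G(3) Lp_norm_2_eq[OF G(1)] D
      by (simp add: divide_ennreal strichartz_const_nonneg)
  qed
  have sup: "(SUP f \<in> (L2_nonzero :: (real ^ 'd \<Rightarrow> complex) set). strichartz_quotient p q f) = ?C"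
  proof (rule antisym)
    show "(SUP f \<in> (L2_nonzero :: (real ^ 'd \<Rightarrow> complex) set). strichartz_quotient p q f) \<le> ?C"
      by (intro SUP_least upper)
    show "?C \<le> (SUP f \<in> (L2_nonzero :: (real ^ 'd \<Rightarrow> complex) set). strichartz_quotient p q f)"
      using SUP_upper[OF gauss(1)[of 1 1 0], of "strichartz_quotient p q"] gauss(2)[of 1 1 0] by simp
  qed
  show ?thesis
  proof (intro conjI ballI allI impI)
    show "mixed_norm p q (schroedinger_flow f) \<le> ?C * Lp_norm 2 f" if "f \<in> L2" for f :: "real ^ 'd \<Rightarrow> complex"
      using strichartz_inequality[OF adm that] unfolding mr D .
    fix A B :: complex and w :: "complex ^ 'd" assume AB: "A \<noteq> 0 \<and> Re B > 0"
    then show "gaussian A B w \<in> L2_nonzero" "strichartz_quotient p q (gaussian A B w) = ?C"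
      by (simp_all add: gauss)
    with AB show "strichartz_quotient p q (gaussian A B w)
        = (SUP f \<in> (L2_nonzero :: (real ^ 'd \<Rightarrow> complex) set). strichartz_quotient p q f)"
      by (simp add: sup)
  qed
qed

end
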